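(* Let $d,n\geqslant 1$ be integers and $N=d+n$. For every function $v_0\in L_2(\mathbb{R}^{N+1})$ there exists a unique $v=v(t,s,\overline x,\overline y)\in C\left(\mathbb{R};L_2(\mathbb{R}^{N+1})\right)$ (a continuous function of $t\in\mathbb{R}$ with values in the space $L_2(\mathbb{R}^{N+1})$ of functions of $(s,\overline x,\overline y)\in\mathbb{R}\times\mathbb{R}^d\times\mathbb{R}^n$) such that $$\left(\partial_t\partial_s+\partial_{x_1}^2+\ldots+\partial_{x_d}^2-\partial_{y_1}^2-\ldots-\partial_{y_n}^2\right)v=0$$ in the sense of distributions in $\mathbb{R}^{N+2}$, and $$v(0,\cdot)=v_0 \quad\text{in } L_2(\mathbb{R}^{N+1}).$$
   Context: Variables: $(t,s,\overline x,\overline y)\in\mathbb{R}\times\mathbb{R}\times\mathbb{R}^d\times\mathbb{R}^n=\mathbb{R}^{N+2}$, with $\overline x=(x_1,\ldots,x_d)$ and $\overline y=(y_1,\ldots,y_n)$. Functions are complex-valued. An element $v\in C\left(\mathbb{R};L_2(\mathbb{R}^{N+1})\right)$ is identified with a Lebesgue measurable scalar function of $(t,s,\overline x,\overline y)$ on $\mathbb{R}^{N+2}$ which, for each $t$, coincides a.e. in $(s,\overline x,\overline y)$ with the element $v(t,\cdot)$. This function belongs to $L_{2,\mathrm{loc}}(\mathbb{R}^{N+2})$ and hence is a regular distribution in $\mathbb{R}^{N+2}$. The equation in the sense of distributions means $$\int_{\mathbb{R}}dt\int_{\mathbb{R}^{N+1}} v\,(\partial_t\partial_s+\Delta_{\overline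 x}-\Delta_{\overline y})\psi\; ds\,d\overline x\,d\overline y=0$$ for all $\psi\in C_0^\infty(\mathbb{R}^{N+2})$, where $\Delta_{\overline x}=\partial_{x_1}^2+\ldots+\partial_{x_d}^2$ and $\Delta_{\overline y}=\partial_{y_1}^2+\ldots+\partial_{y_n}^2$. *)

theory Defs
  imports "HOL-Analysis.Analysis"
begin

text \<open>Elements of \<open>L\<^sub>2\<close> are represented by functions; two functions represent the same element
  iff they agree almost everywhere.\<close>

definition square_integrable :: "('a::euclidean_space \<Rightarrow> complex) \<Rightarrow> bool" where
  "square_integrable f \<longleftrightarrow>
     f \<in> borel_measurable lebesgue \<and> integrable lebesgue (\<lambda>z. (cmod (f z))\<^sup>2)"

definition L2_norm :: "('a::euclidean_space \<Rightarrow> complex) \<Rightarrow> real" where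
  "L2_norm f = sqrt (\<integral>z. (cmod (f z))\<^sup>2 \<partial>lebesgue)"

definition L2_continuous_curve :: "(real \<Rightarrow> 'a::euclidean_space \<Rightarrow> complex) \<Rightarrow> bool" where
  "L2_continuous_curve v \<longleftrightarrow>
     (\<forall>t. square_integrable (v t)) \<and>
     (\<forall>t\<^sub>0. ((\<lambda>t. L2_norm (\<lambda>z. v t z - v t\<^sub>0 z)) \<longlongrightarrow> 0) (at t\<^sub>0))"

definition dir_deriv ::
  "'a::real_normed_vector \<Rightarrow> ('a \<Rightarrow> 'b::real_normed_vector) \<Rightarrow> 'a \<Rightarrow> 'b" where
  "dir_deriv e f z = frechet_derivative f (at z) e"

primrec times_cont_diff ::
  "nat \<Rightarrow> ('a::real_normed_vector \<Rightarrow> 'b::real_normed_vector) \<Rightarrow> bool" where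
  "times_cont_diff 0 f \<longleftrightarrow> continuous_on UNIV f"
| "times_cont_diff (Suc k) f \<longleftrightarrow>
     (\<forall>z. f differentiable (at z)) \<and> (\<forall>e. times_cont_diff k (dir_deriv e f))"

definition test_function :: "('a::euclidean_space \<Rightarrow> complex) \<Rightarrow> bool" where
  "test_function \<psi> \<longleftrightarrow> (\<forall>k. times_cont_diff k \<psi>) \<and> compact (closure {z. \<psi> z \<noteq> 0})"

text \<open>A point is \<open>(t, s, x, y)\<close>; the dimensions \<open>d\<close> and \<open>n\<close> are the cardinalities of the
  (nonempty, finite) index types \<open>'d\<close> and \<open>'n\<close>.\<close>

definition ultrahyperbolic_op ::
  "(real \<times> real \<times> (real^'d) \<times> (real^'n) \<Rightarrow> complex) \<Rightarrow>
    real \<times> real \<times> (real^'d) \<times> (real^'n) \<Rightarrow> complex" where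
  "ultrahyperbolic_op \<psi> p =
     dir_deriv (1, 0, 0, 0) (dir_deriv (0, 1, 0, 0) \<psi>) p
     + (\<Sum>i\<in>UNIV. dir_deriv (0, 0, axis i 1, 0) (dir_deriv (0, 0, axis i 1, 0) \<psi>) p)
     - (\<Sum>j\<in>UNIV. dir_deriv (0, 0, 0, axis j 1) (dir_deriv (0, 0, 0, axis j 1) \<psi>) p)"

definition distributional_solution ::
  "(real \<times> real \<times> (real^'d) \<times> (real^'n) \<Rightarrow> complex) \<Rightarrow> bool" where
  "distributional_solution w \<longleftrightarrow>
     (\<forall>\<psi>. test_function \<psi> \<longrightarrow>
        (\<integral>t. (\<integral>z. w (t, z) * ultrahyperbolic_op \<psi> (t, z) \<partial>lebesgue) \<partial>lebesgue) = 0)"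

text \<open>A curve of functions need not be jointly measurable, so it is regarded as a distribution
  through a Lebesgue measurable function on the whole space that agrees with it, for each \<open>t\<close>,
  almost everywhere. Any two such functions give the same iterated integrals.\<close>

definition joint_representative ::
  "(real \<Rightarrow> 'a::euclidean_space \<Rightarrow> complex) \<Rightarrow> (real \<times> 'a \<Rightarrow> complex) \<Rightarrow> bool" where
  "joint_representative v w \<longleftrightarrow>
     w \<in> borel_measurable lebesgue \<and> (\<forall>t. AE z in lebesgue. w (t, z) = v t z)"

definition solves_equation ::
  "(real \<Rightarrow> real \<times> (real^'d) \<times> (real^'n) \<Rightarrow> complex) \<Rightarrow> bool" where
  "solves_equation v \<longleftrightarrow> (\<exists>w. joint_representative v w \<and> distributional_solution w)"

definition solves_Cauchy_problem ::
  "(real \<times> (real^'d) \<times> (real^'n) \<Rightarrow> complex) \<Rightarrow>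
    (real \<Rightarrow> real \<times> (real^'d) \<times> (real^'n) \<Rightarrow> complex) \<Rightarrow> bool" where
  "solves_Cauchy_problem v\<^sub>0 v \<longleftrightarrow>
     L2_continuous_curve v \<and> solves_equation v \<and> (AE z in lebesgue. v 0 z = v\<^sub>0 z)"

end

theory Submission
  imports Defs "HOL-Probability.Characteristic_Functions"
begin

text \<open>Let \<open>k = (\<sigma>, \<xi>, \<eta>)\<close> be the variable dual to \<open>z = (s, x, y)\<close>. The plane wave with phase
  \<open>t * \<tau> + k \<bullet> z\<close> solves the equation iff \<open>\<tau> * \<sigma> = \<bar>\<eta>\<bar>\<^sup>2 - \<bar>\<xi>\<bar>\<^sup>2\<close>. For \<open>\<sigma> \<noteq> 0\<close> there is exactly one such \<open>\<tau>\<close>, it is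
  real, and the excluded frequencies are a null set. On the Fourier side the equation is therefore an
  ordinary differential equation of first order for almost every frequency, whose solutions are multiples of
  \<open>cis (t * \<tau>)\<close>. Multiplication by this unimodular function is a unitary group, which explains why the problem
  is well posed although the operator is ultrahyperbolic, the surface \<open>t = 0\<close> is characteristic, and only
  one initial value is prescribed.

  The Fourier transform on square-integrable functions is built first. Parseval's identity for bounded
  functions of bounded support comes from a Gaussian regularisation and the continuity of translations in
  the mean (\<open>regularised_Parseval\<close>). The transform of a square-integrable function is then defined by
  duality; \<open>L2_fourier_family\<close> provides it with joint measurability in a parameter, and
  \<open>L2_fourier_inversion\<close> shows that it is onto.

  Existence: the transform of \<open>cis (t * \<tau> k) * g k\<close> is a superposition of plane waves. Paired with the
  operator applied to a test function, it leaves the space-time transform of that function at the frequencies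
  \<open>(\<tau> k, k)\<close>, where the symbol of the operator vanishes (\<open>plane_wave_superposition\<close>).

  Uniqueness: testing with \<open>\<theta> t * \<phi> (z + c)\<close> for all translations \<open>c\<close> isolates single frequencies and
  gives the equation on the Fourier side, averaged over time by \<open>\<theta>\<close> (\<open>spectral_relation\<close>). Transposed to
  functions \<open>h\<close> of the frequency, it says that the pairing of a solution with \<open>fourier h\<close> is differentiable in
  time, and that its derivative is minus the pairing with \<open>fourier (\<lambda>k. \<i> * \<tau> k * h k)\<close>
  (\<open>spectral_evolution\<close>). If \<open>\<tau>\<close> is bounded on the support of \<open>h\<close>, then the pairings for the difference of
  two solutions have derivatives of all orders that vanish at time \<open>0\<close> and grow at most geometrically, so
  these pairings are \<open>0\<close> (\<open>iterated_derivative_zero\<close>). Such \<open>h\<close> separate the square-integrable functions.\<close>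

section \<open>Square-integrable functions\<close>

definition L2 :: "('a::euclidean_space \<Rightarrow> complex) \<Rightarrow> bool" where
  "L2 f \<longleftrightarrow> f \<in> borel_measurable borel \<and> integrable lborel (\<lambda>z. (cmod (f z))\<^sup>2)"

definition sq_norm :: "('a::euclidean_space \<Rightarrow> complex) \<Rightarrow> real" where
  "sq_norm f = (\<integral>z. (cmod (f z))\<^sup>2 \<partial>lborel)"

text \<open>Bounded functions of bounded support are the test class on both sides of the Fourier
  transform. They lie in every \<open>L\<^sup>p\<close>, so their Fourier integrals converge
  absolutely; and truncating a measurable function gives a member of the class, so the class
  separates square-integrable functions.\<close>

definition nice :: "('a::euclidean_space \<Rightarrow> complex) \<Rightarrow> bool" where
  "nice u \<longleftrightarrow> u \<in> borel_measurable borel \<and> (\<exists>B. \<forall>z. cmod (u z) \<le> B) \<and>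
     (\<exists>R. \<forall>z. u z \<noteq> 0 \<longrightarrow> norm z \<le> R)"

lemma borel_measurable_cnj_compose [measurable (raw)]:
  "f \<in> borel_measurable M \<Longrightarrow> (\<lambda>x. cnj (f x)) \<in> borel_measurable M"
  by (rule measurable_compose[of f M borel cnj borel])
     (auto intro!: borel_measurable_continuous_onI continuous_intros)

lemma L2_integrable_sq: "L2 f \<Longrightarrow> integrable lborel (\<lambda>z. (cmod (f z))\<^sup>2)"
  by (simp add: L2_def)

lemma sq_norm_nonneg [simp]: "0 \<le> sq_norm f"
  by (simp add: sq_norm_def)

lemma sq_norm_cong_AE:
  assumes "AE z in lborel. f z = g z" "f \<in> borel_measurable borel" "g \<in> borel_measurable borel"
  shows "sq_norm f = sq_norm g"
  unfolding sq_norm_def using assms by (intro integral_cong_AE) auto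

lemma L2_dominated:
  assumes "L2 g" "f \<in> borel_measurable borel" "\<And>z. cmod (f z) \<le> C * cmod (g z)"
  shows "L2 f" "sq_norm f \<le> C\<^sup>2 * sq_norm g"
proof -
  have le: "(cmod (f z))\<^sup>2 \<le> C\<^sup>2 * (cmod (g z))\<^sup>2" for z
    using power_mono[OF assms(3)[of z], of 2] by (simp add: power_mult_distrib)
  have i: "integrable lborel (\<lambda>z. C\<^sup>2 * (cmod (g z))\<^sup>2)"
    using assms(1) by (simp add: L2_def)
  have i2: "integrable lborel (\<lambda>z. (cmod (f z))\<^sup>2)"
    by (rule Bochner_Integration.integrable_bound[OF i]) (use assms le in auto)
  show "L2 f" using i2 assms by (simp add: L2_def)
  have "sq_norm f \<le> (\<integral>z. C\<^sup>2 * (cmod (g z))\<^sup>2 \<partial>lborel)"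
    unfolding sq_norm_def by (intro integral_mono i i2 le)
  then show "sq_norm f \<le> C\<^sup>2 * sq_norm g" by (simp add: sq_norm_def)
qed

lemma sq_sum_le: "(cmod (a + b))\<^sup>2 \<le> 2 * (cmod a)\<^sup>2 + 2 * (cmod b)\<^sup>2"
proof -
  have "(cmod (a + b))\<^sup>2 \<le> (cmod a + cmod b)\<^sup>2"
    by (intro power_mono norm_triangle_ineq) auto
  also have "\<dots> \<le> 2 * (cmod a)\<^sup>2 + 2 * (cmod b)\<^sup>2"
    using sum_squares_bound[of "cmod a" "cmod b"] by (simp add: power2_sum)
  finally show ?thesis .
qed

lemma L2_add:
  assumes "L2 f" "L2 g"
  shows "L2 (\<lambda>z. f z + g z)" "sq_norm (\<lambda>z. f z + g z) \<le> 2 * sq_norm f + 2 * sq_norm g"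
proof -
  have i: "integrable lborel (\<lambda>z. 2 * (cmod (f z))\<^sup>2 + 2 * (cmod (g z))\<^sup>2)"
    using assms by (simp add: L2_def)
  have i2: "integrable lborel (\<lambda>z. (cmod (f z + g z))\<^sup>2)"
    by (rule Bochner_Integration.integrable_bound[OF i]) (use assms sq_sum_le in \<open>auto simp: L2_def\<close>)
  show "L2 (\<lambda>z. f z + g z)" using i2 assms by (auto simp: L2_def)
  have "sq_norm (\<lambda>z. f z + g z) \<le> (\<integral>z. 2 * (cmod (f z))\<^sup>2 + 2 * (cmod (g z))\<^sup>2 \<partial>lborel)"
    unfolding sq_norm_def by (intro integral_mono i i2 sq_sum_le)
  then show "sq_norm (\<lambda>z. f z + g z) \<le> 2 * sq_norm f + 2 * sq_norm g"
    using assms by (simp add: sq_norm_def L2_def)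
qed

lemma L2_cmult:
  assumes "L2 f"
  shows "L2 (\<lambda>z. c * f z)" "sq_norm (\<lambda>z. c * f z) = (cmod c)\<^sup>2 * sq_norm f"
  using assms by (auto simp: L2_def sq_norm_def norm_mult power_mult_distrib)

lemma L2_diff:
  assumes "L2 f" "L2 g"
  shows "L2 (\<lambda>z. f z - g z)" "sq_norm (\<lambda>z. f z - g z) \<le> 2 * sq_norm f + 2 * sq_norm g"
  using L2_add[OF assms(1) L2_cmult(1)[OF assms(2), of "-1"]] L2_cmult(2)[OF assms(2), of "-1"] by simp_all

lemma sq_norm_minus_commute: "sq_norm (\<lambda>z. f z - g z) = sq_norm (\<lambda>z. g z - f z)"
  by (simp add: sq_norm_def norm_minus_commute)

lemma L2_mult_integrable:
  assumes "L2 f" "L2 g"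
  shows "integrable lborel (\<lambda>z. f z * g z)"
proof (rule Bochner_Integration.integrable_bound)
  show "integrable lborel (\<lambda>z. (cmod (f z))\<^sup>2 + (cmod (g z))\<^sup>2)"
    using assms by (simp add: L2_def)
  show "AE z in lborel. norm (f z * g z) \<le> norm ((cmod (f z))\<^sup>2 + (cmod (g z))\<^sup>2)"
  proof (intro AE_I2)
    fix z
    have "0 \<le> cmod (f z) * cmod (g z)" "2 * (cmod (f z) * cmod (g z)) \<le> (cmod (f z))\<^sup>2 + (cmod (g z))\<^sup>2"
      using sum_squares_bound[of "cmod (f z)" "cmod (g z)"] by (auto simp: mult.assoc)
    then have "cmod (f z) * cmod (g z) \<le> (cmod (f z))\<^sup>2 + (cmod (g z))\<^sup>2" by linarith
    then show "norm (f z * g z) \<le> norm ((cmod (f z))\<^sup>2 + (cmod (g z))\<^sup>2)"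
      by (simp add: norm_mult)
  qed
qed (use assms in \<open>auto simp: L2_def\<close>)

lemma L2_Cauchy_Schwarz_real:
  assumes "L2 f" "L2 g"
  shows "(\<integral>z. cmod (f z) * cmod (g z) \<partial>lborel)\<^sup>2 \<le> sq_norm f * sq_norm g"
proof -
  have [measurable]: "f \<in> borel_measurable borel" "g \<in> borel_measurable borel"
    using assms by (auto simp: L2_def)
  have i: "integrable lborel (\<lambda>z. cmod (f z) * cmod (g z))"
    using integrable_norm[OF L2_mult_integrable[OF assms]] by (simp add: norm_mult)
  have 1: "(\<integral>\<^sup>+z. ennreal (cmod (f z)) * ennreal (cmod (g z)) \<partial>lborel)
      = ennreal (\<integral>z. cmod (f z) * cmod (g z) \<partial>lborel)"
    using nn_integral_eq_integral[OF i] by (simp add: ennreal_mult)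
  have 2: "(\<integral>\<^sup>+z. (ennreal (cmod (h z)))\<^sup>2 \<partial>lborel) = ennreal (sq_norm h)" if "L2 h" for h :: "'a \<Rightarrow> complex"
    using nn_integral_eq_integral[OF L2_integrable_sq[OF that]] by (simp add: ennreal_power sq_norm_def)
  have "(ennreal (\<integral>z. cmod (f z) * cmod (g z) \<partial>lborel))\<^sup>2 \<le> ennreal (sq_norm f) * ennreal (sq_norm g)"
    using Cauchy_Schwarz_nn_integral[of "\<lambda>z. ennreal (cmod (f z))" lborel "\<lambda>z. ennreal (cmod (g z))"]
    by (simp add: 1 2 assms)
  moreover have "0 \<le> (\<integral>z. cmod (f z) * cmod (g z) \<partial>lborel)" by simp
  ultimately show ?thesis
    by (simp add: ennreal_power ennreal_mult[symmetric])
qed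

lemma L2_Cauchy_Schwarz:
  assumes "L2 f" "L2 g"
  shows "(cmod (\<integral>z. f z * g z \<partial>lborel))\<^sup>2 \<le> sq_norm f * sq_norm g"
proof -
  have "cmod (\<integral>z. f z * g z \<partial>lborel) \<le> (\<integral>z. cmod (f z) * cmod (g z) \<partial>lborel)"
    using integral_norm_bound[of lborel "\<lambda>z. f z * g z"] by (simp add: norm_mult)
  then show ?thesis
    using L2_Cauchy_Schwarz_real[OF assms] by (meson norm_ge_zero order_trans power_mono)
qed

lemma L2_pairing_tendsto:
  assumes "\<And>n. L2 (f n)" "L2 g" "L2 p" "((\<lambda>n. sq_norm (\<lambda>z. f n z - g z)) \<longlongrightarrow> 0) F"
  shows "((\<lambda>n. \<integral>z. f n z * p z \<partial>lborel) \<longlongrightarrow> (\<integral>z. g z * p z \<partial>lborel)) F"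
proof -
  have "((\<lambda>n. sqrt (sq_norm (\<lambda>z. f n z - g z) * sq_norm p)) \<longlongrightarrow> sqrt (0 * sq_norm p)) F"
    by (intro tendsto_intros assms)
  then have t: "((\<lambda>n. sqrt (sq_norm (\<lambda>z. f n z - g z) * sq_norm p)) \<longlongrightarrow> 0) F" by simp
  have b: "cmod ((\<integral>z. f n z * p z \<partial>lborel) - (\<integral>z. g z * p z \<partial>lborel))
      \<le> sqrt (sq_norm (\<lambda>z. f n z - g z) * sq_norm p)" for n
  proof -
    have "(\<integral>z. f n z * p z \<partial>lborel) - (\<integral>z. g z * p z \<partial>lborel) = (\<integral>z. (f n z - g z) * p z \<partial>lborel)"
      by (subst Bochner_Integration.integral_diff[symmetric])
         (auto intro!: L2_mult_integrable assms simp: algebra_simps)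
    then show ?thesis
      using L2_Cauchy_Schwarz[OF L2_diff(1)[OF assms(1)[of n] assms(2)] assms(3)] by (simp add: real_le_rsqrt)
  qed
  have "((\<lambda>n. (\<integral>z. f n z * p z \<partial>lborel) - (\<integral>z. g z * p z \<partial>lborel)) \<longlongrightarrow> 0) F"
    by (rule Lim_null_comparison[OF _ t]) (use b in auto)
  then show ?thesis by (simp add: LIM_zero_iff)
qed

lemma nice_integrable:
  assumes "nice u" shows "integrable lborel u"
proof -
  obtain B R where B: "\<And>z. cmod (u z) \<le> B" and R: "\<And>z. u z \<noteq> 0 \<Longrightarrow> norm z \<le> R"
    using assms by (auto simp: nice_def)
  have "integrable lborel (\<lambda>z::'a. indicator (cball 0 R) z *\<^sub>R B)"
    using emeasure_lborel_cball_finite[of "0::'a" R] by (intro integrable_scaleR_left) (auto simp: less_top)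
  then show ?thesis
  proof (rule Bochner_Integration.integrable_bound)
    show "AE z in lborel. norm (u z) \<le> norm (indicator (cball 0 R) z *\<^sub>R B)"
    proof (intro AE_I2)
      fix z show "norm (u z) \<le> norm (indicator (cball 0 R) z *\<^sub>R B)"
        using B[of z] R[of z] by (cases "u z = 0") (auto simp: indicator_def)
    qed
  qed (use assms in \<open>auto simp: nice_def\<close>)
qed

lemma nice_mult_bounded:
  assumes "nice u" "v \<in> borel_measurable borel" "\<And>z. u z \<noteq> 0 \<Longrightarrow> cmod (v z) \<le> B"
  shows "nice (\<lambda>z. v z * u z)"
proof -
  obtain B' R where B: "\<And>z. cmod (u z) \<le> B'" and R: "\<And>z. u z \<noteq> 0 \<Longrightarrow> norm z \<le> R"
    using assms by (auto simp: nice_def)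
  have "cmod (v z * u z) \<le> \<bar>B\<bar> * \<bar>B'\<bar>" for z
    using B[of z] assms(3)[of z] by (cases "u z = 0") (auto simp: norm_mult intro!: mult_mono)
  then show ?thesis
    unfolding nice_def using assms R by (auto simp: nice_def)
qed

lemma nice_cnj: "nice u \<Longrightarrow> nice (\<lambda>z. cnj (u z))"
  unfolding nice_def by auto

lemma nice_L2:
  assumes "nice u" shows "L2 u"
proof -
  obtain B where B: "\<And>z. cmod (u z) \<le> B"
    using assms by (auto simp: nice_def)
  have "integrable lborel (\<lambda>z. cnj (u z) * u z)"
    using B assms by (intro nice_integrable nice_mult_bounded[where B=B]) (auto simp: nice_def)
  then have "integrable lborel (\<lambda>z. cmod (cnj (u z) * u z))" by (rule integrable_norm)
  then show ?thesis using assms by (simp add: L2_def norm_mult power2_eq_square nice_def)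
qed

lemma nice_continuous_compact:
  assumes "continuous_on UNIV u" "compact K" "\<And>z. z \<notin> K \<Longrightarrow> u z = 0"
  shows "nice u"
proof -
  have "compact (u ` K)" using assms continuous_on_subset compact_continuous_image by blast
  then obtain B where B: "\<And>z. z \<in> K \<Longrightarrow> cmod (u z) \<le> B"
    by (force dest!: compact_imp_bounded simp: bounded_iff)
  obtain R where R: "\<And>z. z \<in> K \<Longrightarrow> norm z \<le> R"
    using assms(2) by (force dest!: compact_imp_bounded simp: bounded_iff)
  have "cmod (u z) \<le> \<bar>B\<bar>" for z using B[of z] assms(3)[of z] by (cases "z \<in> K") auto
  then show ?thesis
    unfolding nice_def using assms(1,3) R by (auto intro!: borel_measurable_continuous_onI)
qed

text \<open>The cut depends on a dominating function \<open>G\<close> and not on the function that is cut,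
  so that all members of a family dominated by \<open>G\<close> can be truncated by the same
  sets.\<close>

definition trunc :: "('a::euclidean_space \<Rightarrow> 'b::real_normed_vector) \<Rightarrow> nat \<Rightarrow> 'a set" where
  "trunc G n = {z. norm z \<le> real n \<and> norm (G z) \<le> real n}"

lemma trunc_measurable [measurable]:
  assumes [measurable]: "G \<in> borel_measurable borel" shows "trunc G n \<in> sets borel"
proof -
  have "{z\<in>space borel. norm z \<le> real n \<and> norm (G z) \<le> real n} \<in> sets borel" by measurable
  then show ?thesis by (simp add: trunc_def)
qed

lemma trunc_mono: "m \<le> n \<Longrightarrow> trunc G m \<subseteq> trunc G n"
  by (auto simp: trunc_def)

lemma eventually_in_trunc: "eventually (\<lambda>n. z \<in> trunc G n) sequentially"
proof -
  obtain m where "norm z \<le> real m" "norm (G z) \<le> real m"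
    using real_arch_simple[of "max (norm z) (norm (G z))"] by auto
  then show ?thesis
    by (intro eventually_sequentiallyI[of m]) (auto simp: trunc_def)
qed

lemma nice_trunc:
  assumes "f \<in> borel_measurable borel" "G \<in> borel_measurable borel" "\<And>z. cmod (f z) \<le> norm (G z)"
  shows "nice (\<lambda>z. indicator (trunc G n) z * f z)"
  unfolding nice_def
proof (intro conjI)
  show "\<exists>B. \<forall>z. cmod (indicator (trunc G n) z * f z) \<le> B"
    using assms(3) by (intro exI[of _ "real n"]) (auto simp: indicator_def trunc_def intro: order_trans)
  show "\<exists>R. \<forall>z. indicator (trunc G n) z * f z \<noteq> 0 \<longrightarrow> norm z \<le> R"
    by (intro exI[of _ "real n"]) (auto simp: indicator_def trunc_def)
qed (use assms in measurable)

lemma nice_trunc_self: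
  assumes "f \<in> borel_measurable borel" 
  shows "nice (\<lambda>z. indicator (trunc f n) z * f z)"
  by (rule nice_trunc) (use assms in auto)

lemma sq_norm_trunc_tendsto:
  assumes "L2 f" "G \<in> borel_measurable borel"
  shows "(\<lambda>n. sq_norm (\<lambda>z. indicator (trunc G n) z * f z - f z)) \<longlonglongrightarrow> 0"
proof -
  have [measurable]: "f \<in> borel_measurable borel" "G \<in> borel_measurable borel"
    using assms by (auto simp: L2_def)
  have "(\<lambda>n. sq_norm (\<lambda>z. indicator (trunc G n) z * f z - f z)) \<longlonglongrightarrow> (\<integral>z. 0 \<partial>(lborel::'a measure))"
    unfolding sq_norm_def
  proof (rule integral_dominated_convergence)
    show "integrable lborel (\<lambda>z. (cmod (f z))\<^sup>2)" using assms by (simp add: L2_def)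
    show "AE z in lborel. (\<lambda>n. (cmod (indicator (trunc G n) z * f z - f z))\<^sup>2) \<longlonglongrightarrow> 0"
    proof (intro AE_I2)
      fix z
      have "eventually (\<lambda>n. (cmod (indicator (trunc G n) z * f z - f z))\<^sup>2 = 0) sequentially"
        using eventually_in_trunc[of z G] by eventually_elim simp
      then show "(\<lambda>n. (cmod (indicator (trunc G n) z * f z - f z))\<^sup>2) \<longlonglongrightarrow> 0"
        by (rule tendsto_eventually)
    qed
  qed (auto simp: indicator_def)
  then show ?thesis by simp
qed

text \<open>Testing against a truncation \<open>u\<close> of \<open>cnj f\<close> gives \<open>(sq_norm
  u)\<^sup>2 \<le> B * sq_norm u\<close>, and \<open>sq_norm u\<close> tends to \<open>sq_norm
  f\<close>.\<close>

lemma sq_norm_le_of_duality: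
  assumes "L2 f" "0 \<le> B" "\<And>u. nice u \<Longrightarrow> (cmod (\<integral>z. f z * u z \<partial>lborel))\<^sup>2 \<le> B * sq_norm u"
  shows "sq_norm f \<le> B"
proof -
  have [measurable]: "f \<in> borel_measurable borel" using assms by (auto simp: L2_def)
  define u where "u n z = indicator (trunc f n) z * cnj (f z)" for n z
  have u: "nice (u n)" for n
    unfolding u_def by (rule nice_trunc) auto
  have e: "f z * u n z = complex_of_real ((cmod (u n z))\<^sup>2)" for n z
    by (auto simp: u_def indicator_def complex_norm_square[symmetric])
  have "sq_norm (u n) \<le> B" for n
  proof -
    have "(\<integral>z. f z * u n z \<partial>lborel) = complex_of_real (sq_norm (u n))"
      unfolding e sq_norm_def by (rule integral_complex_of_real)
    then have "(sq_norm (u n))\<^sup>2 \<le> B * sq_norm (u n)"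
      using assms(3)[OF u[of n]] by simp
    then show ?thesis
      using sq_norm_nonneg[of "u n"] assms(2) by (cases "sq_norm (u n) = 0") (auto simp: power2_eq_square)
  qed
  moreover have "(\<lambda>n. sq_norm (u n)) \<longlonglongrightarrow> sq_norm f"
    unfolding sq_norm_def
  proof (rule integral_dominated_convergence)
    show "integrable lborel (\<lambda>z. (cmod (f z))\<^sup>2)" using assms by (simp add: L2_def)
    show "AE z in lborel. (\<lambda>n. (cmod (u n z))\<^sup>2) \<longlonglongrightarrow> (cmod (f z))\<^sup>2"
    proof (intro AE_I2 tendsto_eventually)
      fix z
      show "eventually (\<lambda>n. (cmod (u n z))\<^sup>2 = (cmod (f z))\<^sup>2) sequentially"
        using eventually_in_trunc[of z f] by eventually_elim (simp add: u_def)
    qed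
  qed (auto simp: indicator_def u_def)
  ultimately show ?thesis by (intro LIMSEQ_le_const2[of _ "sq_norm f" B]) auto
qed

lemma L2_AE_zero:
  assumes "L2 f" "sq_norm f = 0" shows "AE z in lborel. f z = 0"
  using assms by (simp add: L2_def sq_norm_def integral_nonneg_eq_0_iff_AE)

lemma L2_AE_zero_of_duality:
  assumes "L2 f" "\<And>u. nice u \<Longrightarrow> (\<integral>z. f z * u z \<partial>lborel) = 0"
  shows "AE z in lborel. f z = 0"
  using sq_norm_le_of_duality[of f 0] L2_AE_zero[of f] assms by (simp add: order_antisym)

lemma L2_reflect:
  assumes "L2 f" shows "L2 (\<lambda>z. f (- z))"
proof -
  have "integrable lborel (\<lambda>z. (cmod (f z))\<^sup>2)" using assms by (simp add: L2_def)
  then have "integrable (distr lborel borel (\<lambda>z. - z)) (\<lambda>z. (cmod (f z))\<^sup>2)"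
    using lborel_affine[of "-1" "0::'a"] by (simp add: density_1)
  then show ?thesis using assms by (auto simp: L2_def integrable_distr_eq)
qed

lemma lborel_reflect: "distr lborel borel (\<lambda>z. - z) = (lborel :: 'a::euclidean_space measure)"
  using lborel_affine[of "-1" "0::'a"] by (simp add: density_1)

lemma integral_reflect:
  fixes f :: "'a::euclidean_space \<Rightarrow> 'b::{banach,second_countable_topology}"
  assumes "f \<in> borel_measurable borel"
  shows "(\<integral>z. f (- z) \<partial>lborel) = (\<integral>z. f z \<partial>lborel)"
  by (subst (2) lborel_reflect[symmetric], subst integral_distr) (use assms in auto)

lemma nice_reflect: "nice u \<Longrightarrow> nice (\<lambda>z. u (- z))"
  unfolding nice_def by (auto simp: measurable_compose[of uminus borel borel]) (metis norm_minus_cancel)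

section \<open>Continuity of translations in the mean\<close>

lemma borel_measurable_cis_compose [measurable (raw)]:
  "f \<in> borel_measurable M \<Longrightarrow> (\<lambda>x. cis (f x)) \<in> borel_measurable M"
  by (rule measurable_compose[of f M borel cis borel])
     (auto intro!: borel_measurable_continuous_onI continuous_intros)

lemma integral_translate:
  fixes f :: "'a::euclidean_space \<Rightarrow> 'b::{banach,second_countable_topology}"
  assumes "f \<in> borel_measurable borel"
  shows "(\<integral>z. f (z + h) \<partial>lborel) = (\<integral>z. f z \<partial>lborel)"
  by (subst (2) lborel_distr_plus[symmetric, of h], subst integral_distr)
     (use assms in \<open>auto simp: add.commute\<close>)

lemma integrable_translate:
  fixes f :: "'a::euclidean_space \<Rightarrow> 'b::{banach,second_countable_topology}"
  assumes "integrable lborel f"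
  shows "integrable lborel (\<lambda>z. f (z + h))"
proof -
  have "integrable (distr lborel borel ((+) h)) f" using assms by (simp add: lborel_distr_plus)
  then show ?thesis
    using assms by (subst (asm) integrable_distr_eq) (auto simp: add.commute)
qed

definition L1_translation_continuous :: "('a::euclidean_space \<Rightarrow> complex) \<Rightarrow> bool" where
  "L1_translation_continuous f \<longleftrightarrow>
     (\<forall>d. d \<longlonglongrightarrow> 0 \<longrightarrow> (\<lambda>n. \<integral>z. cmod (f (z + d n) - f z) \<partial>lborel) \<longlonglongrightarrow> 0)"

text \<open>An error of size \<open>e\<close> in the \<open>L\<^sup>1\<close> norm is not enlarged by a
  translation, so continuity of translations only has to be shown for approximants.\<close>

lemma L1_translation_continuous_limit:
  fixes f :: "'a::euclidean_space \<Rightarrow> complex"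
  assumes f: "integrable lborel f"
    and approx: "\<And>e. e > 0 \<Longrightarrow> \<exists>g. integrable lborel g \<and> L1_translation_continuous g \<and>
                   (\<integral>z. cmod (f z - g z) \<partial>lborel) < e"
  shows "L1_translation_continuous f"
  unfolding L1_translation_continuous_def
proof (intro allI impI)
  fix d :: "nat \<Rightarrow> 'a" assume d: "d \<longlonglongrightarrow> 0"
  show "(\<lambda>n. \<integral>z. cmod (f (z + d n) - f z) \<partial>lborel) \<longlonglongrightarrow> 0"
  proof (rule LIMSEQ_I)
    fix r :: real assume "r > 0"
    then obtain g where g: "integrable lborel g" "L1_translation_continuous g"
        "(\<integral>z. cmod (f z - g z) \<partial>lborel) < r/3"
      using approx[of "r/3"] by auto
    have [measurable]: "f \<in> borel_measurable borel" "g \<in> borel_measurable borel"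
      using f g by (auto dest: borel_measurable_integrable)
    have "(\<lambda>n. \<integral>z. cmod (g (z + d n) - g z) \<partial>lborel) \<longlonglongrightarrow> 0"
      using g d by (simp add: L1_translation_continuous_def)
    then obtain N where N: "\<And>n. n \<ge> N \<Longrightarrow> norm ((\<integral>z. cmod (g (z + d n) - g z) \<partial>lborel) - 0) < r/3"
      using LIMSEQ_D[of _ 0 "r/3"] \<open>r > 0\<close> by (meson divide_pos_pos zero_less_numeral)
    have "norm ((\<integral>z. cmod (f (z + d n) - f z) \<partial>lborel) - 0) < r" if "n \<ge> N" for n
    proof -
      have i1: "integrable lborel (\<lambda>z. cmod (f z - g z))" using f g by simp
      have i2: "integrable lborel (\<lambda>z. cmod (f (z + d n) - g (z + d n)))"
        using integrable_translate[OF i1, of "d n"] by simp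
      have i3: "integrable lborel (\<lambda>z. cmod (g (z + d n) - g z))"
        using integrable_translate[OF g(1), of "d n"] g by simp
      have i4: "integrable lborel (\<lambda>z. cmod (f (z + d n) - f z))"
        using integrable_translate[OF f, of "d n"] f by simp
      have "(\<integral>z. cmod (f (z + d n) - f z) \<partial>lborel)
          \<le> (\<integral>z. cmod (f (z + d n) - g (z + d n)) + cmod (g (z + d n) - g z) + cmod (f z - g z) \<partial>lborel)"
      proof (rule integral_mono[OF i4])
        fix z
        have "f (z + d n) - f z = (f (z + d n) - g (z + d n)) + (g (z + d n) - g z) - (f z - g z)" by simp
        then show "cmod (f (z + d n) - f z) \<le> cmod (f (z + d n) - g (z + d n)) + cmod (g (z + d n) - g z) + cmod (f z - g z)"
          by (smt (verit) norm_triangle_ineq norm_triangle_ineq4)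
      qed (use i1 i2 i3 in auto)
      also have "\<dots> = (\<integral>z. cmod (f (z + d n) - g (z + d n)) \<partial>lborel)
          + (\<integral>z. cmod (g (z + d n) - g z) \<partial>lborel) + (\<integral>z. cmod (f z - g z) \<partial>lborel)"
        using i1 i2 i3 by simp
      also have "(\<integral>z. cmod (f (z + d n) - g (z + d n)) \<partial>lborel) = (\<integral>z. cmod (f z - g z) \<partial>lborel)"
        by (rule integral_translate) measurable
      finally show ?thesis using N[OF that] g(3) by simp
    qed
    then show "\<exists>no. \<forall>n\<ge>no. norm ((\<integral>z. cmod (f (z + d n) - f z) \<partial>lborel) - 0) < r" by blast
  qed
qed

text \<open>The indicator of an open set is lower semicontinuous, so the part of \<open>U\<close> that a
  small shift moves out of \<open>U\<close> shrinks to nothing, pointwise and therefore in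
  measure. The part moved into \<open>U\<close> has the same measure, because Lebesgue measure
  is translation invariant.\<close>

lemma L1_translation_continuous_open:
  fixes U :: "'a::euclidean_space set"
  assumes U: "open U" and fin: "emeasure lborel U < \<infinity>"
  shows "L1_translation_continuous (\<lambda>z. indicator U z *\<^sub>R c)"
  unfolding L1_translation_continuous_def
proof (intro allI impI)
  fix d :: "nat \<Rightarrow> 'a" assume d: "d \<longlonglongrightarrow> 0"
  let ?i = "indicator U :: 'a \<Rightarrow> real"
  have [measurable]: "U \<in> sets borel" using U by simp
  have iU: "integrable lborel ?i" using fin by (auto simp: less_top)
  \<comment> \<open>The mass that the shift moves out of \<open>U\<close>; twice its integral is the whole difference.\<close>
  define p where "p n z = max (?i z - ?i (z + d n)) 0" for n z
  have [measurable]: "p n \<in> borel_measurable borel" for n unfolding p_def by measurable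
  have bp: "norm (p n z) \<le> ?i z" for n z by (auto simp: p_def indicator_def)
  have ip: "integrable lborel (p n)" for n
    by (rule Bochner_Integration.integrable_bound[OF iU]) (auto simp: p_def indicator_def)
  have eq: "(\<integral>z. cmod (indicator U (z + d n) *\<^sub>R c - indicator U z *\<^sub>R c) \<partial>lborel)
      = 2 * cmod c * (\<integral>z. p n z \<partial>lborel)" for n
  proof -
    have "cmod (indicator U (z + d n) *\<^sub>R c - indicator U z *\<^sub>R c)
        = cmod c * (2 * p n z + (?i (z + d n) - ?i z))" for z
      by (auto simp: p_def indicator_def)
    moreover have "(\<integral>z. 2 * p n z + (?i (z + d n) - ?i z) \<partial>lborel) = 2 * (\<integral>z. p n z \<partial>lborel)"
      using ip[of n] iU integrable_translate[OF iU, of "d n"] integral_translate[of ?i "d n"] by simp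
    ultimately show ?thesis by simp
  qed
  have "(\<lambda>n. \<integral>z. p n z \<partial>lborel) \<longlonglongrightarrow> (\<integral>z. 0 \<partial>(lborel::'a measure))"
  proof (rule integral_dominated_convergence[OF _ _ iU])
    show "AE z in lborel. (\<lambda>n. p n z) \<longlonglongrightarrow> 0"
    proof (intro AE_I2 tendsto_eventually)
      fix z
      show "eventually (\<lambda>n. p n z = 0) sequentially"
      proof (cases "z \<in> U")
        case True
        have "(\<lambda>n. z + d n) \<longlonglongrightarrow> z + 0" by (intro tendsto_intros d)
        then have "eventually (\<lambda>n. z + d n \<in> U) sequentially"
          using U True by (auto dest: topological_tendstoD)
        then show ?thesis by eventually_elim (use True in \<open>simp add: p_def\<close>)
      qed (simp add: p_def)
    qed
  qed (use bp in \<open>auto simp: p_def\<close>)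
  then have "(\<lambda>n. 2 * cmod c * (\<integral>z. p n z \<partial>lborel)) \<longlonglongrightarrow> 2 * cmod c * 0"
    by (intro tendsto_intros) simp
  then show "(\<lambda>n. \<integral>z. cmod (indicator U (z + d n) *\<^sub>R c - indicator U z *\<^sub>R c) \<partial>lborel) \<longlonglongrightarrow> 0"
    unfolding eq by simp
qed

text \<open>Outer regularity leads from open sets to Borel sets of finite measure; linear combinations and
  dominated limits of their indicators exhaust the integrable functions.\<close>

lemma L1_translation_continuous_integrable:
  fixes f :: "'a::euclidean_space \<Rightarrow> complex"
  assumes "integrable lborel f"
  shows "L1_translation_continuous f"
  using assms
proof (induction rule: integrable_induct)
  case (base A c)
  then have A: "A \<in> sets borel" by simp
  have iA: "integrable lborel (indicator A :: 'a \<Rightarrow> real)" using base by (auto simp: less_top)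
  show ?case
  proof (rule L1_translation_continuous_limit)
    show "integrable lborel (\<lambda>z. indicator A z *\<^sub>R c)" using iA by simp
    fix e :: real assume e: "e > 0"
    define e' where "e' = e / (cmod c + 1)"
    have e': "e' > 0" using e by (auto simp: e'_def intro!: divide_pos_pos add_nonneg_pos)
    obtain U where U: "open U" "A \<subseteq> U" "emeasure lborel (U - A) < e'"
      using outer_regular_lborel[OF A e'] by blast
    have mU: "U \<in> sets lborel" "U - A \<in> sets lborel" using U A by auto
    have "emeasure lborel U = emeasure lborel (U - A) + emeasure lborel A"
      using U A mU by (subst plus_emeasure) (auto intro!: arg_cong2[where f=emeasure])
    moreover have "emeasure lborel (U - A) < \<infinity>" by (rule less_trans[OF U(3)]) simp
    ultimately have fin: "emeasure lborel U < \<infinity>" using base by (simp add: ennreal_add_less_top)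
    have "(\<integral>z. cmod (indicator A z *\<^sub>R c - indicator U z *\<^sub>R c) \<partial>lborel)
        = (\<integral>z. cmod c * indicator (U - A) z \<partial>lborel)"
      by (intro Bochner_Integration.integral_cong) (use U(2) in \<open>auto simp: indicator_def\<close>)
    also have "\<dots> = cmod c * measure lborel (U - A)" using mU by simp
    also have "\<dots> \<le> cmod c * e'"
    proof (intro mult_left_mono)
      show "measure lborel (U - A) \<le> e'"
        unfolding measure_def using U(3) e' by (intro enn2real_leI) auto
    qed simp
    also have "\<dots> < (cmod c + 1) * e'" using e' by (simp add: algebra_simps)
    also have "\<dots> = e" using norm_ge_zero[of c] unfolding e'_def by (simp add: add_nonneg_eq_0_iff)
    finally show "\<exists>g. integrable lborel g \<and> L1_translation_continuous g \<and>
        (\<integral>z. cmod (indicator A z *\<^sub>R c - g z) \<partial>lborel) < e"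
      using L1_translation_continuous_open[OF U(1) fin, of c] fin U(1)
      by (intro exI[of _ "\<lambda>z. indicator U z *\<^sub>R c"]) (auto simp: less_top)
  qed
next
  case (add f g)
  show ?case
    unfolding L1_translation_continuous_def
  proof (intro allI impI)
    fix d :: "nat \<Rightarrow> 'a" assume d: "d \<longlonglongrightarrow> 0"
    have i: "integrable lborel (\<lambda>z. h (z + d n) - h z)" if "integrable lborel h" for h :: "'a \<Rightarrow> complex" and n
      using integrable_translate[OF that, of "d n"] that by simp
    have "(\<lambda>n. (\<integral>z. cmod (f (z + d n) - f z) \<partial>lborel) + (\<integral>z. cmod (g (z + d n) - g z) \<partial>lborel)) \<longlonglongrightarrow> 0 + 0"
      using add d by (intro tendsto_add) (auto simp: L1_translation_continuous_def)
    then have t: "(\<lambda>n. (\<integral>z. cmod (f (z + d n) - f z) \<partial>lborel) + (\<integral>z. cmod (g (z + d n) - g z) \<partial>lborel)) \<longlonglongrightarrow> 0" by simp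
    show "(\<lambda>n. \<integral>z. cmod (f (z + d n) + g (z + d n) - (f z + g z)) \<partial>lborel) \<longlonglongrightarrow> 0"
    proof (rule Lim_null_comparison[OF _ t], intro always_eventually allI)
      fix n
      have "(\<integral>z. cmod (f (z + d n) + g (z + d n) - (f z + g z)) \<partial>lborel)
         \<le> (\<integral>z. cmod (f (z + d n) - f z) + cmod (g (z + d n) - g z) \<partial>lborel)"
      proof (rule integral_mono)
        show "integrable lborel (\<lambda>z. cmod (f (z + d n) + g (z + d n) - (f z + g z)))"
          using i[of "\<lambda>z. f z + g z" n] add by simp
        show "integrable lborel (\<lambda>z. cmod (f (z + d n) - f z) + cmod (g (z + d n) - g z))"
          using i add by simp
      qed (simp add: add_diff_add norm_triangle_ineq)
      also have "\<dots> = (\<integral>z. cmod (f (z + d n) - f z) \<partial>lborel) + (\<integral>z. cmod (g (z + d n) - g z) \<partial>lborel)"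
        using i add by simp
      finally show "norm (\<integral>z. cmod (f (z + d n) + g (z + d n) - (f z + g z)) \<partial>lborel)
        \<le> (\<integral>z. cmod (f (z + d n) - f z) \<partial>lborel) + (\<integral>z. cmod (g (z + d n) - g z) \<partial>lborel)" by simp
    qed
  qed
next
  case (lim f s)
  show ?case
  proof (rule L1_translation_continuous_limit[OF lim(4)])
    fix e :: real assume e: "e > 0"
    have [measurable]: "f \<in> borel_measurable borel" "\<And>i. s i \<in> borel_measurable borel"
      using lim(1,4) by (auto dest: borel_measurable_integrable)
    have "(\<lambda>i. \<integral>z. cmod (f z - s i z) \<partial>lborel) \<longlonglongrightarrow> (\<integral>z. 0 \<partial>(lborel::'a measure))"
    proof (rule integral_dominated_convergence)
      show "integrable lborel (\<lambda>z. 3 * cmod (f z))" using lim(4) by simp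
      show "AE z in lborel. (\<lambda>i. cmod (f z - s i z)) \<longlonglongrightarrow> 0"
      proof (intro AE_I2)
        fix z :: 'a
        have "(\<lambda>i. s i z) \<longlonglongrightarrow> f z" using lim(2)[of z] by simp
        then have "(\<lambda>i. cmod (f z - s i z)) \<longlonglongrightarrow> cmod (f z - f z)" by (intro tendsto_intros)
        then show "(\<lambda>i. cmod (f z - s i z)) \<longlonglongrightarrow> 0" by simp
      qed
      show "AE z in lborel. norm (cmod (f z - s i z)) \<le> 3 * cmod (f z)" for i
      proof (intro AE_I2)
        fix z :: 'a
        show "norm (cmod (f z - s i z)) \<le> 3 * cmod (f z)"
          using lim(3)[of z i] norm_triangle_ineq4[of "f z" "s i z"] by simp
      qed
    qed auto
    then have "eventually (\<lambda>i. (\<integral>z. cmod (f z - s i z) \<partial>lborel) < e) sequentially"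
      using e by (intro order_tendstoD(2)[of _ 0]) auto
    then obtain i where "(\<integral>z. cmod (f z - s i z) \<partial>lborel) < e"
      using eventually_happens'[OF sequentially_bot] by blast
    then show "\<exists>g. integrable lborel g \<and> L1_translation_continuous g \<and> (\<integral>z. cmod (f z - g z) \<partial>lborel) < e"
      using lim(1)[of i] lim(5)[of i] by (intro exI[of _ "s i"]) simp
  qed
qed

section \<open>The Fourier transform of the Gaussian\<close>

definition gauss :: "'a::euclidean_space \<Rightarrow> real" where
  "gauss z = exp (- (z \<bullet> z) / 2)"

lemma gauss_measurable [measurable]: "gauss \<in> borel_measurable borel"
  unfolding gauss_def[abs_def] by measurable

text \<open>This is the characteristic function of the standard normal distribution without the
  normalising factor.\<close>

lemma has_bochner_integral_gauss_1d:
  "has_bochner_integral lborel (\<lambda>x. exp (\<i> * complex_of_real (t * x) + complex_of_real (- x\<^sup>2 / 2)))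
     (complex_of_real (sqrt (2 * pi) * exp (- t\<^sup>2 / 2)))"
proof -
  interpret real_distribution std_normal_distribution by (rule real_dist_normal_dist)
  have e: "exp (\<i> * complex_of_real (t * x) + complex_of_real (- x\<^sup>2 / 2))
      = sqrt (2 * pi) * (std_normal_density x *\<^sub>R iexp (t * x))" for x
    unfolding exp_add exp_of_real std_normal_density_def by (simp add: scaleR_conv_of_real)
  have "integrable std_normal_distribution (\<lambda>x. iexp (t * x))" 
    by (rule integrable_const_bound[of _ 1]) auto
  then have i: "integrable lborel (\<lambda>x. std_normal_density x *\<^sub>R iexp (t * x))"
    by (subst (asm) integrable_density) auto
  have "char std_normal_distribution t = (\<integral>x. std_normal_density x *\<^sub>R iexp (t * x) \<partial>lborel)"
    unfolding char_def by (subst integral_density) auto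
  then have "has_bochner_integral lborel (\<lambda>x. std_normal_density x *\<^sub>R iexp (t * x)) (complex_of_real (exp (- t\<^sup>2 / 2)))"
    using i by (simp add: char_std_normal_distribution has_bochner_integral_iff)
  from has_bochner_integral_mult_right[OF this, of "complex_of_real (sqrt (2 * pi))"]
  show ?thesis by (subst e, subst of_real_mult) simp
qed

text \<open>Both the Gaussian and the character are products over the coordinates.\<close>

lemma has_bochner_integral_gauss:
  fixes x :: "'a::euclidean_space"
  shows "has_bochner_integral lborel (\<lambda>k. cis (x \<bullet> k) * complex_of_real (gauss k))
           (complex_of_real (sqrt (2 * pi) ^ DIM('a) * gauss x))"
proof -
  interpret product_sigma_finite "\<lambda>_::'a. lborel :: real measure"
    by (simp add: product_sigma_finite_def sigma_finite_lborel)
  let ?f = "\<lambda>b y. exp (\<i> * complex_of_real ((x \<bullet> b) * y) + complex_of_real (- y\<^sup>2 / 2))"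
  let ?e = "\<lambda>f. \<Sum>b\<in>Basis. f b *\<^sub>R b :: 'a"
  have e: "cis (x \<bullet> ?e f) * complex_of_real (gauss (?e f)) = (\<Prod>b\<in>Basis. ?f b (f b))" for f
  proof -
    have 1: "x \<bullet> ?e f = (\<Sum>b\<in>Basis. (x \<bullet> b) * f b)" by (simp add: inner_sum_right mult.commute)
    have "?e f \<bullet> ?e f = (\<Sum>b\<in>Basis. (?e f \<bullet> b) * (?e f \<bullet> b))" by (rule euclidean_inner)
    also have "\<dots> = (\<Sum>b\<in>Basis. (f b)\<^sup>2)" by (intro sum.cong refl) (simp add: power2_eq_square)
    finally have 2: "?e f \<bullet> ?e f = (\<Sum>b\<in>Basis. (f b)\<^sup>2)" .
    have "cis (x \<bullet> ?e f) * complex_of_real (gauss (?e f))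
        = exp (\<i> * complex_of_real (\<Sum>b\<in>Basis. (x \<bullet> b) * f b) + complex_of_real (- (\<Sum>b\<in>Basis. (f b)\<^sup>2) / 2))"
      unfolding exp_add exp_of_real cis_conv_exp gauss_def 1 2 ..
    also have "\<i> * complex_of_real (\<Sum>b\<in>Basis. (x \<bullet> b) * f b) + complex_of_real (- (\<Sum>b\<in>Basis. (f b)\<^sup>2) / 2)
        = (\<Sum>b\<in>Basis. \<i> * complex_of_real ((x \<bullet> b) * f b) + complex_of_real (- (f b)\<^sup>2 / 2))"
      by (simp add: sum.distrib sum_distrib_left sum_subtractf sum_divide_distrib)
    finally show ?thesis by (simp only: exp_sum finite_Basis)
  qed
  have i: "integrable lborel (?f b)" and v: "integral\<^sup>L lborel (?f b) = complex_of_real (sqrt (2 * pi) * exp (- (x \<bullet> b)\<^sup>2 / 2))" for b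
    using has_bochner_integral_gauss_1d[of "x \<bullet> b"] by (auto simp: has_bochner_integral_iff)
  have [measurable]: "?e \<in> (\<Pi>\<^sub>M b\<in>Basis. lborel) \<rightarrow>\<^sub>M borel" by measurable
  have "integrable (\<Pi>\<^sub>M b\<in>Basis. lborel) (\<lambda>f. cis (x \<bullet> ?e f) * complex_of_real (gauss (?e f)))"
    unfolding e using i by (intro product_integrable_prod) auto
  then have I: "integrable lborel (\<lambda>k. cis (x \<bullet> k) * complex_of_real (gauss k))"
    by (subst lborel_eq, subst integrable_distr_eq) auto
  have "(\<integral>k. cis (x \<bullet> k) * complex_of_real (gauss k) \<partial>(lborel :: 'a measure))
      = (\<integral>f. cis (x \<bullet> ?e f) * complex_of_real (gauss (?e f)) \<partial>(\<Pi>\<^sub>M b\<in>Basis. lborel))"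
    by (subst lborel_eq, subst integral_distr) auto
  also have "\<dots> = (\<Prod>b\<in>Basis. integral\<^sup>L lborel (?f b))"
    unfolding e using i by (intro product_integral_prod) auto
  also have "\<dots> = complex_of_real (\<Prod>b\<in>(Basis::'a set). sqrt (2 * pi) * exp (- (x \<bullet> b)\<^sup>2 / 2))"
    by (simp only: v of_real_prod)
  also have "(\<Prod>b\<in>(Basis::'a set). sqrt (2 * pi) * exp (- (x \<bullet> b)\<^sup>2 / 2)) = sqrt (2 * pi) ^ DIM('a) * gauss x"
  proof -
    have "(\<Prod>b\<in>(Basis::'a set). exp (- (x \<bullet> b)\<^sup>2 / 2)) = exp (\<Sum>b\<in>(Basis::'a set). - (x \<bullet> b)\<^sup>2 / 2)"
      by (rule exp_sum[symmetric]) simp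
    also have "(\<Sum>b\<in>(Basis::'a set). - (x \<bullet> b)\<^sup>2 / 2) = - (x \<bullet> x) / 2"
      unfolding euclidean_inner[of x x] by (simp add: sum_negf sum_divide_distrib power2_eq_square)
    finally show ?thesis by (simp add: prod.distrib gauss_def)
  qed
  finally show ?thesis using I by (simp add: has_bochner_integral_iff)
qed

section \<open>The Fourier integral and Parseval's identity\<close>

lemma integrable_pair_dominated:
  fixes F :: "'a::euclidean_space \<times> 'b::euclidean_space \<Rightarrow> complex"
    and u :: "'a \<Rightarrow> complex" and v :: "'b \<Rightarrow> complex"
  assumes "F \<in> borel_measurable borel" and u: "integrable lborel u" and v: "integrable lborel v"
    and le: "\<And>x y. cmod (F (x, y)) \<le> cmod (u x) * cmod (v y)"
  shows "integrable (lborel \<Otimes>\<^sub>M lborel) F"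
proof -
  have [measurable]: "u \<in> borel_measurable borel" "v \<in> borel_measurable borel"
    using u v by (auto dest: borel_measurable_integrable)
  have "integrable (lborel \<Otimes>\<^sub>M lborel) (\<lambda>(x, y). u x * v y)"
    by (rule lborel_pair.Fubini_integrable) (use u v in \<open>auto simp: norm_mult\<close>)
  then show ?thesis
    by (rule Bochner_Integration.integrable_bound)
       (use assms(1) le in \<open>auto simp: lborel_prod norm_mult\<close>)
qed

text \<open>Sign and normalisation are chosen so that the kernel is symmetric in \<open>k\<close> and
  \<open>z\<close>. The inverse of \<open>fourier\<close> is then \<open>fourier\<close> itself,
  up to the reflection \<open>z \<mapsto> - z\<close> and the factor \<open>(2 * pi) ^
  DIM('a)\<close>.\<close>

definition fourier :: "('a::euclidean_space \<Rightarrow> complex) \<Rightarrow> 'a \<Rightarrow> complex" where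
  "fourier u k = (\<integral>z. cis (k \<bullet> z) * u z \<partial>lborel)"

lemma borel_measurable_pair_borel:
  fixes f :: "'a::euclidean_space \<times> 'b::euclidean_space \<Rightarrow> 'c::topological_space"
  shows "f \<in> borel_measurable borel \<longleftrightarrow> f \<in> borel_measurable (borel \<Otimes>\<^sub>M borel)"
  by (simp add: borel_prod)

lemma fourier_measurable [measurable]:
  assumes [measurable]: "u \<in> borel_measurable borel"
  shows "fourier u \<in> borel_measurable borel"
  unfolding fourier_def[abs_def]
  by (rule lborel.borel_measurable_lebesgue_integral) measurable

lemma integrable_cis_mult:
  fixes u :: "'a::euclidean_space \<Rightarrow> complex"
  assumes "integrable lborel u" shows "integrable lborel (\<lambda>z. cis (k \<bullet> z) * u z)"
  by (rule Bochner_Integration.integrable_bound[OF assms])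
     (use borel_measurable_integrable[OF assms] in \<open>auto simp: norm_mult\<close>)

lemma fourier_bound: "cmod (fourier u k) \<le> (\<integral>z. cmod (u z) \<partial>lborel)"
  unfolding fourier_def using integral_norm_bound[of lborel "\<lambda>z. cis (k \<bullet> z) * u z"] by (simp add: norm_mult)

text \<open>Fubini and the symmetry of the kernel. This identity is what extends to square-integrable
  functions and serves there as the definition of the transform.\<close>

lemma fourier_multiplication:
  assumes u: "integrable lborel u" and v: "integrable lborel v"
  shows "(\<integral>k. fourier u k * v k \<partial>lborel) = (\<integral>z. u z * fourier v z \<partial>lborel)"
proof -
  have [measurable]: "u \<in> borel_measurable borel" "v \<in> borel_measurable borel"
    using u v by (auto dest: borel_measurable_integrable)
  have "integrable (lborel \<Otimes>\<^sub>M lborel) (\<lambda>(k, z). cis (k \<bullet> z) * u z * v k)"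
    by (rule integrable_pair_dominated[OF _ v u]) (auto simp: norm_mult borel_measurable_pair_borel)
  from lborel_pair.Fubini_integral[OF this]
  have fub: "(\<integral>z. (\<integral>k. cis (k \<bullet> z) * u z * v k \<partial>lborel) \<partial>lborel) = (\<integral>k. (\<integral>z. cis (k \<bullet> z) * u z * v k \<partial>lborel) \<partial>lborel)"
    by simp
  have l: "(\<integral>k. cis (k \<bullet> z) * u z * v k \<partial>lborel) = u z * fourier v z" for z
    unfolding fourier_def by (subst integral_mult_right_zero[symmetric]) (simp add: ac_simps inner_commute)
  have r: "(\<integral>z. cis (k \<bullet> z) * u z * v k \<partial>lborel) = fourier u k * v k" for k
    unfolding fourier_def by simp
  show ?thesis using fub unfolding l r by (rule sym)
qed

lemma fourier_cnj: "cnj (fourier u k) = fourier (\<lambda>z. cnj (u z)) (- k)"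
  unfolding fourier_def by (subst Bochner_Integration.integral_cnj[symmetric]) (simp add: cis_cnj)

lemma fourier_reflect:
  assumes [measurable]: "u \<in> borel_measurable borel"
  shows "fourier (\<lambda>z. u (- z)) k = fourier u (- k)"
proof -
  have "fourier u (- k) = (\<integral>z. cis ((- k) \<bullet> (- z)) * u (- z) \<partial>lborel)"
    unfolding fourier_def by (rule integral_reflect[symmetric]) measurable
  then show ?thesis by (simp add: fourier_def)
qed

text \<open>As \<open>\<delta>\<close> tends to \<open>0\<close>, the Gaussians on the left increase to
  \<open>1\<close>, while their transforms concentrate at the origin with constant mass.\<close>

lemma fourier_scaled_gauss:
  fixes p :: "'a::euclidean_space"
  assumes "0 < \<delta>"
  shows "integrable lborel (\<lambda>k::'a. complex_of_real (gauss (\<delta> *\<^sub>R k)))"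
    and "fourier (\<lambda>k. complex_of_real (gauss (\<delta> *\<^sub>R k))) p
      = complex_of_real (sqrt (2 * pi) ^ DIM('a) / \<delta> ^ DIM('a) * gauss (p /\<^sub>R \<delta>))"
proof -
  have i0: "integrable lborel (\<lambda>k::'a. complex_of_real (gauss k))"
    using has_bochner_integral_gauss[of "0::'a"] by (simp add: has_bochner_integral_iff)
  have l: "lborel = density (distr lborel borel (\<lambda>x. \<delta> *\<^sub>R x)) (\<lambda>_::'a. \<delta> ^ DIM('a))"
    using lborel_affine[of \<delta> "0::'a"] assms by simp
  have "integrable (density (distr lborel borel (\<lambda>x. \<delta> *\<^sub>R x)) (\<lambda>_::'a. \<delta> ^ DIM('a))) (\<lambda>k::'a. complex_of_real (gauss k))"
    using i0 l by simp
  then have "integrable lborel (\<lambda>k::'a. \<delta> ^ DIM('a) *\<^sub>R complex_of_real (gauss (\<delta> *\<^sub>R k)))"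
    using assms by (simp add: integrable_density integrable_distr_eq)
  then show "integrable lborel (\<lambda>k::'a. complex_of_real (gauss (\<delta> *\<^sub>R k)))"
    using integrable_scaleR_right[of "inverse (\<delta> ^ DIM('a))"] assms by force
  have "complex_of_real (sqrt (2 * pi) ^ DIM('a) * gauss (p /\<^sub>R \<delta>))
     = (\<integral>k. cis ((p /\<^sub>R \<delta>) \<bullet> k) * complex_of_real (gauss k) \<partial>lborel)"
    using has_bochner_integral_gauss[of "p /\<^sub>R \<delta>"] by (simp add: has_bochner_integral_iff)
  also have "\<dots> = (\<integral>k. \<delta> ^ DIM('a) *\<^sub>R (cis ((p /\<^sub>R \<delta>) \<bullet> (\<delta> *\<^sub>R k)) * complex_of_real (gauss (\<delta> *\<^sub>R k))) \<partial>lborel)"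
    using assms by (subst l) (simp add: integral_density integral_distr mult.left_commute[of "inverse \<delta>" \<delta>])
  also have "\<dots> = (\<integral>k. \<delta> ^ DIM('a) *\<^sub>R (cis (p \<bullet> k) * complex_of_real (gauss (\<delta> *\<^sub>R k))) \<partial>lborel)"
    using assms by (intro Bochner_Integration.integral_cong refl) (simp add: mult.assoc[symmetric])
  also have "\<dots> = \<delta> ^ DIM('a) * fourier (\<lambda>k. complex_of_real (gauss (\<delta> *\<^sub>R k))) p"
    using assms unfolding fourier_def by (simp add: scaleR_conv_of_real)
  finally show "fourier (\<lambda>k. complex_of_real (gauss (\<delta> *\<^sub>R k))) p
      = complex_of_real (sqrt (2 * pi) ^ DIM('a) / \<delta> ^ DIM('a) * gauss (p /\<^sub>R \<delta>))"
    using assms by (simp add: field_simps)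
qed

text \<open>The transform of the correlation is the product \<open>fourier u k * cnj (fourier q
  k)\<close>, and its value at \<open>0\<close> is the inner product of \<open>u\<close> and
  \<open>q\<close>. Parseval's identity is therefore Fourier inversion of the correlation at a
  single point.\<close>

definition correlation :: "('a::euclidean_space \<Rightarrow> complex) \<Rightarrow> ('a \<Rightarrow> complex) \<Rightarrow> 'a \<Rightarrow> complex" where
  "correlation u q p = (\<integral>y. u (y + p) * cnj (q y) \<partial>lborel)"

lemma correlation_measurable [measurable]:
  assumes [measurable]: "u \<in> borel_measurable borel" "q \<in> borel_measurable borel"
  shows "correlation u q \<in> borel_measurable borel"
  unfolding correlation_def[abs_def]
  by (rule lborel.borel_measurable_lebesgue_integral) measurable

lemma correlation_pair_integrable:
  assumes u: "integrable lborel u" and q: "integrable lborel q"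
  shows "integrable (lborel \<Otimes>\<^sub>M lborel) (\<lambda>(y, p). u (y + p) * cnj (q y))"
proof -
  have [measurable]: "u \<in> borel_measurable borel" "q \<in> borel_measurable borel"
    using u q by (auto dest: borel_measurable_integrable)
  have 1: "(\<integral>p. cmod (u (y + p)) \<partial>lborel) = (\<integral>p. cmod (u p) \<partial>lborel)" for y
    using integral_translate[of "\<lambda>p. cmod (u p)" y] by (simp add: add.commute)
  show ?thesis
  proof (rule lborel_pair.Fubini_integrable)
    show "integrable lborel (\<lambda>x. LBINT y. norm (case (x, y) of (y, p) \<Rightarrow> u (y + p) * cnj (q y)))"
      using q by (simp add: norm_mult 1)
    show "AE x in lborel. integrable lborel (\<lambda>y. case (x, y) of (y, p) \<Rightarrow> u (y + p) * cnj (q y))"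
      using integrable_translate[OF u] by (simp add: add.commute)
  qed measurable
qed

lemma integrable_correlation:
  assumes "integrable lborel u" "integrable lborel q"
  shows "integrable lborel (correlation u q)"
  using lborel_pair.integrable_snd[OF correlation_pair_integrable[OF assms]]
  by (simp add: correlation_def[abs_def])

lemma fourier_correlation:
  assumes u: "integrable lborel u" and q: "integrable lborel q"
  shows "fourier (correlation u q) k = fourier u k * cnj (fourier q k)"
proof -
  have [measurable]: "u \<in> borel_measurable borel" "q \<in> borel_measurable borel"
    using u q by (auto dest: borel_measurable_integrable)
  let ?F = "\<lambda>(y, p). cis (k \<bullet> p) * (u (y + p) * cnj (q y))"
  have "integrable (lborel \<Otimes>\<^sub>M lborel) ?F"
    by (rule Bochner_Integration.integrable_bound[OF correlation_pair_integrable[OF u q]]) (auto simp: norm_mult)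
  from lborel_pair.Fubini_integral[OF this]
  have "fourier (correlation u q) k = (\<integral>y. (\<integral>p. cis (k \<bullet> p) * (u (y + p) * cnj (q y)) \<partial>lborel) \<partial>lborel)"
    by (simp add: fourier_def correlation_def)
  also have "\<dots> = (\<integral>y. fourier u k * cnj (cis (k \<bullet> y) * q y) \<partial>lborel)"
  proof (intro Bochner_Integration.integral_cong refl)
    fix y
    have c: "cis (k \<bullet> (p + y)) * cnj (cis (k \<bullet> y)) = cis (k \<bullet> p)" for p
      by (simp add: cis_cnj cis_mult inner_add_right)
    have "cis (k \<bullet> p) * (u (y + p) * cnj (q y)) = (cis (k \<bullet> (p + y)) * u (p + y)) * cnj (cis (k \<bullet> y) * q y)" for p
      by (subst c[of p, symmetric]) (simp add: add.commute)
    then have "(\<integral>p. cis (k \<bullet> p) * (u (y + p) * cnj (q y)) \<partial>lborel)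
        = (\<integral>p. cis (k \<bullet> (p + y)) * u (p + y) \<partial>lborel) * cnj (cis (k \<bullet> y) * q y)"
      by (simp only: integral_mult_left_zero)
    also have "(\<integral>p. cis (k \<bullet> (p + y)) * u (p + y) \<partial>lborel) = fourier u k"
      unfolding fourier_def by (rule integral_translate) measurable
    finally show "(\<integral>p. cis (k \<bullet> p) * (u (y + p) * cnj (q y)) \<partial>lborel) = fourier u k * cnj (cis (k \<bullet> y) * q y)" .
  qed
  also have "(\<integral>y. fourier u k * cnj (cis (k \<bullet> y) * q y) \<partial>lborel) = fourier u k * cnj (fourier q k)"
    unfolding fourier_def by (simp only: integral_mult_right_zero Bochner_Integration.integral_cnj)
  finally show ?thesis .
qed

lemma nice_abs_integrable: "nice u \<Longrightarrow> integrable lborel (\<lambda>z. cmod (u z))"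
  using nice_integrable[of u] by simp

lemma correlation_bound:
  assumes q: "integrable lborel q" and B: "\<And>z. cmod (q z) \<le> B" and u: "integrable lborel u"
  shows "cmod (correlation u q p) \<le> B * (\<integral>z. cmod (u z) \<partial>lborel)"
proof -
  have [measurable]: "u \<in> borel_measurable borel" "q \<in> borel_measurable borel"
    using u q by (auto dest: borel_measurable_integrable)
  have iu: "integrable lborel (\<lambda>y. cmod (u (y + p)))" using integrable_translate[OF u] by simp
  have i: "integrable lborel (\<lambda>y. cmod (u (y + p)) * B)" using iu by simp
  have le: "cmod (u (y + p) * cnj (q y)) \<le> cmod (u (y + p)) * B" for y
    using B[of y] by (simp add: norm_mult mult_left_mono)
  have i2: "integrable lborel (\<lambda>y. cmod (u (y + p) * cnj (q y)))"
    proof (rule Bochner_Integration.integrable_bound[OF i])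
    show "AE y in lborel. norm (cmod (u (y + p) * cnj (q y))) \<le> norm (cmod (u (y + p)) * B)"
      using order_trans[OF le abs_ge_self] by (intro AE_I2) simp
  qed measurable
  have "cmod (correlation u q p) \<le> (\<integral>y. cmod (u (y + p) * cnj (q y)) \<partial>lborel)"
    unfolding correlation_def by (rule integral_norm_bound)
  also have "\<dots> \<le> (\<integral>y. cmod (u (y + p)) * B \<partial>lborel)"
    by (rule integral_mono[OF i2 i le])
  also have "\<dots> = B * (\<integral>z. cmod (u z) \<partial>lborel)"
    using integral_translate[of "\<lambda>z. cmod (u z)" p] by simp
  finally show ?thesis .
qed

text \<open>Since \<open>q\<close> is bounded, continuity of translations of \<open>u\<close> in
  \<open>L\<^sup>1\<close> suffices.\<close>

lemma correlation_tendsto: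
  assumes "nice u" "nice q" "d \<longlonglongrightarrow> 0"
  shows "(\<lambda>n. correlation u q (d n)) \<longlonglongrightarrow> correlation u q 0"
proof -
  have u: "integrable lborel u" and q: "integrable lborel q" using assms nice_integrable by auto
  obtain B where B: "\<And>z. cmod (q z) \<le> B" using assms(2) by (auto simp: nice_def)
  have [measurable]: "u \<in> borel_measurable borel" "q \<in> borel_measurable borel"
    using u q by (auto dest: borel_measurable_integrable)
  have i: "integrable lborel (\<lambda>y. u (y + p) * cnj (q y))" for p
  proof (rule Bochner_Integration.integrable_bound)
    show "integrable lborel (\<lambda>y. u (y + p) * complex_of_real B)" using integrable_translate[OF u, of p] by simp
    show "AE y in lborel. cmod (u (y + p) * cnj (q y)) \<le> cmod (u (y + p) * complex_of_real B)"
      using B by (auto simp: norm_mult intro!: mult_left_mono order_trans[OF B])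
  qed measurable
  have "(\<lambda>n. B * (\<integral>z. cmod (u (z + d n) - u z) \<partial>lborel)) \<longlonglongrightarrow> B * 0"
    using L1_translation_continuous_integrable[OF u] assms(3)
    by (intro tendsto_intros) (auto simp: L1_translation_continuous_def)
  then have t: "(\<lambda>n. B * (\<integral>z. cmod (u (z + d n) - u z) \<partial>lborel)) \<longlonglongrightarrow> 0" by simp
  have "(\<lambda>n. correlation u q (d n) - correlation u q 0) \<longlonglongrightarrow> 0"
  proof (rule Lim_null_comparison[OF _ t], intro always_eventually allI)
    fix n
    have j: "integrable lborel (\<lambda>y. cmod (u (y + d n) - u y))"
      using integrable_translate[OF u, of "d n"] u by simp
    have j2: "integrable lborel (\<lambda>y. (u (y + d n) - u y) * cnj (q y))"
      using Bochner_Integration.integrable_diff[OF i[of "d n"] i[of 0]] by (simp add: algebra_simps)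
    have le: "cmod ((u (y + d n) - u y) * cnj (q y)) \<le> B * cmod (u (y + d n) - u y)" for y
      using B[of y] by (simp add: norm_mult mult.commute[of _ "cmod (q y)"] mult_right_mono)
    have "correlation u q (d n) - correlation u q 0 = (\<integral>y. (u (y + d n) - u y) * cnj (q y) \<partial>lborel)"
      unfolding correlation_def using Bochner_Integration.integral_diff[OF i[of "d n"] i[of 0]]
      by (simp add: algebra_simps)
    then have "cmod (correlation u q (d n) - correlation u q 0) \<le> (\<integral>y. cmod ((u (y + d n) - u y) * cnj (q y)) \<partial>lborel)"
      using integral_norm_bound by metis
    also have "\<dots> \<le> (\<integral>y. B * cmod (u (y + d n) - u y) \<partial>lborel)"
      by (rule integral_mono) (use j j2 le in auto)
    finally show "norm (correlation u q (d n) - correlation u q 0) \<le> B * (\<integral>z. cmod (u (z + d n) - u z) \<partial>lborel)"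
      by simp
  qed
  then show ?thesis by (simp add: LIM_zero_iff)
qed

lemma sqrt_2pi_power_twice: "sqrt (2 * pi) ^ n * sqrt (2 * pi) ^ n = (2 * pi) ^ n"
  by (subst power_mult_distrib[symmetric]) simp

text \<open>The Gaussian factor makes the integral converge before anything is known about the decay of
  the transforms. The multiplication formula turns it into an approximate identity acting on the
  correlation, which is continuous at \<open>0\<close>.\<close>

lemma regularised_Parseval:
  fixes u q :: "'a::euclidean_space \<Rightarrow> complex"
  assumes "nice u" "nice q"
  shows "(\<lambda>n. \<integral>k. fourier u k * cnj (fourier q k) * gauss (k /\<^sub>R real (Suc n)) \<partial>lborel)
     \<longlonglongrightarrow> (2 * pi) ^ DIM('a) * (\<integral>z. u z * cnj (q z) \<partial>lborel)"
proof -
  let ?C = "correlation u q" and ?\<kappa> = "sqrt (2 * pi) ^ DIM('a)"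
  define \<delta> where "\<delta> n = inverse (real (Suc n))" for n
  have \<delta>: "\<delta> n > 0" for n by (simp add: \<delta>_def)
  have u: "integrable lborel u" and q: "integrable lborel q" using assms nice_integrable by auto
  have [measurable]: "u \<in> borel_measurable borel" "q \<in> borel_measurable borel"
    using u q by (auto dest: borel_measurable_integrable)
  obtain B where B: "\<And>z. cmod (q z) \<le> B" using assms(2) by (auto simp: nice_def)
  have iC: "integrable lborel ?C" by (rule integrable_correlation[OF u q])
  have i0: "integrable lborel (\<lambda>k::'a. gauss k)"
    using has_bochner_integral_gauss[of "0::'a"] by (simp add: has_bochner_integral_iff complex_of_real_integrable_eq)
  have v0: "(\<integral>k. gauss k \<partial>(lborel :: 'a measure)) = ?\<kappa>"
    using has_bochner_integral_gauss[of "0::'a"] by (simp add: has_bochner_integral_iff gauss_def flip: of_real_power of_real_mult)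
  have eq: "(\<integral>k. fourier u k * cnj (fourier q k) * gauss (\<delta> n *\<^sub>R k) \<partial>lborel) = (\<integral>h. ?\<kappa> * ?C (\<delta> n *\<^sub>R h) * gauss h \<partial>lborel)" for n
  proof -
    have "(\<integral>k. fourier u k * cnj (fourier q k) * gauss (\<delta> n *\<^sub>R k) \<partial>lborel)
       = (\<integral>k. fourier ?C k * gauss (\<delta> n *\<^sub>R k) \<partial>lborel)" by (simp add: fourier_correlation[OF u q])
    also have "\<dots> = (\<integral>p. ?C p * fourier (\<lambda>k. complex_of_real (gauss (\<delta> n *\<^sub>R k))) p \<partial>lborel)"
      by (rule fourier_multiplication[OF iC fourier_scaled_gauss(1)[OF \<delta>]])
    also have "\<dots> = (\<integral>p. ?C p * (?\<kappa> / \<delta> n ^ DIM('a) * gauss (p /\<^sub>R \<delta> n)) \<partial>lborel)"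
      by (simp add: fourier_scaled_gauss(2)[OF \<delta>])
    also have "\<dots> = (\<integral>h. \<delta> n ^ DIM('a) *\<^sub>R (?C (\<delta> n *\<^sub>R h) * (?\<kappa> / \<delta> n ^ DIM('a) * gauss ((\<delta> n *\<^sub>R h) /\<^sub>R \<delta> n))) \<partial>lborel)"
    proof -
      have l: "lborel = density (distr lborel borel (\<lambda>x. \<delta> n *\<^sub>R x)) (\<lambda>_::'a. \<delta> n ^ DIM('a))"
        using lborel_affine[of "\<delta> n" "0::'a"] \<delta>[of n] by simp
      show ?thesis using \<delta>[of n] by (subst l) (subst integral_density; simp add: integral_distr)
    qed
    also have "\<dots> = (\<integral>h. ?\<kappa> * ?C (\<delta> n *\<^sub>R h) * gauss h \<partial>lborel)"
      by (intro Bochner_Integration.integral_cong refl)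
         (use \<delta>[of n] in \<open>simp add: scaleR_conv_of_real field_simps\<close>)
    finally show ?thesis .
  qed
  have "(\<lambda>n. \<integral>h. ?\<kappa> * ?C (\<delta> n *\<^sub>R h) * gauss h \<partial>lborel) \<longlonglongrightarrow> (\<integral>h. ?\<kappa> * ?C 0 * complex_of_real (gauss (h::'a)) \<partial>lborel)"
  proof (rule integral_dominated_convergence)
    let ?M = "B * (\<integral>z. cmod (u z) \<partial>lborel)"
    show "integrable lborel (\<lambda>h::'a. ?\<kappa> * ?M * gauss h)" using i0 by simp
    show "AE h in lborel. (\<lambda>n. ?\<kappa> * ?C (\<delta> n *\<^sub>R h) * complex_of_real (gauss h)) \<longlonglongrightarrow> ?\<kappa> * ?C 0 * complex_of_real (gauss h)"
    proof (intro AE_I2)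
      fix h :: 'a
      have "\<delta> \<longlonglongrightarrow> 0" unfolding \<delta>_def by (rule LIMSEQ_inverse_real_of_nat)
      then have "(\<lambda>n. \<delta> n *\<^sub>R h) \<longlonglongrightarrow> 0 *\<^sub>R h" by (intro tendsto_intros)
      then have "(\<lambda>n. ?C (\<delta> n *\<^sub>R h)) \<longlonglongrightarrow> ?C 0" by (intro correlation_tendsto assms) simp
      then show "(\<lambda>n. ?\<kappa> * ?C (\<delta> n *\<^sub>R h) * complex_of_real (gauss h)) \<longlonglongrightarrow> ?\<kappa> * ?C 0 * complex_of_real (gauss h)"
        by (intro tendsto_intros)
    qed
    show "AE h in lborel. norm (?\<kappa> * ?C (\<delta> n *\<^sub>R h) * complex_of_real (gauss h)) \<le> ?\<kappa> * ?M * gauss h" for n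
    proof (intro AE_I2)
      fix h :: 'a
      have "?\<kappa> * cmod (?C (\<delta> n *\<^sub>R h)) * gauss h \<le> ?\<kappa> * ?M * gauss h"
        by (intro mult_right_mono mult_left_mono correlation_bound[OF q B u]) (auto simp: gauss_def)
      then show "norm (?\<kappa> * ?C (\<delta> n *\<^sub>R h) * complex_of_real (gauss h)) \<le> ?\<kappa> * ?M * gauss h"
        by (simp add: norm_mult norm_power gauss_def)
    qed
  qed measurable
  also have "(\<integral>h. ?\<kappa> * ?C 0 * complex_of_real (gauss (h::'a)) \<partial>lborel) = (2 * pi) ^ DIM('a) * ?C 0"
  proof -
    have "(\<integral>h. complex_of_real (gauss (h::'a)) \<partial>lborel) = complex_of_real ?\<kappa>"
      using integral_complex_of_real[of lborel "gauss :: 'a \<Rightarrow> real"] v0 by simp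
    then have "(\<integral>h. ?\<kappa> * ?C 0 * complex_of_real (gauss (h::'a)) \<partial>lborel) = complex_of_real (?\<kappa> * ?\<kappa>) * ?C 0"
      by simp
    then show ?thesis by (simp add: sqrt_2pi_power_twice)
  qed
  finally show ?thesis
    unfolding eq[symmetric] by (simp add: correlation_def \<delta>_def)
qed

text \<open>For \<open>q = u\<close> the regularised integrands increase, so monotone convergence removes
  the Gaussian factor and at the same time shows that the transform is square integrable.\<close>

lemma Plancherel_nice:
  fixes u :: "'a::euclidean_space \<Rightarrow> complex"
  assumes "nice u"
  shows "L2 (fourier u)" "sq_norm (fourier u) = (2 * pi) ^ DIM('a) * sq_norm u"
proof -
  have [measurable]: "u \<in> borel_measurable borel" using assms by (auto simp: nice_def)
  have iu: "integrable lborel (\<lambda>z. cmod (u z))" using nice_abs_integrable[OF assms] .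
  have g0: "integrable lborel (\<lambda>k::'a. complex_of_real (gauss (k /\<^sub>R real (Suc n))))" for n
    using fourier_scaled_gauss(1)[of "inverse (real (Suc n))"] by simp
  have g: "integrable lborel (\<lambda>k::'a. gauss (k /\<^sub>R real (Suc n)))" for n
    using g0[of n] by (simp add: complex_of_real_integrable_eq)
  let ?f = "\<lambda>n k. (cmod (fourier u k))\<^sup>2 * gauss (k /\<^sub>R real (Suc n))"
  have i: "integrable lborel (?f n)" for n
  proof (rule Bochner_Integration.integrable_bound)
    show "integrable lborel (\<lambda>k::'a. (\<integral>z. cmod (u z) \<partial>lborel)\<^sup>2 * gauss (k /\<^sub>R real (Suc n)))" using g[of n] by simp
    show "AE k in lborel. norm (?f n k) \<le> norm ((\<integral>z. cmod (u z) \<partial>lborel)\<^sup>2 * gauss (k /\<^sub>R real (Suc n)))"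
      by (intro AE_I2) (auto simp: gauss_def intro!: mult_right_mono power_mono fourier_bound)
  qed measurable
  have e: "complex_of_real (?f n k) = fourier u k * cnj (fourier u k) * gauss (k /\<^sub>R real (Suc n))" for n k
    by (simp only: of_real_mult complex_norm_square)
  have s: "complex_of_real (\<integral>k. ?f n k \<partial>lborel) = (\<integral>k. fourier u k * cnj (fourier u k) * gauss (k /\<^sub>R real (Suc n)) \<partial>lborel)" for n
    unfolding e[symmetric] integral_complex_of_real ..
  have su: "complex_of_real (sq_norm u) = (\<integral>z. u z * cnj (u z) \<partial>lborel)"
    unfolding complex_norm_square[symmetric] of_real_power[symmetric] integral_complex_of_real sq_norm_def ..
  have "(\<lambda>n. complex_of_real (\<integral>k. ?f n k \<partial>lborel)) \<longlonglongrightarrow> complex_of_real ((2 * pi) ^ DIM('a) * sq_norm u)"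
    using regularised_Parseval[OF assms assms] unfolding s by (simp add: su)
  then have lim: "(\<lambda>n. \<integral>k. ?f n k \<partial>lborel) \<longlonglongrightarrow> (2 * pi) ^ DIM('a) * sq_norm u"
    by (rule tendsto_of_real_iff[THEN iffD1])
  have mono: "AE k in lborel. mono (\<lambda>n. ?f n k)"
  proof (intro AE_I2 monoI mult_left_mono)
    fix k :: 'a and m n :: nat assume "m \<le> n"
    then have "inverse (real (Suc n)) \<le> inverse (real (Suc m))" by simp
    then have "inverse (real (Suc n)) * inverse (real (Suc n)) * (k \<bullet> k) \<le> inverse (real (Suc m)) * inverse (real (Suc m)) * (k \<bullet> k)"
      by (intro mult_mono mult_right_mono) auto
    then show "gauss (k /\<^sub>R real (Suc m)) \<le> gauss (k /\<^sub>R real (Suc n))"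
      by (simp add: gauss_def mult.assoc)
  qed simp
  have ptw: "AE k in lborel. (\<lambda>n. ?f n k) \<longlonglongrightarrow> (cmod (fourier u k))\<^sup>2"
  proof (intro AE_I2)
    fix k :: 'a
    have "(\<lambda>n. inverse (real (Suc n))) \<longlonglongrightarrow> 0" by (rule LIMSEQ_inverse_real_of_nat)
    then have "(\<lambda>n. (cmod (fourier u k))\<^sup>2 * exp (- ((inverse (real (Suc n)) *\<^sub>R k) \<bullet> (inverse (real (Suc n)) *\<^sub>R k)) / 2))
        \<longlonglongrightarrow> (cmod (fourier u k))\<^sup>2 * exp (- ((0 *\<^sub>R k) \<bullet> (0 *\<^sub>R k)) / 2)"
      by (intro tendsto_intros) auto
    then show "(\<lambda>n. ?f n k) \<longlonglongrightarrow> (cmod (fourier u k))\<^sup>2" by (simp add: gauss_def)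
  qed
  have "integrable lborel (\<lambda>k. (cmod (fourier u k))\<^sup>2)"
    by (rule integrable_monotone_convergence[OF i mono ptw lim]) measurable
  then show "L2 (fourier u)" by (simp add: L2_def)
  show "sq_norm (fourier u) = (2 * pi) ^ DIM('a) * sq_norm u"
    unfolding sq_norm_def[of "fourier u"]
    by (rule integral_monotone_convergence[OF i mono ptw lim]) measurable
qed

lemma Parseval_nice:
  fixes u q :: "'a::euclidean_space \<Rightarrow> complex"
  assumes "nice u" "nice q"
  shows "(\<integral>k. fourier u k * cnj (fourier q k) \<partial>lborel) = (2 * pi) ^ DIM('a) * (\<integral>z. u z * cnj (q z) \<partial>lborel)"
proof (rule LIMSEQ_unique[OF _ regularised_Parseval[OF assms]])
  have [measurable]: "u \<in> borel_measurable borel" "q \<in> borel_measurable borel" using assms by (auto simp: nice_def)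
  have q: "L2 (\<lambda>k. cnj (fourier q k))" using Plancherel_nice(1)[OF assms(2)] by (auto simp: L2_def)
  show "(\<lambda>n. \<integral>k. fourier u k * cnj (fourier q k) * gauss (k /\<^sub>R real (Suc n)) \<partial>lborel)
     \<longlonglongrightarrow> (\<integral>k. fourier u k * cnj (fourier q k) \<partial>lborel)"
  proof (rule integral_dominated_convergence)
    show "integrable lborel (\<lambda>k. cmod (fourier u k * cnj (fourier q k)))"
      using L2_mult_integrable[OF Plancherel_nice(1)[OF assms(1)] q] by (rule integrable_norm)
    show "AE k in lborel. (\<lambda>n. fourier u k * cnj (fourier q k) * gauss (k /\<^sub>R real (Suc n))) \<longlonglongrightarrow> fourier u k * cnj (fourier q k)"
    proof (intro AE_I2)
      fix k :: 'a
      have "(\<lambda>n. inverse (real (Suc n))) \<longlonglongrightarrow> 0" by (rule LIMSEQ_inverse_real_of_nat)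
      then have "(\<lambda>n. fourier u k * cnj (fourier q k) * complex_of_real (exp (- ((inverse (real (Suc n)) *\<^sub>R k) \<bullet> (inverse (real (Suc n)) *\<^sub>R k)) / 2)))
          \<longlonglongrightarrow> fourier u k * cnj (fourier q k) * complex_of_real (exp (- ((0 *\<^sub>R k) \<bullet> (0 *\<^sub>R k)) / 2))"
        by (intro tendsto_intros) auto
      then show "(\<lambda>n. fourier u k * cnj (fourier q k) * gauss (k /\<^sub>R real (Suc n))) \<longlonglongrightarrow> fourier u k * cnj (fourier q k)"
        by (simp add: gauss_def)
    qed
    show "AE k in lborel. norm (fourier u k * cnj (fourier q k) * gauss (k /\<^sub>R real (Suc n))) \<le> cmod (fourier u k * cnj (fourier q k))" for n
      by (intro AE_I2) (auto simp: norm_mult gauss_def intro!: mult_left_le)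
  qed measurable
qed

lemma Parseval_bilinear_nice:
  fixes u p :: "'a::euclidean_space \<Rightarrow> complex"
  assumes "nice u" "nice p"
  shows "(\<integral>k. fourier u k * fourier p k \<partial>lborel) = (2 * pi) ^ DIM('a) * (\<integral>z. u z * p (- z) \<partial>lborel)"
proof -
  let ?q = "\<lambda>z. cnj (p (- z))"
  have [measurable]: "p \<in> borel_measurable borel" using assms by (auto simp: nice_def)
  have "cnj (fourier ?q k) = fourier p k" for k
    unfolding fourier_cnj using fourier_reflect[of p "- k"] by simp
  then show ?thesis
    using Parseval_nice[OF assms(1) nice_cnj[OF nice_reflect[OF assms(2)]]] by simp
qed

section \<open>The Fourier transform of square-integrable functions\<close>

text \<open>The transform of a square-integrable function is defined by duality with the classical
  transform of nice functions. As a relation it need not choose among the functions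
  \<open>g\<close> that agree almost everywhere.\<close>

definition L2_fourier :: "('a::euclidean_space \<Rightarrow> complex) \<Rightarrow> ('a \<Rightarrow> complex) \<Rightarrow> bool" where
  "L2_fourier f g \<longleftrightarrow> L2 f \<and> L2 g \<and>
     (\<forall>u. nice u \<longrightarrow> (\<integral>k. g k * u k \<partial>lborel) = (\<integral>z. f z * fourier u z \<partial>lborel))"

lemma L2_fourierD:
  assumes "L2_fourier f g"
  shows "L2 f" "L2 g" "\<And>u. nice u \<Longrightarrow> (\<integral>k. g k * u k \<partial>lborel) = (\<integral>z. f z * fourier u z \<partial>lborel)"
  using assms by (auto simp: L2_fourier_def)

lemma L2_fourier_nice:
  assumes "nice f" shows "L2_fourier f (fourier f)"
  unfolding L2_fourier_def using assms
  by (auto intro!: nice_L2 Plancherel_nice fourier_multiplication nice_integrable)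

lemma L2_fourier_diff:
  assumes "L2_fourier f g" "L2_fourier f' g'"
  shows "L2_fourier (\<lambda>z. f z - f' z) (\<lambda>z. g z - g' z)"
  unfolding L2_fourier_def
proof (intro conjI allI impI)
  note A = L2_fourierD[OF assms(1)] and B = L2_fourierD[OF assms(2)]
  show "L2 (\<lambda>z. f z - f' z)" "L2 (\<lambda>z. g z - g' z)" using A B L2_diff(1) by blast+
  fix u :: "'a \<Rightarrow> complex" assume u: "nice u"
  show "(\<integral>k. (g k - g' k) * u k \<partial>lborel) = (\<integral>z. (f z - f' z) * fourier u z \<partial>lborel)"
    using A B nice_L2[OF u] Plancherel_nice(1)[OF u]
    by (simp add: left_diff_distrib L2_mult_integrable u)
qed

lemma L2_fourier_cmult:
  assumes "L2_fourier f g" shows "L2_fourier (\<lambda>z. a * f z) (\<lambda>z. a * g z)"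
  using L2_fourierD[OF assms] unfolding L2_fourier_def
  by (auto intro!: L2_cmult(1) simp: mult.assoc)

lemma L2_fourier_reflect:
  assumes "L2_fourier f g" shows "L2_fourier (\<lambda>z. f (- z)) (\<lambda>z. g (- z))"
  unfolding L2_fourier_def
proof (intro conjI allI impI)
  note A = L2_fourierD[OF assms]
  show "L2 (\<lambda>z. f (- z))" "L2 (\<lambda>z. g (- z))" using A L2_reflect by blast+
  fix u :: "'a \<Rightarrow> complex" assume u: "nice u"
  have [measurable]: "f \<in> borel_measurable borel" "g \<in> borel_measurable borel" "u \<in> borel_measurable borel"
    using A u by (auto simp: L2_def nice_def)
  have "(\<integral>k. g (- k) * u k \<partial>lborel) = (\<integral>k. g k * u (- k) \<partial>lborel)"
    using integral_reflect[of "\<lambda>k. g k * u (- k)"] by simp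
  also have "\<dots> = (\<integral>z. f z * fourier (\<lambda>k. u (- k)) z \<partial>lborel)"
    by (rule A(3)[OF nice_reflect[OF u]])
  also have "\<dots> = (\<integral>z. f (- z) * fourier u z \<partial>lborel)"
    using integral_reflect[of "\<lambda>z. f z * fourier u (- z)"] by (simp add: fourier_reflect)
  finally show "(\<integral>k. g (- k) * u k \<partial>lborel) = (\<integral>z. f (- z) * fourier u z \<partial>lborel)" .
qed

text \<open>Duality and the isometry property for nice functions.\<close>

lemma L2_fourier_bound:
  fixes f g :: "'a::euclidean_space \<Rightarrow> complex"
  assumes "L2_fourier f g"
  shows "sq_norm g \<le> (2 * pi) ^ DIM('a) * sq_norm f"
proof (rule sq_norm_le_of_duality)
  note A = L2_fourierD[OF assms]
  show "L2 g" by (rule A)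
  fix u :: "'a \<Rightarrow> complex" assume u: "nice u"
  show "(cmod (\<integral>z. g z * u z \<partial>lborel))\<^sup>2 \<le> (2 * pi) ^ DIM('a) * sq_norm f * sq_norm u"
    using L2_Cauchy_Schwarz[OF A(1) Plancherel_nice(1)[OF u]] A(3)[OF u]
    by (simp add: Plancherel_nice(2)[OF u] ac_simps)
qed simp

lemma L2_fourier_unique:
  assumes "L2_fourier f g" "L2_fourier f g'"
  shows "AE z in lborel. g z = g' z"
proof -
  have d: "L2_fourier (\<lambda>z. f z - f z) (\<lambda>z. g z - g' z)" using L2_fourier_diff assms by blast
  have "sq_norm (\<lambda>z. f z - f z) = 0" by (simp add: sq_norm_def)
  then have "sq_norm (\<lambda>z. g z - g' z) \<le> 0"
    using L2_fourier_bound[OF d] by (simp only: mult_zero_right)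
  then have "sq_norm (\<lambda>z. g z - g' z) = 0" by (rule antisym[OF _ sq_norm_nonneg])
  from L2_AE_zero[OF L2_fourierD(2)[OF d] this] show ?thesis by simp
qed

text \<open>Fatou's lemma, in the form in which bounds survive pointwise limits.\<close>

lemma L2_Fatou:
  assumes h: "\<And>m. L2 (h m)" "\<And>m. sq_norm (h m) \<le> B"
    and lim: "AE z in lborel. (\<lambda>m. h m z) \<longlonglongrightarrow> f z" and [measurable]: "f \<in> borel_measurable borel"
  shows "L2 f" "sq_norm f \<le> B"
proof -
  have [measurable]: "h m \<in> borel_measurable borel" for m using h by (auto simp: L2_def)
  have "(\<integral>\<^sup>+z. ennreal ((cmod (f z))\<^sup>2) \<partial>lborel) = (\<integral>\<^sup>+z. liminf (\<lambda>m. ennreal ((cmod (h m z))\<^sup>2)) \<partial>lborel)"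
  proof (rule nn_integral_cong_AE)
    show "AE z in lborel. ennreal ((cmod (f z))\<^sup>2) = liminf (\<lambda>m. ennreal ((cmod (h m z))\<^sup>2))"
      using lim
    proof eventually_elim
      case (elim z)
      then have "(\<lambda>m. ennreal ((cmod (h m z))\<^sup>2)) \<longlonglongrightarrow> ennreal ((cmod (f z))\<^sup>2)"
        by (intro tendsto_ennrealI tendsto_intros)
      then show ?case by (rule lim_imp_Liminf[OF sequentially_bot, symmetric])
    qed
  qed
  also have "\<dots> \<le> liminf (\<lambda>m. \<integral>\<^sup>+z. ennreal ((cmod (h m z))\<^sup>2) \<partial>lborel)"
    by (rule nn_integral_liminf) measurable
  also have "\<dots> \<le> liminf (\<lambda>m. ennreal B)"
  proof (rule Liminf_mono, intro always_eventually allI)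
    fix m
    show "(\<integral>\<^sup>+z. ennreal ((cmod (h m z))\<^sup>2) \<partial>lborel) \<le> ennreal B"
      using h(2)[of m] nn_integral_eq_integral[OF L2_integrable_sq[OF h(1)[of m]]]
      by (simp add: sq_norm_def ennreal_leI)
  qed
  finally have le: "(\<integral>\<^sup>+z. ennreal ((cmod (f z))\<^sup>2) \<partial>lborel) \<le> ennreal B"
    by (simp add: Liminf_const)
  have i: "integrable lborel (\<lambda>z. (cmod (f z))\<^sup>2)"
    by (rule integrableI_bounded) (use le in \<open>auto intro: order.strict_trans1\<close>)
  then show "L2 f" by (simp add: L2_def)
  have "B \<ge> 0" using h(2)[of 0] sq_norm_nonneg[of "h 0"] by linarith
  then show "sq_norm f \<le> B"
    using le nn_integral_eq_integral[OF i] by (simp add: sq_norm_def)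
qed

text \<open>The increments \<open>d n\<close> satisfy \<open>cmod (d n z) \<le> (1/2) ^ n + 2 ^ n * (cmod
  (d n z))\<^sup>2\<close>, and the sum over \<open>n\<close> of the right-hand side is finite
  for almost every \<open>z\<close>, because the integrals of the square terms are dominated by
  a geometric series.\<close>

lemma AE_convergent_of_fast_Cauchy:
  fixes h :: "nat \<Rightarrow> 'a::euclidean_space \<Rightarrow> complex"
  assumes h: "\<And>n. L2 (h n)" and C: "\<And>n. sq_norm (\<lambda>z. h (Suc n) z - h n z) \<le> C * (1/4) ^ n"
  shows "AE z in lborel. convergent (\<lambda>n. h n z)"
proof -
  have [measurable]: "h m \<in> borel_measurable borel" for m using h by (auto simp: L2_def)
  define d where "d n z = h (Suc n) z - h n z" for n z
  have d: "L2 (d n)" for n unfolding d_def by (intro L2_diff h)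
  have [measurable]: "d n \<in> borel_measurable borel" for n using d by (auto simp: L2_def)
  have C0: "C \<ge> 0" using order_trans[OF sq_norm_nonneg C[of 0]] by simp
  have "(\<integral>\<^sup>+z. (\<Sum>n. ennreal (2 ^ n * (cmod (d n z))\<^sup>2)) \<partial>lborel)
      = (\<Sum>n. \<integral>\<^sup>+z. ennreal (2 ^ n * (cmod (d n z))\<^sup>2) \<partial>lborel)"
    by (rule nn_integral_suminf) measurable
  also have "\<dots> \<le> (\<Sum>n. ennreal (C * (1/2) ^ n))"
  proof (rule suminf_le)
    fix n
    have "(\<integral>\<^sup>+z. ennreal (2 ^ n * (cmod (d n z))\<^sup>2) \<partial>lborel) = ennreal (2 ^ n * sq_norm (d n))"
      using L2_integrable_sq[OF d[of n]] by (subst nn_integral_eq_integral) (auto simp: sq_norm_def)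
    also have "\<dots> \<le> ennreal (2 ^ n * (C * (1/4) ^ n))"
      using C[of n] by (intro ennreal_leI mult_left_mono) (auto simp: d_def[abs_def])
    also have "2 ^ n * (C * (1/4) ^ n) = C * (1/2::real) ^ n"
      by (simp add: power_mult_distrib[symmetric])
    finally show "(\<integral>\<^sup>+z. ennreal (2 ^ n * (cmod (d n z))\<^sup>2) \<partial>lborel) \<le> ennreal (C * (1/2) ^ n)" .
  qed auto
  also have "\<dots> = ennreal (\<Sum>n. C * (1/2) ^ n)"
    using C0 by (intro suminf_ennreal2 summable_mult summable_geometric) auto
  also have "\<dots> < \<infinity>" by simp
  finally have "AE z in lborel. (\<Sum>n. ennreal (2 ^ n * (cmod (d n z))\<^sup>2)) \<noteq> \<infinity>"
    by (intro nn_integral_PInf_AE) auto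
  then show ?thesis
  proof eventually_elim
    case (elim z)
    then have s: "summable (\<lambda>n. 2 ^ n * (cmod (d n z))\<^sup>2)"
      by (intro summable_suminf_not_top) (auto simp: infinity_ennreal_def)
    have "summable (\<lambda>n. cmod (d n z))"
    proof (rule summable_comparison_test)
      show "summable (\<lambda>n. (1/2) ^ n + 2 ^ n * (cmod (d n z))\<^sup>2)"
        by (intro summable_add s summable_geometric) auto
      show "\<exists>N. \<forall>n\<ge>N. norm (cmod (d n z)) \<le> (1/2) ^ n + 2 ^ n * (cmod (d n z))\<^sup>2"
      proof (intro exI allI impI)
        fix n :: nat
        \<comment> \<open>The weights \<open>2 ^ n\<close> and \<open>(1/2) ^ n\<close> are inverse to each other, so the mixed term is \<open>cmod (d n z)\<close>.\<close>
        have "2 * sqrt ((1/2) ^ n) * (sqrt (2 ^ n) * cmod (d n z)) \<le> (sqrt ((1/2) ^ n))\<^sup>2 + (sqrt (2 ^ n) * cmod (d n z))\<^sup>2"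
          by (rule sum_squares_bound)
        moreover have "sqrt ((1/2) ^ n) * sqrt (2 ^ n) = 1"
          by (simp add: real_sqrt_mult[symmetric] power_mult_distrib[symmetric])
        then have "2 * sqrt ((1/2) ^ n) * (sqrt (2 ^ n) * cmod (d n z)) = 2 * cmod (d n z)"
          by (simp add: mult.assoc[symmetric])
        ultimately have "2 * cmod (d n z) \<le> (1/2) ^ n + 2 ^ n * (cmod (d n z))\<^sup>2"
          by (simp add: power_mult_distrib)
        moreover have "cmod (d n z) \<le> 2 * cmod (d n z)" by simp
        ultimately show "norm (cmod (d n z)) \<le> (1/2) ^ n + 2 ^ n * (cmod (d n z))\<^sup>2"
          by (simp only: real_norm_def abs_norm_cancel)
      qed
    qed
    then have "summable (\<lambda>n. d n z)" by (rule summable_norm_cancel)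
    then have "convergent (\<lambda>n. \<Sum>i<n. d i z)" by (simp add: summable_iff_convergent)
    moreover have "(\<Sum>i<n. d i z) = h n z - h 0 z" for n
      unfolding d_def by (induction n) auto
    ultimately have "convergent (\<lambda>n. (h n z - h 0 z) + h 0 z)"
      by (intro convergent_add convergent_const) simp
    then show ?case by simp
  qed
qed

text \<open>The transform of a family with parameter \<open>t\<close> can be chosen jointly measurable.
  Domination by a fixed \<open>G\<close> makes truncation errors uniform in \<open>t\<close>, so
  one sequence of truncations, whose transforms are classical integrals and hence jointly
  measurable, converges almost everywhere for every \<open>t\<close>. The measurability in all
  variables that is required of a solution comes from here.\<close>

proposition L2_fourier_family:
  fixes f :: "'b::euclidean_space \<times> 'a::euclidean_space \<Rightarrow> complex"
  assumes fm [measurable]: "f \<in> borel_measurable borel" and G: "L2 G"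
    and le: "\<And>t k. cmod (f (t, k)) \<le> cmod (G k)"
  shows "\<exists>w. w \<in> borel_measurable borel \<and> (\<forall>t. L2_fourier (\<lambda>k. f (t, k)) (\<lambda>z. w (t, z)))"
proof -
  let ?c = "(2 * pi) ^ DIM('a)"
  have [measurable]: "G \<in> borel_measurable borel" using G by (simp add: L2_def)
  have [measurable]: "(\<lambda>k. f (t, k)) \<in> borel_measurable borel" for t by measurable
  have "\<exists>r. \<forall>n\<ge>r. sq_norm (\<lambda>z. indicator (trunc G n) z * G z - G z) \<le> (1/4) ^ j" for j
    using LIMSEQ_D[OF sq_norm_trunc_tendsto[OF G \<open>G \<in> borel_measurable borel\<close>], of "(1/4) ^ j"]
    by (auto intro: less_imp_le)
  then obtain r where r: "\<And>j n. n \<ge> r j \<Longrightarrow> sq_norm (\<lambda>z. indicator (trunc G n) z * G z - G z) \<le> (1/4) ^ j"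
    by metis
  \<comment> \<open>Partial sums instead of \<open>r j\<close> itself, so that the sets increase.\<close>
  define T where "T j = trunc G (\<Sum>i\<le>j. r i)" for j
  have [measurable]: "T j \<in> sets borel" for j unfolding T_def by measurable
  have T: "sq_norm (\<lambda>z. indicator (T j) z * G z - G z) \<le> (1/4) ^ j" for j
    unfolding T_def by (rule r) (simp add: member_le_sum)
  have Tmono: "T i \<subseteq> T j" if "i \<le> j" for i j
    unfolding T_def using that by (intro trunc_mono sum_mono2) auto
  define fT where "fT j t k = indicator (T j) k * f (t, k)" for j t k
  have nice: "nice (fT j t)" for j t
    unfolding fT_def T_def by (rule nice_trunc) (use le in auto)
  have Gd: "L2 (\<lambda>z. indicator (T j) z * G z - G z)" for j
  proof (intro L2_diff(1) G)
    show "L2 (\<lambda>z. indicator (T j) z * G z)"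
      by (rule L2_dominated(1)[OF G, of _ 1]) (auto simp: indicator_def)
  qed
  have small: "sq_norm (\<lambda>k. fT i t k - fT j t k) \<le> (1/4) ^ j" if "j \<le> i" for i j t
  proof -
    have "sq_norm (\<lambda>k. fT i t k - fT j t k) \<le> 1\<^sup>2 * sq_norm (\<lambda>z. indicator (T j) z * G z - G z)"
      by (rule L2_dominated(2)[OF Gd])
         (use le Tmono[OF that] in \<open>auto simp: fT_def indicator_def\<close>)
    then show ?thesis using T[of j] by simp
  qed
  have fL2: "L2 (\<lambda>k. f (t, k))" for t
    by (rule L2_dominated(1)[OF G, of _ 1]) (use le in auto)
  have small': "sq_norm (\<lambda>k. fT j t k - f (t, k)) \<le> (1/4) ^ j" for j t
  proof -
    have "sq_norm (\<lambda>k. fT j t k - f (t, k)) \<le> 1\<^sup>2 * sq_norm (\<lambda>z. indicator (T j) z * G z - G z)"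
      by (rule L2_dominated(2)[OF Gd]) (use le in \<open>auto simp: fT_def indicator_def\<close>)
    then show ?thesis using T[of j] by simp
  qed
  define h where "h j t = fourier (fT j t)" for j t
  have hd: "L2_fourier (\<lambda>k. fT i t k - fT j t k) (\<lambda>z. h i t z - h j t z)" for i j t
    unfolding h_def by (intro L2_fourier_diff L2_fourier_nice nice)
  have hsmall: "sq_norm (\<lambda>z. h i t z - h j t z) \<le> ?c * (1/4) ^ j" if "j \<le> i" for i j t
    using L2_fourier_bound[OF hd[of i t j]] mult_left_mono[OF small[OF that], of ?c] by (meson order_trans pi_ge_zero mult_nonneg_nonneg zero_le_numeral zero_le_power)
  have hL2: "L2 (h j t)" for j t unfolding h_def using Plancherel_nice(1)[OF nice] .
  have conv: "AE z in lborel. convergent (\<lambda>j. h j t z)" for t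
    by (rule AE_convergent_of_fast_Cauchy[where C="?c", OF hL2]) (rule hsmall, simp)
  define w where "w p = lim (\<lambda>j. h j (fst p) (snd p))" for p :: "'b \<times> 'a"
  have hm: "(\<lambda>p. h j (fst p) (snd p)) \<in> borel_measurable borel" for j
  proof -
    have [measurable]: "f \<in> borel_measurable (borel \<Otimes>\<^sub>M borel)" by (simp add: borel_prod fm)
    have "(\<lambda>p::'b \<times> 'a. \<integral>k. cis (snd p \<bullet> k) * (indicator (T j) k * f (fst p, k)) \<partial>lborel) \<in> borel_measurable (borel \<Otimes>\<^sub>M borel)"
      by (rule lborel.borel_measurable_lebesgue_integral) measurable
    then show ?thesis unfolding h_def fourier_def fT_def by (simp add: borel_prod)
  qed
  have wm [measurable]: "w \<in> borel_measurable borel"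
    unfolding w_def by (rule borel_measurable_lim_metric[OF hm])
  have hlim: "AE z in lborel. (\<lambda>j. h j t z) \<longlonglongrightarrow> w (t, z)" for t
    using conv[of t] by eventually_elim (simp add: w_def convergent_LIMSEQ_iff)
  have wh: "L2 (\<lambda>z. w (t, z) - h j t z)" "sq_norm (\<lambda>z. w (t, z) - h j t z) \<le> ?c * (1/4) ^ j" for j t
  proof -
    have 1: "L2 (\<lambda>z. h (i + j) t z - h j t z)" for i by (intro L2_diff hL2)
    have 2: "sq_norm (\<lambda>z. h (i + j) t z - h j t z) \<le> ?c * (1/4) ^ j" for i by (rule hsmall) simp
    have 3: "AE z in lborel. (\<lambda>i. h (i + j) t z - h j t z) \<longlonglongrightarrow> w (t, z) - h j t z"
      using hlim[of t] by eventually_elim (intro tendsto_intros LIMSEQ_ignore_initial_segment)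
    have 4: "(\<lambda>z. w (t, z) - h j t z) \<in> borel_measurable borel"
      using hL2[of j t] by (auto simp: L2_def)
    show "L2 (\<lambda>z. w (t, z) - h j t z)" by (rule L2_Fatou(1)[OF 1 2 3 4])
    show "sq_norm (\<lambda>z. w (t, z) - h j t z) \<le> ?c * (1/4) ^ j" by (rule L2_Fatou(2)[OF 1 2 3 4])
  qed
  have wL2: "L2 (\<lambda>z. w (t, z))" for t
    using L2_add(1)[OF wh(1)[of t 0] hL2[of 0 t]] by simp
  have geo: "(\<lambda>j. a * (1/4) ^ j) \<longlonglongrightarrow> 0" for a :: real
    using tendsto_mult[OF tendsto_const[of a] LIMSEQ_power_zero[of "1/4::real"]] by simp
  have "L2_fourier (\<lambda>k. f (t, k)) (\<lambda>z. w (t, z))" for t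
    unfolding L2_fourier_def
  proof (intro conjI allI impI fL2 wL2)
    fix u :: "'a \<Rightarrow> complex" assume u: "nice u"
    have "(\<lambda>j. \<integral>z. h j t z * u z \<partial>lborel) \<longlonglongrightarrow> (\<integral>z. w (t, z) * u z \<partial>lborel)"
    proof (rule L2_pairing_tendsto[OF hL2 wL2 nice_L2[OF u]])
      show "(\<lambda>j. sq_norm (\<lambda>z. h j t z - w (t, z))) \<longlonglongrightarrow> 0"
        by (rule Lim_null_comparison[OF _ geo[of ?c]])
           (use wh(2)[of t] in \<open>auto simp: sq_norm_minus_commute[of "h _ t"]\<close>)
    qed
    moreover have "(\<integral>z. h j t z * u z \<partial>lborel) = (\<integral>k. fT j t k * fourier u k \<partial>lborel)" for j
      unfolding h_def by (intro fourier_multiplication nice_integrable nice u)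
    moreover have "(\<lambda>j. \<integral>k. fT j t k * fourier u k \<partial>lborel) \<longlonglongrightarrow> (\<integral>k. f (t, k) * fourier u k \<partial>lborel)"
    proof (rule L2_pairing_tendsto[OF nice_L2[OF nice] fL2 Plancherel_nice(1)[OF u]])
      show "(\<lambda>j. sq_norm (\<lambda>k. fT j t k - f (t, k))) \<longlonglongrightarrow> 0"
        by (rule Lim_null_comparison[OF _ geo[of 1]]) (use small'[of _ t] in auto)
    qed
    ultimately show "(\<integral>z. w (t, z) * u z \<partial>lborel) = (\<integral>k. f (t, k) * fourier u k \<partial>lborel)"
      using LIMSEQ_unique by auto
  qed
  then show ?thesis using wm by blast
qed

lemma L2_fourier_exists:
  assumes "L2 f" shows "\<exists>g. L2_fourier f g"
proof -
  have [measurable]: "f \<in> borel_measurable borel" using assms by (simp add: L2_def)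
  show ?thesis
    using L2_fourier_family[of "\<lambda>(t::real, k). f k" f] assms by (auto simp: borel_prod[symmetric])
qed

text \<open>The defining identity holds for nice \<open>h\<close>; both sides are continuous in
  \<open>h\<close>.\<close>

lemma L2_fourier_duality:
  assumes "L2_fourier f g" "L2_fourier h k"
  shows "(\<integral>z. g z * h z \<partial>lborel) = (\<integral>z. f z * k z \<partial>lborel)"
proof -
  note A = L2_fourierD[OF assms(1)] and B = L2_fourierD[OF assms(2)]
  have [measurable]: "h \<in> borel_measurable borel" using B by (simp add: L2_def)
  define u where "u n z = indicator (trunc h n) z * h z" for n z
  have u: "nice (u n)" for n unfolding u_def by (rule nice_trunc_self) measurable
  have t: "(\<lambda>n. sq_norm (\<lambda>z. u n z - h z)) \<longlonglongrightarrow> 0"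
    unfolding u_def by (rule sq_norm_trunc_tendsto[OF B(1)]) measurable
  have d: "L2_fourier (\<lambda>z. u n z - h z) (\<lambda>z. fourier (u n) z - k z)" for n
    by (intro L2_fourier_diff L2_fourier_nice u assms(2))
  have "(\<lambda>n. (2 * pi) ^ DIM('a) * sq_norm (\<lambda>z. u n z - h z)) \<longlonglongrightarrow> (2 * pi) ^ DIM('a) * 0"
    by (intro tendsto_mult tendsto_const t)
  then have t1: "(\<lambda>n. (2 * pi) ^ DIM('a) * sq_norm (\<lambda>z. u n z - h z)) \<longlonglongrightarrow> 0" by simp
  have t2: "(\<lambda>n. sq_norm (\<lambda>z. fourier (u n) z - k z)) \<longlonglongrightarrow> 0"
    by (rule Lim_null_comparison[OF _ t1]) (use L2_fourier_bound[OF d] in auto)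
  have "(\<lambda>n. \<integral>z. u n z * g z \<partial>lborel) \<longlonglongrightarrow> (\<integral>z. h z * g z \<partial>lborel)"
    by (rule L2_pairing_tendsto[OF nice_L2[OF u] B(1) A(2) t])
  moreover have "(\<lambda>n. \<integral>z. fourier (u n) z * f z \<partial>lborel) \<longlonglongrightarrow> (\<integral>z. k z * f z \<partial>lborel)"
    by (rule L2_pairing_tendsto[OF Plancherel_nice(1)[OF u] B(2) A(1) t2])
  moreover have "(\<integral>z. u n z * g z \<partial>lborel) = (\<integral>z. fourier (u n) z * f z \<partial>lborel)" for n
    using A(3)[OF u[of n]] by (simp add: mult.commute)
  ultimately have "(\<integral>z. h z * g z \<partial>lborel) = (\<integral>z. k z * f z \<partial>lborel)"
    using LIMSEQ_unique by auto
  then show ?thesis by (simp add: mult.commute)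
qed

text \<open>For nice \<open>u\<close> let \<open>U\<close> be the transform of \<open>fourier u\<close>.
  Parseval's identity, read as a statement about \<open>U\<close> tested against nice functions,
  says that \<open>U\<close> is a multiple of the reflection of \<open>u\<close>; the duality of
  \<open>f\<close> and \<open>U\<close> transfers this from \<open>u\<close> to
  \<open>f\<close>.\<close>

proposition L2_fourier_inversion:
  fixes f g :: "'a::euclidean_space \<Rightarrow> complex"
  assumes "L2_fourier f g"
  shows "L2_fourier g (\<lambda>z. (2 * pi) ^ DIM('a) * f (- z))"
  unfolding L2_fourier_def
proof (intro conjI allI impI)
  let ?c = "complex_of_real ((2 * pi) ^ DIM('a))"
  note A = L2_fourierD[OF assms]
  have [measurable]: "f \<in> borel_measurable borel" using A by (simp add: L2_def)
  show "L2 g" "L2 (\<lambda>z. ?c * f (- z))" using A by (auto intro!: L2_cmult L2_reflect)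
  fix u :: "'a \<Rightarrow> complex" assume u: "nice u"
  have [measurable]: "u \<in> borel_measurable borel" using u by (simp add: nice_def)
  obtain U where U: "L2_fourier (fourier u) U"
    using L2_fourier_exists[OF Plancherel_nice(1)[OF u]] by blast
  have [measurable]: "U \<in> borel_measurable borel" using L2_fourierD(2)[OF U] by (simp add: L2_def)
  have uL2: "L2 (\<lambda>z. ?c * u (- z))" by (intro L2_cmult L2_reflect nice_L2 u)
  have "AE z in lborel. U z - ?c * u (- z) = 0"
  proof (rule L2_AE_zero_of_duality)
    show "L2 (\<lambda>z. U z - ?c * u (- z))"
      by (intro L2_diff(1) L2_fourierD(2)[OF U] uL2)
    fix p :: "'a \<Rightarrow> complex" assume p: "nice p"
    have [measurable]: "p \<in> borel_measurable borel" using p by (simp add: nice_def)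
    have "(\<integral>z. (U z - ?c * u (- z)) * p z \<partial>lborel) = (\<integral>z. U z * p z \<partial>lborel) - (\<integral>z. ?c * u (- z) * p z \<partial>lborel)"
      unfolding left_diff_distrib
      by (intro Bochner_Integration.integral_diff L2_mult_integrable L2_fourierD(2)[OF U] nice_L2[OF p] uL2)
    also have "(\<integral>z. U z * p z \<partial>lborel) = ?c * (\<integral>z. u z * p (- z) \<partial>lborel)"
      using L2_fourierD(3)[OF U p] Parseval_bilinear_nice[OF u p] by simp
    also have "(\<integral>z. ?c * u (- z) * p z \<partial>lborel) = ?c * (\<integral>z. u z * p (- z) \<partial>lborel)"
      using integral_reflect[of "\<lambda>z. ?c * u z * p (- z)"] by (simp add: mult.assoc)
    finally show "(\<integral>z. (U z - ?c * u (- z)) * p z \<partial>lborel) = 0" by simp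
  qed
  then have "(\<integral>z. f z * U z \<partial>lborel) = (\<integral>z. f z * (?c * u (- z)) \<partial>lborel)"
    by (intro integral_cong_AE) auto
  also have "\<dots> = (\<integral>z. ?c * f (- z) * u z \<partial>lborel)"
    using integral_reflect[of "\<lambda>z. f z * (?c * u (- z))"] by (simp add: ac_simps)
  finally show "(\<integral>z. ?c * f (- z) * u z \<partial>lborel) = (\<integral>z. g z * fourier u z \<partial>lborel)"
    using L2_fourier_duality[OF assms U] by simp
qed

lemma sq_norm_reflect:
  assumes [measurable]: "f \<in> borel_measurable borel" shows "sq_norm (\<lambda>z. f (- z)) = sq_norm f"
  unfolding sq_norm_def using integral_reflect[of "\<lambda>z. (cmod (f z))\<^sup>2"] by simp

text \<open>The norm bound is applied to the pair \<open>f\<close>, \<open>g\<close> and to the inverted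
  pair; the two inequalities are converse to each other.\<close>

proposition Plancherel:
  fixes f g :: "'a::euclidean_space \<Rightarrow> complex"
  assumes "L2_fourier f g"
  shows "sq_norm g = (2 * pi) ^ DIM('a) * sq_norm f"
proof -
  let ?c = "(2 * pi) ^ DIM('a)"
  note A = L2_fourierD[OF assms]
  have "sq_norm (\<lambda>z. complex_of_real ?c * f (- z)) = ?c\<^sup>2 * sq_norm f"
    using L2_cmult(2)[OF L2_reflect[OF A(1)], of "complex_of_real ?c"] sq_norm_reflect[of f] A(1)
    by (simp add: L2_def norm_power norm_mult)
  then have "?c * (?c * sq_norm f) \<le> ?c * sq_norm g"
    using L2_fourier_bound[OF L2_fourier_inversion[OF assms]] by (simp add: power2_eq_square mult.assoc)
  then have "?c * sq_norm f \<le> sq_norm g" by (rule mult_left_le_imp_le) simp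
  then show ?thesis using L2_fourier_bound[OF assms] by simp
qed

lemma L2_fourier_onto:
  fixes g :: "'a::euclidean_space \<Rightarrow> complex"
  assumes "L2 g" shows "\<exists>f. L2_fourier f g"
proof -
  obtain a where "L2_fourier g a" using L2_fourier_exists[OF assms] by blast
  from L2_fourier_cmult[OF L2_fourier_reflect[OF L2_fourier_inversion[OF this]], of "1 / (2 * pi) ^ DIM('a)"]
  show ?thesis by auto
qed

section \<open>Directional derivatives\<close>

lemma dir_deriv_eq:
  assumes "(f has_derivative D) (at z)" shows "dir_deriv e f z = D e"
  using frechet_derivative_at[OF assms] by (simp add: dir_deriv_def)

lemma has_derivative_dir_deriv:
  assumes "f differentiable (at z)" shows "(f has_derivative (\<lambda>e. dir_deriv e f z)) (at z)"
  using assms unfolding dir_deriv_def by (simp add: frechet_derivative_works eta_contract_eq)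

lemma times_cont_diff_continuous: "times_cont_diff k f \<Longrightarrow> continuous_on UNIV f"
  by (cases k) (auto simp: continuous_on_eq_continuous_at differentiable_imp_continuous_within)

lemma times_cont_diff_SucD: "times_cont_diff (Suc k) f \<Longrightarrow> times_cont_diff k f"
proof (induction k arbitrary: f)
  case 0 then show ?case using times_cont_diff_continuous[of "Suc 0" f] by simp
qed simp

lemma times_cont_diff_SucI:
  assumes "\<And>z. (f has_derivative (\<lambda>e. D e z)) (at z)" "\<And>e. times_cont_diff k (D e)"
  shows "times_cont_diff (Suc k) f"
proof -
  have "dir_deriv e f = D e" for e using dir_deriv_eq[OF assms(1)] by (auto simp: fun_eq_iff)
  then show ?thesis using assms by (auto simp: differentiable_def)
qed

lemma times_cont_diff_const: "times_cont_diff k (\<lambda>z. c)"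
proof (induction k arbitrary: c)
  case (Suc k)
  show ?case by (rule times_cont_diff_SucI[where D="\<lambda>e z. 0"]) (auto intro: Suc)
qed simp

lemma times_cont_diff_add:
  "times_cont_diff k f \<Longrightarrow> times_cont_diff k g \<Longrightarrow> times_cont_diff k (\<lambda>z. f z + g z)"
proof (induction k arbitrary: f g)
  case 0 then show ?case by (auto intro: continuous_intros)
next
  case (Suc k)
  show ?case
  proof (rule times_cont_diff_SucI[where D="\<lambda>e z. dir_deriv e f z + dir_deriv e g z"])
    fix z show "((\<lambda>z. f z + g z) has_derivative (\<lambda>e. dir_deriv e f z + dir_deriv e g z)) (at z)"
      using Suc.prems by (auto intro!: derivative_intros has_derivative_dir_deriv)
  qed (use Suc in auto)
qed

lemma (in bounded_bilinear) times_cont_diff_prod: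
  "times_cont_diff k f \<Longrightarrow> times_cont_diff k g \<Longrightarrow> times_cont_diff k (\<lambda>z. prod (f z) (g z))"
proof (induction k arbitrary: f g)
  case 0 then show ?case by (auto intro: continuous_on)
next
  case (Suc k)
  note m = times_cont_diff_SucD[OF Suc.prems(1)] times_cont_diff_SucD[OF Suc.prems(2)]
  show ?case
  proof (rule times_cont_diff_SucI[where D="\<lambda>e z. prod (f z) (dir_deriv e g z) + prod (dir_deriv e f z) (g z)"])
    fix z show "((\<lambda>z. prod (f z) (g z)) has_derivative (\<lambda>e. prod (f z) (dir_deriv e g z) + prod (dir_deriv e f z) (g z))) (at z)"
      using Suc.prems by (intro FDERIV has_derivative_dir_deriv) auto
    fix e show "times_cont_diff k (\<lambda>z. prod (f z) (dir_deriv e g z) + prod (dir_deriv e f z) (g z))"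
      using Suc.prems m by (intro times_cont_diff_add Suc.IH) auto
  qed
qed

lemmas times_cont_diff_mult = bounded_bilinear.times_cont_diff_prod[OF bounded_bilinear_mult]
lemmas times_cont_diff_scaleR = bounded_bilinear.times_cont_diff_prod[OF bounded_bilinear_scaleR]
lemmas times_cont_diff_inner = bounded_bilinear.times_cont_diff_prod[OF bounded_bilinear_inner]

lemma times_cont_diff_bounded_linear:
  assumes "bounded_linear L" shows "times_cont_diff k L"
proof (cases k)
  case 0 then show ?thesis using assms by (simp add: linear_continuous_on)
next
  case (Suc j)
  show ?thesis unfolding Suc
    by (rule times_cont_diff_SucI[where D="\<lambda>e z. L e"])
       (auto intro: times_cont_diff_const bounded_linear_imp_has_derivative assms)
qed

lemma has_derivative_affine_compose:
  assumes "f differentiable (at (L z + c))" "bounded_linear L"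
  shows "((\<lambda>z. f (L z + c)) has_derivative (\<lambda>e. dir_deriv (L e) f (L z + c))) (at z)"
proof -
  have "((\<lambda>z. L z + c) has_derivative L) (at z)"
    using bounded_linear_imp_has_derivative[OF assms(2)] by (auto intro!: derivative_eq_intros)
  from has_derivative_compose[OF this, of f "\<lambda>e. dir_deriv e f (L z + c)"]
  show ?thesis using has_derivative_dir_deriv[OF assms(1)] by simp
qed

lemma times_cont_diff_affine_compose:
  assumes "bounded_linear L"
  shows "times_cont_diff k f \<Longrightarrow> times_cont_diff k (\<lambda>z. f (L z + c))"
proof (induction k arbitrary: f)
  case 0
  have "continuous_on UNIV (\<lambda>z. L z + c)" by (intro continuous_intros linear_continuous_on assms)
  then show ?case using 0 continuous_on_compose2[of UNIV f UNIV "\<lambda>z. L z + c"] by simp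
next
  case (Suc k)
  show ?case
    by (rule times_cont_diff_SucI[where D="\<lambda>e z. dir_deriv (L e) f (L z + c)"])
       (use Suc assms in \<open>auto intro: has_derivative_affine_compose\<close>)
qed

lemma times_cont_diff_real_compose:
  fixes f :: "real \<Rightarrow> 'b::real_normed_vector" and g :: "'a::real_normed_vector \<Rightarrow> real"
  shows "times_cont_diff k f \<Longrightarrow> times_cont_diff k g \<Longrightarrow> times_cont_diff k (\<lambda>z. f (g z))"
proof (induction k arbitrary: f g)
  case 0 then show ?case using continuous_on_compose2[of UNIV f UNIV g] by simp
next
  case (Suc k)
  show ?case
  proof (rule times_cont_diff_SucI[where D="\<lambda>e z. dir_deriv e g z *\<^sub>R dir_deriv 1 f (g z)"])
    fix z
    have g: "(g has_derivative (\<lambda>e. dir_deriv e g z)) (at z)"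
      using Suc.prems by (auto intro: has_derivative_dir_deriv)
    have f: "(f has_derivative (\<lambda>e. dir_deriv e f (g z))) (at (g z))"
      using Suc.prems by (auto intro: has_derivative_dir_deriv)
    have e: "(\<lambda>a. dir_deriv a f (g z)) = (\<lambda>a. a *\<^sub>R dir_deriv 1 f (g z))"
    proof
      fix a :: real
      show "dir_deriv a f (g z) = a *\<^sub>R dir_deriv 1 f (g z)"
        using linear_scale[OF has_derivative_linear[OF f], of a 1] by (simp only: real_scaleR_def mult_1_right)
    qed
    show "((\<lambda>z. f (g z)) has_derivative (\<lambda>e. dir_deriv e g z *\<^sub>R dir_deriv 1 f (g z))) (at z)"
      by (rule has_derivative_compose[OF g f[unfolded e]])
    fix e show "times_cont_diff k (\<lambda>z. dir_deriv e g z *\<^sub>R dir_deriv 1 f (g z))"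
      using Suc.prems times_cont_diff_SucD[OF Suc.prems(2)] by (intro times_cont_diff_scaleR Suc.IH) auto
  qed
qed

section \<open>Test functions\<close>

lemma zero_outside_support: "z \<notin> closure {z. f z \<noteq> 0} \<Longrightarrow> f z = 0"
  using closure_subset[of "{z. f z \<noteq> 0}"] by blast

lemma dir_deriv_zero_outside_support:
  assumes "z \<notin> closure {z. f z \<noteq> 0}" shows "dir_deriv e f z = 0"
proof -
  have "((\<lambda>z. 0) has_derivative (\<lambda>e. 0)) (at z)" by simp
  then have "(f has_derivative (\<lambda>e. 0)) (at z)"
  proof (rule has_derivative_transform_within_open)
    show "open (- closure {z. f z \<noteq> 0})" "z \<in> - closure {z. f z \<noteq> 0}" using assms by auto
    show "0 = f x" if "x \<in> - closure {z. f z \<noteq> 0}" for x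
      by (rule zero_outside_support[symmetric]) (use that in simp)
  qed
  then show ?thesis by (simp add: dir_deriv_eq)
qed

lemma test_functionD:
  assumes "test_function f"
  shows "times_cont_diff k f" "f differentiable (at z)" "continuous_on UNIV f"
  using assms times_cont_diff_continuous[of 0 f] by (auto simp: test_function_def dest: spec[of _ "Suc 0"])

lemma test_function_dir_deriv:
  assumes "test_function f" shows "test_function (dir_deriv e f)"
  unfolding test_function_def
proof (intro conjI allI)
  fix k show "times_cont_diff k (dir_deriv e f)" using test_functionD(1)[OF assms, of "Suc k"] by simp
  have "closure {z. dir_deriv e f z \<noteq> 0} \<subseteq> closure {z. f z \<noteq> 0}"
    using dir_deriv_zero_outside_support[of _ f e] by (intro closure_minimal) auto
  then show "compact (closure {z. dir_deriv e f z \<noteq> 0})"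
    using assms compact_Int_closed[of "closure {z. f z \<noteq> 0}" "closure {z. dir_deriv e f z \<noteq> 0}"]
    by (auto simp: test_function_def Int_absorb1)
qed

lemma test_function_nice:
  assumes "test_function f" shows "nice f"
  using test_functionD(3)[OF assms] assms closure_subset[of "{z. f z \<noteq> 0}"]
  by (intro nice_continuous_compact[of f "closure {z. f z \<noteq> 0}"]) (auto simp: test_function_def)

lemma test_functionI:
  assumes "\<And>k. times_cont_diff k f" "compact K" "\<And>z. z \<notin> K \<Longrightarrow> f z = 0"
  shows "test_function f"
  unfolding test_function_def
proof (intro conjI allI assms(1))
  have "closure {z. f z \<noteq> 0} \<subseteq> K" using assms by (intro closure_minimal compact_imp_closed) auto
  then show "compact (closure {z. f z \<noteq> 0})"
    using assms(2) compact_Int_closed[of K "closure {z. f z \<noteq> 0}"] by (simp add: Int_absorb1)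
qed

text \<open>The difference quotients of \<open>f\<close> in direction \<open>e\<close> have integral
  \<open>0\<close> by translation invariance, and the mean value inequality dominates them by a
  multiple of the indicator of a ball.\<close>

lemma integral_dir_deriv_eq_0:
  fixes f :: "'a::euclidean_space \<Rightarrow> complex"
  assumes diff: "\<And>z. f differentiable (at z)" and cont: "continuous_on UNIV (dir_deriv e f)"
    and K: "compact K" "\<And>z. z \<notin> K \<Longrightarrow> f z = 0"
  shows "(\<integral>z. dir_deriv e f z \<partial>lborel) = 0"
proof -
  have fc: "continuous_on UNIV f" using diff by (auto simp: continuous_on_eq_continuous_at differentiable_imp_continuous_within)
  have [measurable]: "f \<in> borel_measurable borel" "dir_deriv e f \<in> borel_measurable borel"
    using fc cont by (auto intro: borel_measurable_continuous_onI)
  have nf: "nice f" by (rule nice_continuous_compact[OF fc K])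
  have "closure {z. f z \<noteq> 0} \<subseteq> K" using K by (intro closure_minimal compact_imp_closed) auto
  then have "nice (dir_deriv e f)"
    using dir_deriv_zero_outside_support[of _ f e] by (intro nice_continuous_compact[OF cont K(1)]) auto
  then obtain B where B: "\<And>z. cmod (dir_deriv e f z) \<le> B" by (auto simp: nice_def)
  have B0: "B \<ge> 0" using B[of 0] norm_ge_zero order_trans by blast
  obtain R where R: "\<And>z. z \<in> K \<Longrightarrow> norm z \<le> R"
    using compact_imp_bounded[OF K(1)] by (auto simp: bounded_iff)
  define h where "h n = inverse (real (Suc n))" for n
  have h: "0 < h n" "h n \<le> 1" for n by (auto simp: h_def inverse_le_1_iff)
  define q where "q n z = (f (z + h n *\<^sub>R e) - f z) /\<^sub>R h n" for n z
  have q0: "(\<integral>z. q n z \<partial>lborel) = 0" for n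
    unfolding q_def using integral_translate[of f "h n *\<^sub>R e"] integrable_translate[OF nice_integrable[OF nf], of "h n *\<^sub>R e"]
      nice_integrable[OF nf] by simp
  have line: "((\<lambda>s. f (z + s *\<^sub>R e)) has_derivative (\<lambda>a. a *\<^sub>R dir_deriv e f (z + s *\<^sub>R e))) (at s)" for z s
  proof -
    have 1: "((\<lambda>s. z + s *\<^sub>R e) has_derivative (\<lambda>a. a *\<^sub>R e)) (at s)" by (auto intro!: derivative_eq_intros)
    note 2 = has_derivative_dir_deriv[OF diff, of "z + s *\<^sub>R e"]
    have "dir_deriv (a *\<^sub>R e) f (z + s *\<^sub>R e) = a *\<^sub>R dir_deriv e f (z + s *\<^sub>R e)" for a
      by (rule linear_scale[OF has_derivative_linear[OF 2]])
    then show ?thesis using has_derivative_compose[OF 1 2] by simp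
  qed
  have qb: "cmod (q n z) \<le> B" for n z
  proof -
    have "cmod (f (z + h n *\<^sub>R e) - f (z + 0 *\<^sub>R e)) \<le> B * norm (h n - 0)"
    proof (rule differentiable_bound[of UNIV "\<lambda>s. f (z + s *\<^sub>R e)" "\<lambda>s a. a *\<^sub>R dir_deriv e f (z + s *\<^sub>R e)"])
      show "onorm (\<lambda>a. a *\<^sub>R dir_deriv e f (z + s *\<^sub>R e)) \<le> B" for s
        using B[of "z + s *\<^sub>R e"] B0 by (intro onorm_bound) (auto simp: mult.commute[of B] mult_left_mono)
    qed (use line in auto)
    moreover have "cmod (q n z) = cmod (f (z + h n *\<^sub>R e) - f z) / h n"
      using h[of n] by (simp add: q_def divide_inverse_commute)
    ultimately show ?thesis using h[of n] by (simp add: pos_divide_le_eq)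
  qed
  have qs: "q n z = 0" if "norm z > R + norm e" for n z
  proof -
    have "norm (h n *\<^sub>R e) \<le> norm e" using h[of n] by (simp add: mult_left_le_one_le)
    then have "norm z \<le> norm (z + h n *\<^sub>R e) + norm e"
      using norm_triangle_ineq4[of "z + h n *\<^sub>R e" "h n *\<^sub>R e"] by simp
    then have "z \<notin> K" "z + h n *\<^sub>R e \<notin> K"
      using that R[of z] R[of "z + h n *\<^sub>R e"] norm_ge_zero[of e] by auto
    then show ?thesis by (simp add: q_def K(2))
  qed
  have lim: "(\<lambda>n. q n z) \<longlonglongrightarrow> dir_deriv e f z" for z
  proof -
    let ?d = "dir_deriv e f z"
    have "((\<lambda>s. cmod (f (z + s *\<^sub>R e) - f z - s *\<^sub>R ?d) / norm s) \<longlongrightarrow> 0) (at 0)"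
      using line[of z 0] by (simp add: has_derivative_at)
    then have "((\<lambda>s. cmod ((f (z + s *\<^sub>R e) - f z) /\<^sub>R s - ?d)) \<longlongrightarrow> 0) (at 0)"
    proof (rule Lim_transform_eventually)
      have "cmod (f (z + s *\<^sub>R e) - f z - s *\<^sub>R ?d) / norm s = cmod ((f (z + s *\<^sub>R e) - f z) /\<^sub>R s - ?d)"
        if "s \<noteq> 0" for s
      proof -
        have "(f (z + s *\<^sub>R e) - f z) /\<^sub>R s - ?d = (f (z + s *\<^sub>R e) - f z - s *\<^sub>R ?d) /\<^sub>R s"
          using that by (simp add: scaleR_diff_right)
        then show ?thesis by (simp add: divide_inverse_commute)
      qed
      then show "\<forall>\<^sub>F s in at 0. cmod (f (z + s *\<^sub>R e) - f z - s *\<^sub>R ?d) / norm s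
          = cmod ((f (z + s *\<^sub>R e) - f z) /\<^sub>R s - ?d)"
        by (simp add: eventually_at_filter)
    qed
    then have l: "((\<lambda>s. (f (z + s *\<^sub>R e) - f z) /\<^sub>R s) \<longlongrightarrow> ?d) (at 0)"
      by (simp only: tendsto_norm_zero_iff LIM_zero_iff)
    have "h \<longlonglongrightarrow> 0" unfolding h_def by (rule LIMSEQ_inverse_real_of_nat)
    then have "filterlim h (at 0) sequentially"
      using h by (auto simp: filterlim_at intro!: always_eventually) (metis less_irrefl)
    from filterlim_compose[OF l this] show ?thesis by (simp add: q_def)
  qed
  have "(\<lambda>n. \<integral>z. q n z \<partial>lborel) \<longlonglongrightarrow> (\<integral>z. dir_deriv e f z \<partial>lborel)"
  proof (rule integral_dominated_convergence)
    show "integrable lborel (\<lambda>z::'a. indicator (cball 0 (R + norm e)) z *\<^sub>R B)"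
      using emeasure_lborel_cball_finite[of "0::'a" "R + norm e"] by (intro integrable_scaleR_left) (auto simp: less_top)
    show "AE z in lborel. cmod (q n z) \<le> indicator (cball 0 (R + norm e)) z *\<^sub>R B" for n
      using qb qs B0 by (intro AE_I2) (auto simp: indicator_def)
    show "q n \<in> borel_measurable lborel" for n unfolding q_def by measurable
  qed (use lim in auto)
  then show ?thesis unfolding q0 by (simp add: LIMSEQ_const_iff)
qed

text \<open>The derivative of \<open>\<lambda>z. cis (k \<bullet> z) * f z\<close> has integral
  \<open>0\<close>.\<close>

lemma fourier_dir_deriv:
  fixes f :: "'a::euclidean_space \<Rightarrow> complex"
  assumes "test_function f"
  shows "fourier (dir_deriv e f) k = - \<i> * complex_of_real (k \<bullet> e) * fourier f k"
proof -
  let ?g = "\<lambda>z. cis (k \<bullet> z) * f z"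
  note tf = test_functionD[OF assms]
  have cis: "((\<lambda>z. cis (k \<bullet> z)) has_derivative (\<lambda>e. \<i> * complex_of_real (k \<bullet> e) * cis (k \<bullet> z))) (at z)" for z
  proof -
    have 1: "((\<lambda>z. \<i> * complex_of_real (k \<bullet> z)) has_derivative (\<lambda>e. \<i> * complex_of_real (k \<bullet> e))) (at z)"
      by (auto intro!: derivative_eq_intros)
    show ?thesis
      using has_derivative_compose[OF 1 DERIV_exp[unfolded has_field_derivative_def]]
      by (simp add: cis_conv_exp mult.commute)
  qed
  have d: "(?g has_derivative (\<lambda>e. cis (k \<bullet> z) * dir_deriv e f z + \<i> * complex_of_real (k \<bullet> e) * cis (k \<bullet> z) * f z)) (at z)" for z
    by (rule has_derivative_mult[OF cis has_derivative_dir_deriv[OF tf(2)]])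
  have dd: "dir_deriv e ?g = (\<lambda>z. cis (k \<bullet> z) * dir_deriv e f z + \<i> * complex_of_real (k \<bullet> e) * (cis (k \<bullet> z) * f z))"
    using dir_deriv_eq[OF d] by (auto simp: fun_eq_iff)
  have cd: "continuous_on UNIV (dir_deriv e f)"
    using test_functionD(3)[OF test_function_dir_deriv[OF assms]] .
  have "(\<integral>z. dir_deriv e ?g z \<partial>lborel) = 0"
  proof (rule integral_dir_deriv_eq_0)
    show "?g differentiable (at z)" for z using d by (auto simp: differentiable_def)
    show "continuous_on UNIV (dir_deriv e ?g)" unfolding dd using cd tf(3) by (intro continuous_intros)
    show "compact (closure {z. f z \<noteq> 0})" using assms by (simp add: test_function_def)
    show "?g z = 0" if "z \<notin> closure {z. f z \<noteq> 0}" for z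
      using that closure_subset[of "{z. f z \<noteq> 0}"] by auto
  qed
  then have "fourier (dir_deriv e f) k + \<i> * complex_of_real (k \<bullet> e) * fourier f k = 0"
    unfolding dd fourier_def
    using integrable_cis_mult[OF nice_integrable[OF test_function_nice[OF assms]], of k]
      integrable_cis_mult[OF nice_integrable[OF test_function_nice[OF test_function_dir_deriv[OF assms]]], of k]
    by simp
  then show ?thesis by (simp add: add_eq_0_iff)
qed

section \<open>Smooth bumps\<close>

text \<open>The powers of \<open>1 / s\<close> are included because the span of these functions is closed
  under differentiation: smoothness of each of them follows by one induction for all
  \<open>m\<close>.\<close>

definition flat :: "nat \<Rightarrow> real \<Rightarrow> real" where
  "flat m s = (if s > 0 then (1 / s) ^ m * exp (- (1 / s)) else 0)"

lemma flat_tendsto_0: "(flat m \<longlongrightarrow> 0) (at 0)"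
  unfolding filterlim_at_split
proof
  have "eventually (\<lambda>s. flat m s = 0) (at_left 0)"
    by (auto simp: eventually_at_filter flat_def)
  then show "(flat m \<longlongrightarrow> 0) (at_left 0)" by (rule tendsto_eventually)
  have "((\<lambda>x. x ^ m / exp x) \<longlongrightarrow> (0::real)) at_top" by (rule tendsto_power_div_exp_0)
  then have "((\<lambda>s. (inverse s) ^ m / exp (inverse s)) \<longlongrightarrow> (0::real)) (at_right 0)"
    by (rule filterlim_compose) (rule filterlim_inverse_at_top_right)
  moreover have "eventually (\<lambda>s. (inverse s) ^ m / exp (inverse s) = flat m s) (at_right 0)"
    by (auto simp: eventually_at_filter flat_def inverse_eq_divide exp_minus)
  ultimately show "(flat m \<longlongrightarrow> 0) (at_right 0)" by (rule Lim_transform_eventually)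
qed

lemma flat_has_real_derivative:
  "(flat m has_real_derivative (flat (m + 2) s - real m * flat (m + 1) s)) (at s)"
proof (cases "s = 0")
  case True
  have "((\<lambda>h. (flat m (0 + h) - flat m 0) / h) \<longlongrightarrow> 0) (at 0)"
  proof (rule Lim_transform_eventually[OF flat_tendsto_0[of "Suc m"]])
    show "eventually (\<lambda>h. flat (Suc m) h = (flat m (0 + h) - flat m 0) / h) (at 0)"
      by (auto simp: flat_def eventually_at_filter)
  qed
  then show ?thesis unfolding True by (simp add: DERIV_def flat_def)
next
  case False
  show ?thesis
  proof (cases "s > 0")
    case True
    have "((\<lambda>s. (1 / s) ^ m * exp (- (1 / s))) has_real_derivative
        real m * (1 / s) ^ (m - 1) * (- (1 / s)\<^sup>2) * exp (- (1 / s)) + (1 / s) ^ m * (exp (- (1 / s)) * (1 / s)\<^sup>2)) (at s)"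
      using True by (auto intro!: derivative_eq_intros simp: power2_eq_square)
    moreover have "real m * x ^ (m - 1) * (- x\<^sup>2) * E + x ^ m * (E * x\<^sup>2) = x ^ (m + 2) * E - real m * (x ^ (m + 1) * E)" for x E :: real
      by (cases m) (simp_all add: algebra_simps power2_eq_square)
    ultimately have "((\<lambda>s. (1 / s) ^ m * exp (- (1 / s))) has_real_derivative (flat (m + 2) s - real m * flat (m + 1) s)) (at s)"
      using True by (simp add: flat_def)
    then show ?thesis
      by (rule has_field_derivative_transform_within_open[of _ _ _ "{0<..}"]) (use True in \<open>auto simp: flat_def\<close>)
  next
    case f: False
    have "((\<lambda>s. 0) has_real_derivative (flat (m + 2) s - real m * flat (m + 1) s)) (at s)"
      using f by (simp add: flat_def)
    then show ?thesis
      by (rule has_field_derivative_transform_within_open[of _ _ _ "{..<0}"]) (use f False in \<open>auto simp: flat_def\<close>)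
  qed
qed

lemma times_cont_diff_flat: "times_cont_diff k (flat m)"
proof (induction k arbitrary: m)
  case 0
  show ?case using flat_has_real_derivative by (auto simp: continuous_on_eq_continuous_at intro: DERIV_isCont)
next
  case (Suc k)
  show ?case
  proof (rule times_cont_diff_SucI[where D="\<lambda>e s. e * (flat (m + 2) s + (- real m) * flat (m + 1) s)"])
    fix s show "(flat m has_derivative (\<lambda>e. e * (flat (m + 2) s + (- real m) * flat (m + 1) s))) (at s)"
      using flat_has_real_derivative[of m s] by (simp add: has_field_derivative_def mult.commute[of _ "flat _ _ - _"] mult_commute_abs)
    fix e show "times_cont_diff k (\<lambda>s. e * (flat (m + 2) s + (- real m) * flat (m + 1) s))"
      by (intro times_cont_diff_mult times_cont_diff_add times_cont_diff_const Suc)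
  qed
qed

definition bump :: "real \<Rightarrow> 'a::euclidean_space \<Rightarrow> complex" where
  "bump r z = complex_of_real (flat 0 (r\<^sup>2 - z \<bullet> z))"

lemma times_cont_diff_bump: "times_cont_diff k (bump r)"
proof -
  have "times_cont_diff k (\<lambda>z::'a. r\<^sup>2 + (- 1) * (z \<bullet> z))"
    by (intro times_cont_diff_add times_cont_diff_mult times_cont_diff_inner times_cont_diff_const
        times_cont_diff_bounded_linear bounded_linear_ident)
  from times_cont_diff_real_compose[OF times_cont_diff_real_compose[OF times_cont_diff_bounded_linear[OF bounded_linear_of_real] times_cont_diff_flat[of k 0]] this]
  show ?thesis by (simp add: bump_def[abs_def])
qed

lemma bump_eq_0: "norm z \<ge> r \<Longrightarrow> r \<ge> 0 \<Longrightarrow> bump r z = 0"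
  using power_mono[of r "norm z" 2] by (simp add: bump_def flat_def power2_norm_eq_inner)

lemma test_function_bump:
  assumes "r \<ge> 0" shows "test_function (bump r :: 'a::euclidean_space \<Rightarrow> complex)"
  by (rule test_functionI[of _ "cball 0 r"]) (use assms in \<open>auto intro!: bump_eq_0 times_cont_diff_bump\<close>)

section \<open>The symbol of the operator\<close>

lemma nice_add:
  assumes "nice u" "nice v" shows "nice (\<lambda>z. u z + v z)"
proof -
  obtain B R B' R' where b: "\<And>z. cmod (u z) \<le> B" "\<And>z. u z \<noteq> 0 \<Longrightarrow> norm z \<le> R"
      "\<And>z. cmod (v z) \<le> B'" "\<And>z. v z \<noteq> 0 \<Longrightarrow> norm z \<le> R'"
    using assms by (auto simp: nice_def)
  have "cmod (u z + v z) \<le> B + B'" for z using b(1,3)[of z] norm_triangle_mono by blast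
  moreover have "norm z \<le> max R R'" if "u z + v z \<noteq> 0" for z
    using that b(2,4)[of z] by (cases "u z = 0") (auto simp: le_max_iff_disj)
  ultimately show ?thesis using assms unfolding nice_def by (auto intro!: exI)
qed

lemma nice_cmult: "nice u \<Longrightarrow> nice (\<lambda>z. c * u z)"
  by (rule nice_mult_bounded[of u "\<lambda>z. c" "cmod c"]) auto

lemma nice_diff: "nice u \<Longrightarrow> nice v \<Longrightarrow> nice (\<lambda>z. u z - v z)"
  using nice_add[of u "\<lambda>z. (-1) * v z"] nice_cmult[of v "-1"] by simp

lemma nice_zero: "nice (\<lambda>z. 0)"
  by (auto simp: nice_def)

lemma nice_sum: "(\<And>i. i \<in> I \<Longrightarrow> nice (u i)) \<Longrightarrow> nice (\<lambda>z. \<Sum>i\<in>I. u i z)"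
  by (induction I rule: infinite_finite_induct) (auto intro: nice_zero nice_add)

lemma fourier_add:
  "nice u \<Longrightarrow> nice v \<Longrightarrow> fourier (\<lambda>z. u z + v z) k = fourier u k + fourier v k"
  unfolding fourier_def by (simp add: distrib_left integrable_cis_mult nice_integrable)

lemma fourier_diff:
  "nice u \<Longrightarrow> nice v \<Longrightarrow> fourier (\<lambda>z. u z - v z) k = fourier u k - fourier v k"
  unfolding fourier_def by (simp add: right_diff_distrib integrable_cis_mult nice_integrable)

lemma fourier_sum:
  "(\<And>i. i \<in> I \<Longrightarrow> nice (u i)) \<Longrightarrow> fourier (\<lambda>z. \<Sum>i\<in>I. u i z) k = (\<Sum>i\<in>I. fourier (u i) k)"
  unfolding fourier_def by (simp add: sum_distrib_left integrable_cis_mult nice_integrable)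

lemma nice_dir_deriv: "test_function f \<Longrightarrow> nice (dir_deriv e f)"
  by (intro test_function_nice test_function_dir_deriv)

lemma nice_dir_deriv2: "test_function f \<Longrightarrow> nice (dir_deriv e (dir_deriv e' f))"
  by (intro test_function_nice test_function_dir_deriv)

lemma fourier_dir_deriv2:
  "test_function f \<Longrightarrow> fourier (dir_deriv e (dir_deriv e' f)) k = - complex_of_real ((k \<bullet> e) * (k \<bullet> e')) * fourier f k"
  by (simp add: fourier_dir_deriv test_function_dir_deriv algebra_simps)

lemma nice_ultrahyperbolic_op:
  "test_function \<psi> \<Longrightarrow> nice (ultrahyperbolic_op \<psi>)"
  unfolding ultrahyperbolic_op_def[abs_def]
  by (intro nice_add nice_diff nice_sum nice_dir_deriv2)

text \<open>The polynomial on the right vanishes at the frequencies of those plane waves that solve the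
  equation.\<close>

lemma fourier_ultrahyperbolic_op:
  fixes \<psi> :: "real \<times> real \<times> (real^'d) \<times> (real^'n) \<Rightarrow> complex"
  assumes "test_function \<psi>"
  shows "fourier (ultrahyperbolic_op \<psi>) (\<tau>, \<sigma>, \<xi>, \<eta>)
    = complex_of_real (\<eta> \<bullet> \<eta> - \<xi> \<bullet> \<xi> - \<tau> * \<sigma>) * fourier \<psi> (\<tau>, \<sigma>, \<xi>, \<eta>)"
proof -
  note n = nice_dir_deriv2[OF assms]
  have 1: "\<xi> \<bullet> \<xi> = (\<Sum>i\<in>UNIV. \<xi> $ i * \<xi> $ i)" "\<eta> \<bullet> \<eta> = (\<Sum>i\<in>UNIV. \<eta> $ i * \<eta> $ i)"
    by (simp_all add: inner_vec_def)
  show ?thesis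
    unfolding ultrahyperbolic_op_def[abs_def] 1
    by (simp add: fourier_add fourier_diff fourier_sum n nice_add nice_sum fourier_dir_deriv2[OF assms]
        inner_prod_def inner_axis sum_distrib_left sum_negf algebra_simps)
qed

section \<open>Superpositions of plane waves\<close>

lemma norm_snd_le_Pair: "norm z \<le> norm (t, z)"
  by (rule norm_snd_le)

lemma norm_fst_le_Pair: "norm t \<le> norm (t, z)"
  by (rule norm_fst_le)

lemma measurable_slice:
  fixes f :: "'b::euclidean_space \<times> 'a::euclidean_space \<Rightarrow> 'c::topological_space"
  assumes "f \<in> borel_measurable borel"
  shows "(\<lambda>z. f (t, z)) \<in> borel_measurable borel" "(\<lambda>t. f (t, z)) \<in> borel_measurable borel"
proof -
  have [measurable]: "f \<in> borel_measurable (borel \<Otimes>\<^sub>M borel)" using assms by (simp add: borel_prod)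
  show "(\<lambda>z. f (t, z)) \<in> borel_measurable borel" "(\<lambda>t. f (t, z)) \<in> borel_measurable borel" by measurable
qed

text \<open>The uniform bound lets the slices be integrated over \<open>t\<close>.\<close>

lemma nice_slices:
  fixes \<Psi> :: "real \<times> 'a::euclidean_space \<Rightarrow> complex"
  assumes "nice \<Psi>"
  shows "nice (\<lambda>z. \<Psi> (t, z))" "\<exists>C R. \<forall>t. sq_norm (\<lambda>z. \<Psi> (t, z)) \<le> C * indicator {- R..R} t"
proof -
  obtain B R where B: "\<And>p. cmod (\<Psi> p) \<le> B" and R: "\<And>p. \<Psi> p \<noteq> 0 \<Longrightarrow> norm p \<le> R"
    using assms by (auto simp: nice_def)
  have B0: "B \<ge> 0" using B[of 0] norm_ge_zero order_trans by blast
  have m: "(\<lambda>z. \<Psi> (t, z)) \<in> borel_measurable borel" for t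
    using assms by (intro measurable_slice) (simp add: nice_def)
  show "nice (\<lambda>z. \<Psi> (t, z))"
    using m[of t] B R order_trans[OF norm_snd_le_Pair R] unfolding nice_def by blast
  let ?I = "indicator (cball 0 R) :: 'a \<Rightarrow> complex"
  have "nice ?I"
    unfolding nice_def
  proof (intro conjI)
    show "\<exists>B. \<forall>z. cmod (?I z) \<le> B" by (rule exI[of _ 1]) (simp add: indicator_def)
    show "\<exists>R. \<forall>z. ?I z \<noteq> 0 \<longrightarrow> norm z \<le> R" by (rule exI[of _ R]) (simp add: indicator_def)
  qed (rule borel_measurable_indicator, simp)
  then have I: "L2 ?I" by (rule nice_L2)
  have "sq_norm (\<lambda>z. \<Psi> (t, z)) \<le> B\<^sup>2 * sq_norm ?I * indicator {- R..R} t" for t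
  proof (cases "\<bar>t\<bar> \<le> R")
    case True
    have le: "cmod (\<Psi> (t, z)) \<le> B * cmod (?I z)" for z
      using B[of "(t, z)"] order_trans[OF norm_snd_le_Pair R, of t z] B0
      by (cases "\<Psi> (t, z) = 0") (auto simp: indicator_def)
    have "indicator {- R..R} t = (1::real)" using True by (simp add: abs_le_iff)
    then show ?thesis using L2_dominated(2)[OF I m le] by (simp only: mult_1_right)
  next
    case False
    then have "\<Psi> (t, z) = 0" for z using order_trans[OF norm_fst_le_Pair R, of t z] by auto
    then show ?thesis using False by (auto simp: indicator_def sq_norm_def)
  qed
  then show "\<exists>C R. \<forall>t. sq_norm (\<lambda>z. \<Psi> (t, z)) \<le> C * indicator {- R..R} t" by blast
qed

lemma fourier_Pair:
  fixes \<Psi> :: "real \<times> 'a::euclidean_space \<Rightarrow> complex"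
  assumes "integrable lborel \<Psi>"
  shows "fourier \<Psi> (\<tau>, k) = (\<integral>t. cis (t * \<tau>) * fourier (\<lambda>z. \<Psi> (t, z)) k \<partial>lborel)"
proof -
  have "integrable (lborel \<Otimes>\<^sub>M lborel) (\<lambda>p. cis ((\<tau>, k) \<bullet> p) * \<Psi> p)"
    using integrable_cis_mult[OF assms, of "(\<tau>, k)"] unfolding lborel_prod[symmetric] .
  from lborel_pair.integral_fst'[OF this]
  have "fourier \<Psi> (\<tau>, k) = (\<integral>t. (\<integral>z. cis ((\<tau>, k) \<bullet> (t, z)) * \<Psi> (t, z) \<partial>lborel) \<partial>lborel)"
    unfolding fourier_def lborel_prod[symmetric] by simp
  also have "\<dots> = (\<integral>t. cis (t * \<tau>) * fourier (\<lambda>z. \<Psi> (t, z)) k \<partial>lborel)"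
    unfolding fourier_def by (simp add: cis_mult[symmetric] mult.assoc mult.commute[of \<tau>])
  finally show ?thesis .
qed

lemma slice_fourier_measurable:
  fixes \<Psi> :: "real \<times> 'a::euclidean_space \<Rightarrow> complex"
  assumes "\<Psi> \<in> borel_measurable borel"
  shows "(\<lambda>(t, k). fourier (\<lambda>z. \<Psi> (t, z)) k) \<in> borel_measurable (borel \<Otimes>\<^sub>M borel)"
proof -
  have [measurable]: "\<Psi> \<in> borel_measurable (borel \<Otimes>\<^sub>M borel)" using assms by (simp add: borel_prod)
  have "(\<lambda>p. \<integral>z. cis (snd p \<bullet> z) * \<Psi> (fst p, z) \<partial>lborel) \<in> borel_measurable (borel \<Otimes>\<^sub>M borel)"
    by (rule lborel.borel_measurable_lebesgue_integral) measurable
  then show ?thesis by (simp add: fourier_def case_prod_beta')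
qed

text \<open>The function \<open>w\<close> is a superposition of the plane waves with space frequency
  \<open>k\<close> and time frequency \<open>\<tau> k\<close>. Moving the transform from
  \<open>w t\<close> to the slices of \<open>\<Psi>\<close> and integrating over
  \<open>t\<close> first leaves the space-time transform of \<open>\<Psi>\<close> at the
  frequency \<open>(\<tau> k, k)\<close>.\<close>

lemma plane_wave_superposition:
  fixes \<Psi> :: "real \<times> 'a::euclidean_space \<Rightarrow> complex"
  assumes g: "L2 g" and \<tau> [measurable]: "\<tau> \<in> borel_measurable borel"
    and w: "\<And>t. L2_fourier (\<lambda>k. cis (t * \<tau> k) * g k) (\<lambda>z. w (t, z))"
    and \<Psi>: "nice \<Psi>" and zero: "AE k in lborel. fourier \<Psi> (\<tau> k, k) = 0"
  shows "(\<integral>t. (\<integral>z. w (t, z) * \<Psi> (t, z) \<partial>lborel) \<partial>lborel) = 0"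
proof -
  define F where "F t k = fourier (\<lambda>z. \<Psi> (t, z)) k" for t k
  have [measurable]: "g \<in> borel_measurable borel" using g by (simp add: L2_def)
  have Fm [measurable]: "(\<lambda>(t, k). F t k) \<in> borel_measurable (borel \<Otimes>\<^sub>M borel)"
    unfolding F_def by (rule slice_fourier_measurable) (use \<Psi> in \<open>simp add: nice_def\<close>)
  obtain C R where CR: "\<And>t. sq_norm (\<lambda>z. \<Psi> (t, z)) \<le> C * indicator {- R..R} t"
    using nice_slices(2)[OF \<Psi>] by blast
  note ns = nice_slices(1)[OF \<Psi>]
  have FL2: "L2 (F t)" for t unfolding F_def using Plancherel_nice(1)[OF ns] .
  let ?c = "(2 * pi) ^ DIM('a)"
  let ?H = "\<lambda>(t, k). cis (t * \<tau> k) * g k * F t k"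
  define b where "b t = (\<integral>k. cmod (g k) * cmod (F t k) \<partial>lborel)" for t
  have bm: "b \<in> borel_measurable borel"
    unfolding b_def by (rule lborel.borel_measurable_lebesgue_integral) measurable
  have b_le: "norm (b t) \<le> sqrt (sq_norm g * (?c * C)) * indicator {- R..R} t" for t
  proof -
    have "(b t)\<^sup>2 \<le> sq_norm g * sq_norm (F t)"
      unfolding b_def by (rule L2_Cauchy_Schwarz_real[OF g FL2])
    also have "sq_norm (F t) = ?c * sq_norm (\<lambda>z. \<Psi> (t, z))"
      unfolding F_def by (rule Plancherel_nice(2)[OF ns])
    also have "sq_norm g * (?c * sq_norm (\<lambda>z. \<Psi> (t, z))) \<le> sq_norm g * (?c * (C * indicator {- R..R} t))"
      by (intro mult_left_mono CR) auto
    finally have "(b t)\<^sup>2 \<le> sq_norm g * (?c * C) * indicator {- R..R} t" by (simp add: mult.assoc)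
    moreover have "b t \<ge> 0" unfolding b_def by simp
    ultimately show ?thesis
      by (cases "t \<in> {- R..R}") (auto simp: real_le_rsqrt)
  qed
  have "integrable lborel b"
  proof (rule Bochner_Integration.integrable_bound)
    show "integrable lborel (\<lambda>t. sqrt (sq_norm g * (?c * C)) * indicator {- R..R} t)"
      by (simp add: emeasure_lborel_Icc_eq)
    show "AE t in lborel. norm (b t) \<le> norm (sqrt (sq_norm g * (?c * C)) * indicator {- R..R} t)"
      using b_le abs_ge_self order_trans by (intro AE_I2) (simp only: real_norm_def, blast)
  qed (use bm in simp)
  then have I: "integrable (lborel \<Otimes>\<^sub>M lborel) ?H"
  proof (intro lborel_pair.Fubini_integrable)
    show "AE t in lborel. integrable lborel (\<lambda>k. ?H (t, k))"
    proof (intro AE_I2)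
      fix t
      have "L2 (\<lambda>k. cis (t * \<tau> k) * g k)" using L2_fourierD(1)[OF w] .
      from L2_mult_integrable[OF this FL2] show "integrable lborel (\<lambda>k. ?H (t, k))" by simp
    qed
  qed (auto simp: norm_mult b_def[abs_def])
  have "(\<integral>t. (\<integral>z. w (t, z) * \<Psi> (t, z) \<partial>lborel) \<partial>lborel) = (\<integral>t. (\<integral>k. cis (t * \<tau> k) * g k * F t k \<partial>lborel) \<partial>lborel)"
    unfolding F_def L2_fourierD(3)[OF w ns] ..
  also have "\<dots> = (\<integral>k. (\<integral>t. cis (t * \<tau> k) * g k * F t k \<partial>lborel) \<partial>lborel)"
    using lborel_pair.Fubini_integral[OF I] by simp
  also have "\<dots> = (\<integral>k. g k * fourier \<Psi> (\<tau> k, k) \<partial>lborel)"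
  proof (intro Bochner_Integration.integral_cong refl)
    fix k
    have "(\<integral>t. cis (t * \<tau> k) * g k * F t k \<partial>lborel) = (\<integral>t. g k * (cis (t * \<tau> k) * F t k) \<partial>lborel)"
      by (simp add: ac_simps)
    also have "\<dots> = g k * fourier \<Psi> (\<tau> k, k)"
      unfolding fourier_Pair[OF nice_integrable[OF \<Psi>]] F_def by simp
    finally show "(\<integral>t. cis (t * \<tau> k) * g k * F t k \<partial>lborel) = g k * fourier \<Psi> (\<tau> k, k)" .
  qed
  also have "\<dots> = 0"
    using zero by (intro integral_eq_zero_AE) auto
  finally show ?thesis .
qed

lemma sq_norm_phase_tendsto:
  assumes g: "L2 g" and \<tau> [measurable]: "\<tau> \<in> borel_measurable borel"
  shows "((\<lambda>t. sq_norm (\<lambda>k. cis (t * \<tau> k) * g k - cis (t0 * \<tau> k) * g k)) \<longlongrightarrow> 0) (at t0)"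
proof -
  have [measurable]: "g \<in> borel_measurable borel" using g by (simp add: L2_def)
  have "(\<lambda>i. sq_norm (\<lambda>k. cis (X i * \<tau> k) * g k - cis (t0 * \<tau> k) * g k)) \<longlonglongrightarrow> 0" if X: "X \<longlonglongrightarrow> t0" for X :: "nat \<Rightarrow> real"
  proof -
    have "(\<lambda>i. sq_norm (\<lambda>k. cis (X i * \<tau> k) * g k - cis (t0 * \<tau> k) * g k)) \<longlonglongrightarrow> (\<integral>k. 0 \<partial>(lborel::'a measure))"
      unfolding sq_norm_def
    proof (rule integral_dominated_convergence)
      show "integrable lborel (\<lambda>k. 4 * (cmod (g k))\<^sup>2)" using g by (simp add: L2_def)
      show "AE k in lborel. (\<lambda>i. (cmod (cis (X i * \<tau> k) * g k - cis (t0 * \<tau> k) * g k))\<^sup>2) \<longlonglongrightarrow> 0"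
      proof (intro AE_I2)
        fix k
        have "(\<lambda>i. (cmod (cis (X i * \<tau> k) * g k - cis (t0 * \<tau> k) * g k))\<^sup>2) \<longlonglongrightarrow> (cmod (cis (t0 * \<tau> k) * g k - cis (t0 * \<tau> k) * g k))\<^sup>2"
          by (intro tendsto_intros X)
        then show "(\<lambda>i. (cmod (cis (X i * \<tau> k) * g k - cis (t0 * \<tau> k) * g k))\<^sup>2) \<longlonglongrightarrow> 0" by simp
      qed
      show "AE k in lborel. norm ((cmod (cis (X i * \<tau> k) * g k - cis (t0 * \<tau> k) * g k))\<^sup>2) \<le> 4 * (cmod (g k))\<^sup>2" for i
      proof (intro AE_I2)
        fix k
        show "norm ((cmod (cis (X i * \<tau> k) * g k - cis (t0 * \<tau> k) * g k))\<^sup>2) \<le> 4 * (cmod (g k))\<^sup>2"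
          using sq_sum_le[of "cis (X i * \<tau> k) * g k" "- (cis (t0 * \<tau> k) * g k)"] by (simp add: norm_mult)
      qed
    qed measurable
    then show ?thesis by simp
  qed
  then show ?thesis by (auto simp: tendsto_at_iff_sequentially comp_def)
qed

section \<open>Existence\<close>

lemma square_integrable_of_L2: "L2 f \<Longrightarrow> square_integrable f"
  unfolding square_integrable_def L2_def
  by (auto simp: integrable_completion intro: measurable_completion)

lemma L2_norm_eq: "f \<in> borel_measurable borel \<Longrightarrow> L2_norm f = sqrt (sq_norm f)"
  unfolding L2_norm_def sq_norm_def by (simp add: integral_completion)

text \<open>The frequencies \<open>\<sigma> = 0\<close>, where the equation does not determine
  \<open>\<partial>\<^sub>t v\<close>, form a null set. This is why data on the characteristic
  hyperplane \<open>t = 0\<close> determine the solution in the class of square-integrable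
  functions.\<close>

lemma AE_fst_neq_0: "AE k in lborel. fst (k :: real \<times> 'a::euclidean_space) \<noteq> 0"
proof -
  have "negligible {k :: real \<times> 'a. (1, 0) \<bullet> k = 0}"
    by (rule negligible_hyperplane) (simp add: zero_prod_def)
  then have "AE k in lebesgue. k \<notin> {k :: real \<times> 'a. (1, 0) \<bullet> k = 0}"
    by (intro AE_not_in) (simp add: negligible_iff_null_sets)
  then show ?thesis
    by (simp add: AE_completion_iff inner_prod_def) 
qed

text \<open>The dispersion relation. It is real valued, so that \<open>cis (t * time_frequency k)\<close>
  is unimodular for both signs of \<open>t\<close>. On the null set \<open>\<sigma> = 0\<close>
  the value is \<open>0\<close> by the convention for division.\<close>

definition time_frequency :: "real \<times> (real^'d) \<times> (real^'n) \<Rightarrow> real" where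
  "time_frequency k = (case k of (\<sigma>, \<xi>, \<eta>) \<Rightarrow> (\<eta> \<bullet> \<eta> - \<xi> \<bullet> \<xi>) / \<sigma>)"

lemma time_frequency_measurable [measurable]:
  "time_frequency \<in> borel_measurable (borel :: (real \<times> (real^'d) \<times> (real^'n)) measure)"
proof -
  have "(\<lambda>k :: real \<times> (real^'d) \<times> (real^'n). (snd (snd k) \<bullet> snd (snd k) - fst (snd k) \<bullet> fst (snd k)) / fst k) \<in> borel_measurable borel"
    by (intro borel_measurable_divide borel_measurable_continuous_onI continuous_intros)
  then show ?thesis by (simp add: time_frequency_def[abs_def] case_prod_beta')
qed

text \<open>The solution is the transform of \<open>\<lambda>k. cis (t * time_frequency k) * g k\<close>,
  where \<open>v0\<close> is the transform of \<open>g\<close>. Continuity in \<open>t\<close>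
  is dominated convergence on the frequency side.\<close>

proposition Cauchy_problem_existence:
  fixes v0 :: "real \<times> (real^'d) \<times> (real^'n) \<Rightarrow> complex"
  assumes "L2 v0"
  shows "\<exists>v. solves_Cauchy_problem v0 v"
proof -
  let ?\<tau> = "time_frequency :: real \<times> (real^'d) \<times> (real^'n) \<Rightarrow> real"
  obtain g where gv: "L2_fourier g v0" using L2_fourier_onto[OF assms] by blast
  note g = L2_fourierD(1)[OF gv]
  have gm [measurable]: "g \<in> borel_measurable borel" using g by (simp add: L2_def)
  have fm: "(\<lambda>(t, k). cis (t * ?\<tau> k) * g k) \<in> borel_measurable borel"
    unfolding borel_measurable_pair_borel by measurable
  obtain w where wm: "w \<in> borel_measurable borel"
    and w: "\<And>t::real. L2_fourier (\<lambda>k. cis (t * ?\<tau> k) * g k) (\<lambda>z. w (t, z))"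
    using L2_fourier_family[OF fm g] by (auto simp: norm_mult)
  define v where "v t z = w (t, z)" for t z
  have wL2: "L2 (\<lambda>z. w (t, z))" for t using L2_fourierD(2)[OF w] .
  have "L2_continuous_curve v"
    unfolding L2_continuous_curve_def
  proof (intro conjI allI)
    show "square_integrable (v t)" for t unfolding v_def using square_integrable_of_L2[OF wL2] .
    fix t0
    let ?P = "\<lambda>t. sq_norm (\<lambda>k. cis (t * ?\<tau> k) * g k - cis (t0 * ?\<tau> k) * g k)"
    let ?c = "(2 * pi) ^ DIM(real \<times> (real^'d) \<times> (real^'n))"
    \<comment> \<open>Plancherel, for the difference of two members of the family.\<close>
    have e: "L2_norm (\<lambda>z. v t z - v t0 z) = sqrt (?c * ?P t)" for t
      using L2_fourier_diff[OF w[of t] w[of t0]] L2_diff(1)[OF wL2[of t] wL2[of t0]] unfolding v_def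
      by (subst L2_norm_eq) (auto simp: L2_def Plancherel)
    have "((\<lambda>t. sqrt (?c * ?P t)) \<longlongrightarrow> sqrt (?c * 0)) (at t0)"
      by (intro tendsto_intros sq_norm_phase_tendsto g) measurable
    then show "((\<lambda>t. L2_norm (\<lambda>z. v t z - v t0 z)) \<longlongrightarrow> 0) (at t0)" unfolding e by simp
  qed
  moreover have "solves_equation v"
    unfolding solves_equation_def
  proof (intro exI conjI)
    show "joint_representative v w"
      unfolding joint_representative_def v_def using wm by (auto intro: measurable_completion)
    show "distributional_solution w"
      unfolding distributional_solution_def
    proof (intro allI impI)
      fix \<psi> :: "real \<times> real \<times> (real^'d) \<times> (real^'n) \<Rightarrow> complex" assume \<psi>: "test_function \<psi>"
      note n = nice_ultrahyperbolic_op[OF \<psi>]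
      have z: "AE k in lborel. fourier (ultrahyperbolic_op \<psi>) (?\<tau> k, k) = 0"
        using AE_fst_neq_0
      proof eventually_elim
        case (elim k)
        obtain \<sigma> \<xi> \<eta> where k: "k = (\<sigma>, \<xi>, \<eta>)" by (cases k) auto
        show ?case using elim unfolding k fourier_ultrahyperbolic_op[OF \<psi>] by (simp add: time_frequency_def)
      qed
      let ?\<Psi> = "ultrahyperbolic_op \<psi>"
      have pm [measurable]: "(\<lambda>p. w p * ?\<Psi> p) \<in> borel_measurable borel"
        using wm n by (auto simp: nice_def)
      have [measurable]: "(\<lambda>p. w p * ?\<Psi> p) \<in> borel_measurable (borel \<Otimes>\<^sub>M borel)"
        using pm by (simp only: borel_measurable_pair_borel)
      have 1: "(\<integral>z. w (t, z) * ?\<Psi> (t, z) \<partial>lebesgue) = (\<integral>z. w (t, z) * ?\<Psi> (t, z) \<partial>lborel)" for t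
        by (rule integral_completion) (use measurable_slice(1)[OF pm] in simp)
      have "(\<lambda>t. \<integral>z. w (t, z) * ?\<Psi> (t, z) \<partial>lborel) \<in> borel_measurable borel"
        by (rule lborel.borel_measurable_lebesgue_integral) measurable
      then have "(\<integral>t. (\<integral>z. w (t, z) * ?\<Psi> (t, z) \<partial>lebesgue) \<partial>lebesgue) = (\<integral>t. (\<integral>z. w (t, z) * ?\<Psi> (t, z) \<partial>lborel) \<partial>lborel)"
        unfolding 1 by (intro integral_completion) simp
      also have "\<dots> = 0"
        by (rule plane_wave_superposition[OF g time_frequency_measurable w n z])
      finally show "(\<integral>t. (\<integral>z. w (t, z) * ?\<Psi> (t, z) \<partial>lebesgue) \<partial>lebesgue) = 0" .
    qed
  qed
  moreover have "AE z in lebesgue. v 0 z = v0 z"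
    using L2_fourier_unique[OF _ gv, of "\<lambda>z. w (0, z)"] w[of 0] unfolding v_def AE_completion_iff by simp
  ultimately show ?thesis unfolding solves_Cauchy_problem_def by blast
qed

section \<open>Functions of one real variable\<close>

lemma antiderivative_exists:
  fixes f :: "real \<Rightarrow> complex"
  assumes "continuous_on UNIV f"
  shows "\<exists>F. \<forall>x. (F has_vector_derivative f x) (at x)"
  using einterval_antiderivative[of "- \<infinity>" "\<infinity>" f] assms
  by (auto simp: continuous_on_eq_continuous_at)

lemma dir_deriv_real: "(f has_vector_derivative f') (at x) \<Longrightarrow> dir_deriv e f x = e *\<^sub>R f'"
  by (rule dir_deriv_eq) (simp add: has_vector_derivative_def)

lemma constant_of_zero_derivative:
  fixes f :: "real \<Rightarrow> complex"
  assumes d: "\<And>x. (f has_vector_derivative f' x) (at x)" and z: "\<And>x. x \<in> {a..b} \<Longrightarrow> f' x = 0" and ab: "a \<le> b"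
  shows "f a = f b"
proof (cases "a = b")
  case False
  have c: "continuous_on UNIV f"
    using d by (auto simp: continuous_on_eq_continuous_at intro: has_vector_derivative_continuous)
  have "norm (f b - f a) \<le> (\<lambda>x. 0::real) b - (\<lambda>x. 0) a"
  proof (rule differentiable_bound_general[where f'=f' and \<phi>'="\<lambda>x. 0"])
    show "norm (f' x) \<le> 0" if "a < x" "x < b" for x using z[of x] that by simp
  qed (use False ab d continuous_on_subset[OF c] in auto)
  then show ?thesis by simp
qed simp

text \<open>On the support of the bump the phase stays below \<open>1\<close>, where the cosine is
  positive.\<close>

lemma fourier_bump_neq_0:
  assumes "r > 0" "norm k * r < 1"
  shows "fourier (bump r :: 'a::euclidean_space \<Rightarrow> complex) k \<noteq> 0"
proof -
  let ?b = "bump r :: 'a \<Rightarrow> complex"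
  have i: "integrable lborel (\<lambda>z. cis (k \<bullet> z) * ?b z)"
    using assms by (intro integrable_cis_mult nice_integrable test_function_nice test_function_bump) simp
  have ir: "integrable lborel (\<lambda>z. Re (cis (k \<bullet> z) * ?b z))" using integrable_Re[OF i] .
  have re: "Re (cis (k \<bullet> z) * ?b z) = cos (k \<bullet> z) * flat 0 (r\<^sup>2 - z \<bullet> z)" for z
    by (simp add: bump_def)
  have pos: "0 < Re (cis (k \<bullet> z) * ?b z)" if "z \<in> ball 0 r" for z
  proof -
    have nz: "norm z < r" using that by simp
    have "\<bar>k \<bullet> z\<bar> \<le> norm k * norm z" by (rule Cauchy_Schwarz_ineq2)
    also have "\<dots> \<le> norm k * r" using nz by (intro mult_left_mono) auto
    also have "\<dots> < pi / 2" using assms(2) pi_ge_two by simp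
    finally have "cos (k \<bullet> z) > 0" by (intro cos_gt_zero_pi) (auto simp: abs_less_iff)
    moreover have "z \<bullet> z < r\<^sup>2" using power_strict_mono[OF nz, of 2] by (simp add: power2_norm_eq_inner)
    ultimately show ?thesis unfolding re by (simp add: flat_def)
  qed
  have nonneg: "0 \<le> Re (cis (k \<bullet> z) * ?b z)" for z
    using pos[of z] bump_eq_0[of r z] assms by (cases "norm z < r") auto
  have "(\<integral>z. Re (cis (k \<bullet> z) * ?b z) \<partial>lborel) \<noteq> 0"
  proof
    assume "(\<integral>z. Re (cis (k \<bullet> z) * ?b z) \<partial>lborel) = 0"
    then have "AE z in lborel. Re (cis (k \<bullet> z) * ?b z) = 0"
      using integral_nonneg_eq_0_iff_AE[OF ir] nonneg by auto
    then have "AE z in lborel. z \<notin> ball (0::'a) r" by eventually_elim (use pos in force)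
    then have "emeasure lborel (ball (0::'a) r) = 0"
      by (subst (asm) AE_iff_measurable[of "ball 0 r"]) auto
    then show False using content_ball_pos[OF assms(1), of "0::'a"] by (simp add: measure_def)
  qed
  then have "Re (fourier ?b k) \<noteq> 0" unfolding fourier_def using integral_Re[OF i] by simp
  then show ?thesis by auto
qed

text \<open>The step is an antiderivative of a bump. Differences of its shifts and rescalings are test
  functions whose derivatives are differences of two bumps.\<close>

lemma smooth_step_exists:
  "\<exists>B :: real \<Rightarrow> complex. (\<forall>x. (B has_vector_derivative bump 1 x) (at x)) \<and> (\<forall>k. times_cont_diff k B) \<and>
     (\<forall>x\<le>-1. B x = 0) \<and> (\<forall>x\<ge>1. B x = B 1)"
proof -
  have tb: "test_function (bump 1 :: real \<Rightarrow> complex)" by (rule test_function_bump) simp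
  obtain F where F: "\<And>x. (F has_vector_derivative (bump 1 x :: complex)) (at x)"
    using antiderivative_exists[OF test_functionD(3)[OF tb]] by blast
  define B where "B x = F x - F (-1)" for x
  have B: "(B has_vector_derivative bump 1 x) (at x)" for x
    unfolding B_def using has_vector_derivative_diff[OF F has_vector_derivative_const] by simp
  have z: "bump 1 x = (0::complex)" if "x \<le> -1 \<or> x \<ge> 1" for x :: real
    by (rule bump_eq_0) (use that in auto)
  have "times_cont_diff k B" for k
  proof (cases k)
    case 0
    then show ?thesis using B by (auto simp: continuous_on_eq_continuous_at intro: has_vector_derivative_continuous)
  next
    case (Suc j)
    show ?thesis unfolding Suc
    proof (rule times_cont_diff_SucI[where D="\<lambda>e x. e *\<^sub>R bump 1 x"])
      show "(B has_derivative (\<lambda>e. e *\<^sub>R bump 1 x)) (at x)" for x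
        using B by (simp add: has_vector_derivative_def)
      show "times_cont_diff j (\<lambda>x. e *\<^sub>R (bump 1 x :: complex))" for e :: real
        by (intro times_cont_diff_scaleR times_cont_diff_const times_cont_diff_bump)
    qed
  qed
  moreover have "B x = 0" if "x \<le> -1" for x
    using constant_of_zero_derivative[OF B _ that] z that by (simp add: B_def)
  moreover have "B x = B 1" if "x \<ge> 1" for x
    using constant_of_zero_derivative[OF B _ that] z that by simp
  ultimately show ?thesis using B by blast
qed

text \<open>The test function with derivative \<open>bump ((s - a) / \<epsilon>) / \<epsilon> - bump ((s -
  b) / \<epsilon>) / \<epsilon>\<close> shows that the averages of \<open>D\<close> around
  \<open>a\<close> and around \<open>b\<close> coincide.\<close>

lemma constant_of_weak_zero_derivative:
  fixes D :: "real \<Rightarrow> complex"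
  assumes c: "continuous_on UNIV D"
    and weak: "\<And>\<theta>. test_function \<theta> \<Longrightarrow> (\<integral>s. dir_deriv 1 \<theta> s * D s \<partial>lborel) = 0"
  shows "D a = D b"
proof -
  obtain B :: "real \<Rightarrow> complex" where B: "\<And>x. (B has_vector_derivative bump 1 x) (at x)"
    and Bs: "\<And>k. times_cont_diff k B" and B0: "\<And>x. x \<le> -1 \<Longrightarrow> B x = 0" and B1: "\<And>x. x \<ge> 1 \<Longrightarrow> B x = B 1"
    using smooth_step_exists by blast
  let ?\<beta> = "bump 1 :: real \<Rightarrow> complex"
  have tb: "test_function ?\<beta>" by (rule test_function_bump) simp
  have [measurable]: "D \<in> borel_measurable borel" "?\<beta> \<in> borel_measurable borel"
    using c test_function_nice[OF tb] by (auto intro: borel_measurable_continuous_onI simp: nice_def)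
  define P where "P t \<epsilon> = (\<integral>r. ?\<beta> r * D (t + \<epsilon> * r) \<partial>lborel)" for t \<epsilon>
  have eq: "P a \<epsilon> = P b \<epsilon>" if e: "\<epsilon> > 0" for \<epsilon>
  proof -
    define \<theta> where "\<theta> s = B ((1/\<epsilon>) *\<^sub>R s + (- a/\<epsilon>)) - B ((1/\<epsilon>) *\<^sub>R s + (- b/\<epsilon>))" for s
    have \<theta>t: "test_function \<theta>"
    proof (rule test_functionI)
      fix k
      have s: "times_cont_diff k (\<lambda>s. B ((1/\<epsilon>) *\<^sub>R s + c))" for c
        by (rule times_cont_diff_affine_compose[OF bounded_linear_scaleR_right Bs])
      have "times_cont_diff k (\<lambda>s. B ((1/\<epsilon>) *\<^sub>R s + (- a/\<epsilon>)) + (-1) * B ((1/\<epsilon>) *\<^sub>R s + (- b/\<epsilon>)))"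
        by (intro times_cont_diff_add times_cont_diff_mult times_cont_diff_const s)
      then show "times_cont_diff k \<theta>" by (simp add: \<theta>_def[abs_def])
      show "compact {min a b - \<epsilon>..max a b + \<epsilon>}" by simp
      fix s assume s: "s \<notin> {min a b - \<epsilon>..max a b + \<epsilon>}"
      have v: "(1/\<epsilon>) *\<^sub>R s + (- t/\<epsilon>) = (s - t)/\<epsilon>" for t by (simp add: diff_divide_distrib)
      consider "s - a \<le> - \<epsilon>" "s - b \<le> - \<epsilon>" | "s - a \<ge> \<epsilon>" "s - b \<ge> \<epsilon>" using s by fastforce
      then show "\<theta> s = 0"
      proof cases
        case 1
        then have "(s - a)/\<epsilon> \<le> -1" "(s - b)/\<epsilon> \<le> -1" using e by (auto simp: pos_divide_le_eq)
        then show ?thesis unfolding \<theta>_def v by (simp add: B0)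
      next
        case 2
        then have "(s - a)/\<epsilon> \<ge> 1" "(s - b)/\<epsilon> \<ge> 1" using e by (auto simp: pos_le_divide_eq)
        then show ?thesis unfolding \<theta>_def v using B1[of "(s - a)/\<epsilon>"] B1[of "(s - b)/\<epsilon>"] by simp
      qed
    qed
    have d: "dir_deriv 1 \<theta> s = (1/\<epsilon>) *\<^sub>R ?\<beta> ((s - a)/\<epsilon>) - (1/\<epsilon>) *\<^sub>R ?\<beta> ((s - b)/\<epsilon>)" for s
    proof -
      have g: "((\<lambda>s. B ((1/\<epsilon>) *\<^sub>R s + (- t/\<epsilon>))) has_vector_derivative (1/\<epsilon>) *\<^sub>R ?\<beta> ((s - t)/\<epsilon>)) (at s)" for t
      proof -
        have 1: "((\<lambda>s. (1/\<epsilon>) *\<^sub>R s + (- t/\<epsilon>)) has_vector_derivative (1/\<epsilon>)) (at s)"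
          using e by (auto intro!: derivative_eq_intros simp: has_vector_derivative_def)
        show ?thesis
          using vector_diff_chain_at[OF 1 B] by (simp add: comp_def diff_divide_distrib)
      qed
      have "(\<theta> has_vector_derivative (1/\<epsilon>) *\<^sub>R ?\<beta> ((s - a)/\<epsilon>) - (1/\<epsilon>) *\<^sub>R ?\<beta> ((s - b)/\<epsilon>)) (at s)"
        unfolding \<theta>_def by (rule has_vector_derivative_diff[OF g g])
      from dir_deriv_real[OF this, of 1] show ?thesis by simp
    qed
    have I: "integrable lborel (\<lambda>r. ?\<beta> r * D (t + \<epsilon> * r))" for t
    proof -
      have "continuous_on UNIV (\<lambda>r. t + \<epsilon> * r)" by (intro continuous_intros)
      then have "continuous_on UNIV (\<lambda>r. ?\<beta> r * D (t + \<epsilon> * r))"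
        using test_functionD(3)[OF tb] continuous_on_compose2[OF c, of UNIV "\<lambda>r. t + \<epsilon> * r"]
        by (auto intro!: continuous_intros)
      then have "nice (\<lambda>r. ?\<beta> r * D (t + \<epsilon> * r))"
        by (rule nice_continuous_compact[where K="cball 0 1"]) (auto simp: bump_eq_0)
      then show ?thesis by (rule nice_integrable)
    qed
    have aff: "(\<integral>s. (1/\<epsilon>) *\<^sub>R ?\<beta> ((s - t)/\<epsilon>) * D s \<partial>lborel) = P t \<epsilon>"
        "integrable lborel (\<lambda>s. (1/\<epsilon>) *\<^sub>R ?\<beta> ((s - t)/\<epsilon>) * D s)" for t
    proof -
      let ?f = "\<lambda>s. (1/\<epsilon>) *\<^sub>R ?\<beta> ((s - t)/\<epsilon>) * D s"
      have f: "?f (t + \<epsilon> * r) = (1/\<epsilon>) *\<^sub>R (?\<beta> r * D (t + \<epsilon> * r))" for r using e by simp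
      show "(\<integral>s. ?f s \<partial>lborel) = P t \<epsilon>"
        using e by (subst lborel_integral_real_affine[of \<epsilon> _ t]) (simp_all add: P_def)
      show "integrable lborel ?f"
        using e I[of t] lborel_integrable_real_affine_iff[of \<epsilon> ?f t] unfolding f by simp
    qed
    have "0 = (\<integral>s. dir_deriv 1 \<theta> s * D s \<partial>lborel)" using weak[OF \<theta>t] by simp
    also have "\<dots> = P a \<epsilon> - P b \<epsilon>"
      unfolding d left_diff_distrib by (simp only: Bochner_Integration.integral_diff[OF aff(2) aff(2)] aff(1))
    finally show ?thesis by simp
  qed
  have lim: "(\<lambda>n. P t (inverse (real (Suc n)))) \<longlonglongrightarrow> (\<integral>r. ?\<beta> r \<partial>lborel) * D t" for t
  proof -
    have "compact (D ` cball t 1)" by (intro compact_continuous_image continuous_on_subset[OF c]) auto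
    then obtain M where M: "\<And>x. x \<in> cball t 1 \<Longrightarrow> cmod (D x) \<le> M"
      by (force dest!: compact_imp_bounded simp: bounded_iff)
    have "(\<lambda>n. P t (inverse (real (Suc n)))) \<longlonglongrightarrow> (\<integral>r. ?\<beta> r * D t \<partial>lborel)"
      unfolding P_def
    proof (rule integral_dominated_convergence)
      show "integrable lborel (\<lambda>r. cmod (?\<beta> r) * M)"
        using nice_abs_integrable[OF test_function_nice[OF tb]] by simp
      show "AE r in lborel. (\<lambda>n. ?\<beta> r * D (t + inverse (real (Suc n)) * r)) \<longlonglongrightarrow> ?\<beta> r * D t"
      proof (intro AE_I2 tendsto_intros)
        fix r
        have "(\<lambda>n. t + inverse (real (Suc n)) * r) \<longlonglongrightarrow> t + 0 * r"
          by (intro tendsto_intros LIMSEQ_inverse_real_of_nat)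
        then show "(\<lambda>n. D (t + inverse (real (Suc n)) * r)) \<longlonglongrightarrow> D t"
          using c by (intro isCont_tendsto_compose[of t D]) (auto simp: continuous_on_eq_continuous_at)
      qed
      show "AE r in lborel. norm (?\<beta> r * D (t + inverse (real (Suc n)) * r)) \<le> cmod (?\<beta> r) * M" for n
      proof (intro AE_I2)
        fix r
        show "norm (?\<beta> r * D (t + inverse (real (Suc n)) * r)) \<le> cmod (?\<beta> r) * M"
        proof (cases "\<bar>r\<bar> < 1")
          case True
          have "\<bar>inverse (real (Suc n)) * r\<bar> \<le> 1"
            using True mult_mono[of "inverse (real (Suc n))" 1 "\<bar>r\<bar>" 1] by (simp add: abs_mult inverse_le_1_iff)
          then have "cmod (D (t + inverse (real (Suc n)) * r)) \<le> M" by (intro M) (simp add: dist_norm)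
          then show ?thesis by (simp add: norm_mult mult_left_mono)
        next
          case False
          then show ?thesis using bump_eq_0[of 1 r] by simp
        qed
      qed
    qed measurable
    then show ?thesis by simp
  qed
  have "(\<integral>r. ?\<beta> r \<partial>lborel) * D a = (\<integral>r. ?\<beta> r \<partial>lborel) * D b"
    using LIMSEQ_unique[OF lim[of a]] lim[of b] eq by simp
  moreover have "(\<integral>r. ?\<beta> r \<partial>lborel) \<noteq> 0"
    using fourier_bump_neq_0[of 1 "0::real"] by (simp add: fourier_def)
  ultimately show ?thesis by simp
qed

text \<open>Adding an antiderivative of \<open>b\<close> to \<open>a\<close> reduces the claim to a
  vanishing weak derivative.\<close>

lemma du_Bois_Reymond:
  fixes a b :: "real \<Rightarrow> complex"
  assumes a: "continuous_on UNIV a" and b: "continuous_on UNIV b"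
    and weak: "\<And>\<theta>. test_function \<theta> \<Longrightarrow> (\<integral>s. dir_deriv 1 \<theta> s * a s \<partial>lborel) = (\<integral>s. \<theta> s * b s \<partial>lborel)"
  shows "(a has_vector_derivative - b t) (at t)"
proof -
  obtain I where I: "\<And>x. (I has_vector_derivative b x) (at x)" using antiderivative_exists[OF b] by blast
  have Ic: "continuous_on UNIV I"
    using I by (auto simp: continuous_on_eq_continuous_at intro: has_vector_derivative_continuous)
  have "a x + I x = a 0 + I 0" for x
  proof (rule constant_of_weak_zero_derivative)
    show "continuous_on UNIV (\<lambda>x. a x + I x)" by (intro continuous_intros a Ic)
    fix \<theta> :: "real \<Rightarrow> complex" assume \<theta>: "test_function \<theta>"
    note tf = test_functionD[OF \<theta>] and tf' = test_function_dir_deriv[OF \<theta>]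
    have K: "compact (closure {z. \<theta> z \<noteq> 0})" using \<theta> by (simp add: test_function_def)
    have i: "integrable lborel (\<lambda>s. \<phi> s * h s)" if "test_function \<phi>" "continuous_on UNIV h" for \<phi> h :: "real \<Rightarrow> complex"
    proof -
      have "nice (\<lambda>s. \<phi> s * h s)"
      proof (rule nice_continuous_compact)
        show "continuous_on UNIV (\<lambda>s. \<phi> s * h s)" by (intro continuous_intros that test_functionD(3)[OF that(1)])
        show "compact (closure {z. \<phi> z \<noteq> 0})" using that by (simp add: test_function_def)
        show "\<phi> s * h s = 0" if "s \<notin> closure {z. \<phi> z \<noteq> 0}" for s using zero_outside_support[OF that] by simp
      qed
      then show ?thesis by (rule nice_integrable)
    qed
    have "\<And>x. (\<theta> has_derivative (\<lambda>e. dir_deriv e \<theta> x)) (at x)" using has_derivative_dir_deriv tf(2) by blast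
    then have \<theta>v: "(\<theta> has_vector_derivative dir_deriv 1 \<theta> x) (at x)" for x
      by (metis (no_types, lifting) dir_deriv_def tf(2) vector_derivative_works frechet_derivative_works has_vector_derivative_def dir_deriv_real scaleR_one)
    have prod: "((\<lambda>x. \<theta> x * I x) has_vector_derivative (\<theta> x * b x + dir_deriv 1 \<theta> x * I x)) (at x)" for x
      by (rule has_vector_derivative_mult[OF \<theta>v I])
    then have dd: "dir_deriv 1 (\<lambda>x. \<theta> x * I x) = (\<lambda>x. \<theta> x * b x + dir_deriv 1 \<theta> x * I x)"
      using dir_deriv_real[OF prod, of 1] by (simp add: fun_eq_iff)
    have "(\<integral>x. dir_deriv 1 (\<lambda>x. \<theta> x * I x) x \<partial>lborel) = 0"
    proof (rule integral_dir_deriv_eq_0[OF _ _ K])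
      show "(\<lambda>x. \<theta> x * I x) differentiable (at x)" for x
        using prod[of x] by (rule differentiableI_vector)
      show "continuous_on UNIV (dir_deriv 1 (\<lambda>x. \<theta> x * I x))"
        unfolding dd by (intro continuous_intros tf(3) b Ic test_functionD(3)[OF tf'])
      show "\<theta> z * I z = 0" if "z \<notin> closure {z. \<theta> z \<noteq> 0}" for z using zero_outside_support[OF that] by simp
    qed
    then have "(\<integral>x. \<theta> x * b x \<partial>lborel) + (\<integral>x. dir_deriv 1 \<theta> x * I x \<partial>lborel) = 0"
      unfolding dd using i[OF \<theta> b] i[OF tf' Ic, of 1] by simp
    then show "(\<integral>s. dir_deriv 1 \<theta> s * (a s + I s) \<partial>lborel) = 0"
      unfolding distrib_left using i[OF tf' Ic, of 1] i[OF tf' a, of 1] weak[OF \<theta>] by (simp add: add.commute)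
  qed
  then have "a = (\<lambda>x. (a 0 + I 0) - I x)" by (auto simp: fun_eq_iff algebra_simps)
  moreover have "((\<lambda>x. (a 0 + I 0) - I x) has_vector_derivative (0 - b t)) (at t)"
    by (rule has_vector_derivative_diff[OF has_vector_derivative_const I])
  ultimately show ?thesis by simp
qed

text \<open>Each integration from \<open>0\<close> gains a factor \<open>s / (j + 1)\<close> at the cost
  of passing to the next function in the sequence.\<close>

lemma iterated_derivative_bound:
  fixes \<alpha> \<alpha>' :: "nat \<Rightarrow> real \<Rightarrow> complex"
  assumes d: "\<And>m s. (\<alpha> m has_vector_derivative \<alpha>' m s) (at s)"
    and le: "\<And>m s. cmod (\<alpha>' m s) \<le> cmod (\<alpha> (Suc m) s)"
    and z: "\<And>m. \<alpha> m 0 = 0"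
    and bd: "\<And>m s. 0 \<le> s \<Longrightarrow> s \<le> T \<Longrightarrow> cmod (\<alpha> m s) \<le> K * C ^ m"
    and s: "0 \<le> s" "s \<le> T"
  shows "cmod (\<alpha> m s) \<le> K * C ^ (m + j) * s ^ j / fact j"
  using s
proof (induction j arbitrary: m s)
  case 0 then show ?case using bd by simp
next
  case (Suc j)
  show ?case
  proof (cases "s = 0")
    case False
    let ?\<phi> = "\<lambda>x. (K * C ^ (m + Suc j) / fact (Suc j)) * x ^ Suc j"
    have c: "continuous_on UNIV (\<alpha> m)"
      using d by (auto simp: continuous_on_eq_continuous_at intro: has_vector_derivative_continuous)
    have "norm (\<alpha> m s - \<alpha> m 0) \<le> ?\<phi> s - ?\<phi> 0"
    proof (rule differentiable_bound_general[where f'="\<alpha>' m" and \<phi>'="\<lambda>x. K * C ^ (Suc m + j) * x ^ j / fact j"])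
      show "0 < s" using False Suc.prems by simp
      show "continuous_on {0..s} (\<alpha> m)" using c continuous_on_subset by blast
      show "continuous_on {0..s} ?\<phi>" by (intro continuous_intros) auto
      fix x assume x: "0 < x" "x < s"
      show "(\<alpha> m has_vector_derivative \<alpha>' m x) (at x)" by (rule d)
      have pow: "((\<lambda>x. x ^ Suc j) has_real_derivative real (Suc j) * x ^ j) (at x)"
        using DERIV_pow[of "Suc j" x] by simp
      have "(?\<phi> has_real_derivative (K * C ^ (m + Suc j) / fact (Suc j)) * (real (Suc j) * x ^ j)) (at x)"
        by (rule DERIV_cmult[OF pow])
      moreover have "(K * C ^ (m + Suc j) / fact (Suc j)) * (real (Suc j) * x ^ j) = K * C ^ (Suc m + j) * x ^ j / fact j"
        by (simp add: fact_Suc divide_simps del: of_nat_Suc)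
      ultimately show "(?\<phi> has_vector_derivative K * C ^ (Suc m + j) * x ^ j / fact j) (at x)"
        by (simp only: has_real_derivative_iff_has_vector_derivative)
      show "norm (\<alpha>' m x) \<le> K * C ^ (Suc m + j) * x ^ j / fact j"
        using le[of m x] Suc.IH[of x "Suc m"] x Suc.prems by simp
    qed
    then show ?thesis by (simp add: z)
  qed (simp add: z)
qed

text \<open>Taylor's formula at \<open>0\<close> for the function \<open>\<alpha> 0\<close>, all of whose
  derivatives vanish there and grow at most geometrically.\<close>

lemma iterated_derivative_zero:
  fixes \<alpha> :: "nat \<Rightarrow> real \<Rightarrow> complex"
  assumes d: "\<And>m s. (\<alpha> m has_vector_derivative - \<alpha> (Suc m) s) (at s)"
    and z: "\<And>m. \<alpha> m 0 = 0"
    and bd: "\<And>m s. \<bar>s\<bar> \<le> T \<Longrightarrow> cmod (\<alpha> m s) \<le> K * C ^ m"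
    and t: "\<bar>t\<bar> \<le> T"
  shows "\<alpha> 0 t = 0"
proof -
  have b: "cmod (\<alpha> 0 t) \<le> K * (C * \<bar>t\<bar>) ^ j / fact j" for j
  proof (cases "t \<ge> 0")
    case True
    have "cmod (\<alpha> 0 t) \<le> K * C ^ (0 + j) * t ^ j / fact j"
      by (rule iterated_derivative_bound[OF d _ z]) (use bd t True in auto)
    then show ?thesis using True by (simp add: power_mult_distrib mult.assoc)
  next
    case False
    have d': "((\<lambda>s. \<alpha> m (- s)) has_vector_derivative \<alpha> (Suc m) (- s)) (at s)" for m s
      using vector_diff_chain_at[OF has_vector_derivative_minus[OF has_vector_derivative_id] d, of m s]
      by (simp add: comp_def)
    have "cmod (\<alpha> 0 (- (- t))) \<le> K * C ^ (0 + j) * (- t) ^ j / fact j"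
      by (rule iterated_derivative_bound[OF d', where T=T]) (use bd t False z in auto)
    moreover have "C * \<bar>t\<bar> = C * (- t)" using False by simp
    ultimately show ?thesis by (simp only: power_mult_distrib mult.assoc add_0 minus_minus)
  qed
  have "(\<lambda>j. inverse (fact j) * (C * \<bar>t\<bar>) ^ j) \<longlonglongrightarrow> 0"
    by (rule summable_LIMSEQ_zero[OF summable_exp])
  then have "(\<lambda>j. K * (inverse (fact j) * (C * \<bar>t\<bar>) ^ j)) \<longlonglongrightarrow> K * 0" by (intro tendsto_intros)
  then have "cmod (\<alpha> 0 t) \<le> K * 0"
    by (rule LIMSEQ_le_const) (use b in \<open>auto simp: field_simps\<close>)
  then show ?thesis by simp
qed

section \<open>Product test functions\<close>

lemma test_function_tensor:
  fixes \<theta> :: "real \<Rightarrow> complex" and \<phi> :: "'a::euclidean_space \<Rightarrow> complex"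
  assumes "test_function \<theta>" "test_function \<phi>"
  shows "test_function (\<lambda>p. \<theta> (fst p) * \<phi> (snd p))"
proof (rule test_functionI)
  fix k
  have "times_cont_diff k (\<lambda>p :: real \<times> 'a. \<theta> (fst p + 0))"
    by (rule times_cont_diff_affine_compose[OF bounded_linear_fst test_functionD(1)[OF assms(1)]])
  moreover have "times_cont_diff k (\<lambda>p :: real \<times> 'a. \<phi> (snd p + 0))"
    by (rule times_cont_diff_affine_compose[OF bounded_linear_snd test_functionD(1)[OF assms(2)]])
  ultimately show "times_cont_diff k (\<lambda>p. \<theta> (fst p) * \<phi> (snd p))"
    using times_cont_diff_mult by simp
  show "compact (closure {z. \<theta> z \<noteq> 0} \<times> closure {z. \<phi> z \<noteq> 0})"
    using assms by (auto simp: test_function_def intro: compact_Times)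
  show "\<theta> (fst p) * \<phi> (snd p) = 0" if "p \<notin> closure {z. \<theta> z \<noteq> 0} \<times> closure {z. \<phi> z \<noteq> 0}" for p
    using that zero_outside_support[of "fst p" \<theta>] zero_outside_support[of "snd p" \<phi>] by (cases p) auto
qed

lemma dir_deriv_tensor:
  fixes \<theta> :: "real \<Rightarrow> complex" and \<phi> :: "'a::euclidean_space \<Rightarrow> complex"
  assumes "test_function \<theta>" "test_function \<phi>"
  shows "dir_deriv (a, e) (\<lambda>p. \<theta> (fst p) * \<phi> (snd p)) p
    = \<theta> (fst p) * dir_deriv e \<phi> (snd p) + dir_deriv a \<theta> (fst p) * \<phi> (snd p)"
proof -
  have 1: "((\<lambda>p :: real \<times> 'a. \<theta> (fst p + 0)) has_derivative (\<lambda>h. dir_deriv (fst h) \<theta> (fst p + 0))) (at p)"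
    by (rule has_derivative_affine_compose[OF test_functionD(2)[OF assms(1)] bounded_linear_fst])
  have 2: "((\<lambda>p :: real \<times> 'a. \<phi> (snd p + 0)) has_derivative (\<lambda>h. dir_deriv (snd h) \<phi> (snd p + 0))) (at p)"
    by (rule has_derivative_affine_compose[OF test_functionD(2)[OF assms(2)] bounded_linear_snd])
  show ?thesis
    using dir_deriv_eq[OF has_derivative_mult[OF 1 2], of "(a, e)"] by simp
qed

lemma dir_deriv_zero_direction:
  assumes "test_function f" shows "dir_deriv 0 f z = 0"
  by (rule linear_0[OF has_derivative_linear[OF has_derivative_dir_deriv[OF test_functionD(2)[OF assms]]]])

lemma dir_deriv_tensor_space:
  fixes \<theta> :: "real \<Rightarrow> complex" and \<phi> :: "'a::euclidean_space \<Rightarrow> complex"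
  assumes "test_function \<theta>" "test_function \<phi>"
  shows "dir_deriv (0, e) (\<lambda>p. \<theta> (fst p) * \<phi> (snd p)) = (\<lambda>p. \<theta> (fst p) * dir_deriv e \<phi> (snd p))"
  using assms by (simp add: fun_eq_iff dir_deriv_tensor dir_deriv_zero_direction)

lemma dir_deriv_tensor_time:
  fixes \<theta> :: "real \<Rightarrow> complex" and \<phi> :: "'a::euclidean_space \<Rightarrow> complex"
  assumes "test_function \<theta>" "test_function \<phi>"
  shows "dir_deriv (1, 0) (\<lambda>p. \<theta> (fst p) * \<phi> (snd p)) = (\<lambda>p. dir_deriv 1 \<theta> (fst p) * \<phi> (snd p))"
  using assms by (simp add: fun_eq_iff dir_deriv_tensor dir_deriv_zero_direction)

text \<open>The part of the operator without \<open>t\<close>. Against a product test function the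
  equation becomes a relation between this part and \<open>\<partial>\<^sub>s\<close>.\<close>

definition spatial_op ::
  "(real \<times> (real^'d) \<times> (real^'n) \<Rightarrow> complex) \<Rightarrow> real \<times> (real^'d) \<times> (real^'n) \<Rightarrow> complex" where
  "spatial_op \<phi> z = (\<Sum>i\<in>UNIV. dir_deriv (0, axis i 1, 0) (dir_deriv (0, axis i 1, 0) \<phi>) z)
     - (\<Sum>j\<in>UNIV. dir_deriv (0, 0, axis j 1) (dir_deriv (0, 0, axis j 1) \<phi>) z)"

lemma ultrahyperbolic_op_tensor:
  fixes \<theta> :: "real \<Rightarrow> complex" and \<phi> :: "real \<times> (real^'d) \<times> (real^'n) \<Rightarrow> complex"
  assumes \<theta>: "test_function \<theta>" and \<phi>: "test_function \<phi>"
  shows "ultrahyperbolic_op (\<lambda>p. \<theta> (fst p) * \<phi> (snd p)) (t, z)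
    = dir_deriv 1 \<theta> t * dir_deriv (1, 0, 0) \<phi> z + \<theta> t * spatial_op \<phi> z"
proof -
  note d = test_function_dir_deriv[OF \<phi>]
  have z: "((1::real), (0::real), (0::real^'d), (0::real^'n)) = (1, 0)" by (simp add: zero_prod_def)
  show ?thesis
    unfolding ultrahyperbolic_op_def spatial_op_def z
    by (simp only: dir_deriv_tensor_space[OF \<theta> \<phi>] dir_deriv_tensor_space[OF \<theta> d] dir_deriv_tensor_time[OF \<theta> d] fst_conv snd_conv
        sum_distrib_left right_diff_distrib add_diff_eq)
qed

lemma nice_spatial_op: "test_function \<phi> \<Longrightarrow> nice (spatial_op \<phi>)"
  unfolding spatial_op_def[abs_def]
  by (intro nice_diff nice_sum nice_dir_deriv2)

lemma fourier_spatial_op: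
  fixes \<phi> :: "real \<times> (real^'d) \<times> (real^'n) \<Rightarrow> complex"
  assumes "test_function \<phi>"
  shows "fourier (spatial_op \<phi>) (\<sigma>, \<xi>, \<eta>) = complex_of_real (\<eta> \<bullet> \<eta> - \<xi> \<bullet> \<xi>) * fourier \<phi> (\<sigma>, \<xi>, \<eta>)"
proof -
  note n = nice_dir_deriv2[OF assms]
  have 1: "\<xi> \<bullet> \<xi> = (\<Sum>i\<in>UNIV. \<xi> $ i * \<xi> $ i)" "\<eta> \<bullet> \<eta> = (\<Sum>i\<in>UNIV. \<eta> $ i * \<eta> $ i)"
    by (simp_all add: inner_vec_def)
  show ?thesis
    unfolding spatial_op_def[abs_def] 1
    by (simp add: fourier_diff fourier_sum n nice_sum fourier_dir_deriv2[OF assms]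
        inner_prod_def inner_axis sum_distrib_left sum_negf algebra_simps)
qed

lemma test_function_translate:
  assumes "test_function \<phi>" shows "test_function (\<lambda>z. \<phi> (z + c))"
proof (rule test_functionI)
  show "times_cont_diff k (\<lambda>z. \<phi> (z + c))" for k
    by (rule times_cont_diff_affine_compose[OF bounded_linear_ident test_functionD(1)[OF assms]])
  show "compact ((\<lambda>z. z - c) ` closure {z. \<phi> z \<noteq> 0})"
    using assms by (intro compact_continuous_image continuous_intros) (simp add: test_function_def)
  show "\<phi> (z + c) = 0" if "z \<notin> (\<lambda>z. z - c) ` closure {z. \<phi> z \<noteq> 0}" for z
  proof (rule zero_outside_support[of _ \<phi>])
    show "z + c \<notin> closure {z. \<phi> z \<noteq> 0}" using that by (metis add_diff_cancel_right' imageI)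
  qed
qed

lemma fourier_translate:
  assumes [measurable]: "u \<in> borel_measurable borel"
  shows "fourier (\<lambda>z. u (z + c)) k = cis (- (k \<bullet> c)) * fourier u k"
proof -
  have "fourier (\<lambda>z. u (z + c)) k = (\<integral>z. cis (k \<bullet> ((z + c) - c)) * u (z + c) \<partial>lborel)"
    by (simp add: fourier_def)
  also have "\<dots> = (\<integral>z. cis (k \<bullet> (z - c)) * u z \<partial>lborel)"
    by (rule integral_translate[of "\<lambda>z. cis (k \<bullet> (z - c)) * u z"]) measurable
  also have "\<dots> = (\<integral>z. cis (- (k \<bullet> c)) * (cis (k \<bullet> z) * u z) \<partial>lborel)"
    by (simp add: mult.assoc[symmetric] cis_mult inner_diff_right)
  finally show ?thesis unfolding fourier_def by simp
qed

section \<open>Continuous curves of square-integrable functions\<close>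

text \<open>Squared norms of Borel functions keep roots and the completion of the measure out of the
  estimates.\<close>

definition L2_curve :: "(real \<Rightarrow> 'a::euclidean_space \<Rightarrow> complex) \<Rightarrow> bool" where
  "L2_curve u \<longleftrightarrow> (\<forall>t. L2 (u t)) \<and> (\<forall>t0. ((\<lambda>t. sq_norm (\<lambda>z. u t z - u t0 z)) \<longlongrightarrow> 0) (at t0))"

lemma L2_curveD:
  assumes "L2_curve u"
  shows "L2 (u t)" "((\<lambda>t. sq_norm (\<lambda>z. u t z - u t0 z)) \<longlongrightarrow> 0) (at t0)"
  using assms by (auto simp: L2_curve_def)

text \<open>Otherwise the parameters at which the norm exceeds \<open>n\<close> would accumulate at a
  point of discontinuity.\<close>

lemma L2_curve_bounded:
  assumes "L2_curve u" shows "\<exists>M\<ge>0. \<forall>t. \<bar>t\<bar> \<le> R \<longrightarrow> sq_norm (u t) \<le> M"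
proof (rule ccontr)
  assume "\<not> ?thesis"
  then have "\<exists>t. \<bar>t\<bar> \<le> R \<and> sq_norm (u t) > real n" for n
    by (metis not_le of_nat_0_le_iff)
  then obtain f where f: "\<And>n. f n \<in> {- R..R}" "\<And>n. sq_norm (u (f n)) > real n"
    by (metis abs_le_iff atLeastAtMost_iff minus_le_iff)
  obtain l r where r: "strict_mono r" "(f \<circ> r) \<longlonglongrightarrow> l"
    using compact_Icc[of "- R" R] f(1) unfolding compact_def by metis
  let ?d = "\<lambda>t. sq_norm (\<lambda>z. u t z - u l z)"
  have "isCont ?d l"
    using L2_curveD(2)[OF assms, of l] by (simp add: isCont_def sq_norm_def)
  then have "(\<lambda>n. ?d ((f \<circ> r) n)) \<longlonglongrightarrow> ?d l" by (rule isCont_tendsto_compose[OF _ r(2)])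
  moreover have "?d l = 0" by (simp add: sq_norm_def)
  ultimately have "eventually (\<lambda>n. ?d (f (r n)) < 1) sequentially"
    by (intro order_tendstoD(2)[of _ 0]) auto
  moreover have "eventually (\<lambda>n. 2 + 2 * sq_norm (u l) \<le> real n) sequentially"
    using filterlim_real_sequentially by (simp add: filterlim_at_top)
  ultimately have "eventually (\<lambda>n. False) sequentially"
  proof eventually_elim
    case (elim n)
    have "sq_norm (\<lambda>z. (u (f (r n)) z - u l z) + u l z) \<le> 2 * ?d (f (r n)) + 2 * sq_norm (u l)"
      by (intro L2_add L2_diff L2_curveD(1)[OF assms])
    then have "sq_norm (u (f (r n))) < real n" using elim by simp
    moreover have "real n \<le> real (r n)" using seq_suble[OF r(1), of n] by simp
    ultimately show False using f(2)[of "r n"] by simp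
  qed
  then show False by simp
qed

lemma L2_curve_pairing_continuous:
  assumes "L2_curve u" "L2 p" shows "continuous_on UNIV (\<lambda>t. \<integral>z. u t z * p z \<partial>lborel)"
  unfolding continuous_on_def
  using L2_pairing_tendsto[OF L2_curveD(1)[OF assms(1)] L2_curveD(1)[OF assms(1)] assms(2) L2_curveD(2)[OF assms(1)]] by blast

text \<open>The function \<open>X\<close> is the integral of \<open>\<theta> t * u t\<close> over
  \<open>t\<close>. It is computed pointwise from the jointly measurable \<open>W\<close>; the
  Cauchy-Schwarz inequality in \<open>t\<close> makes it square integrable, because
  \<open>\<theta>\<close> has bounded support.\<close>

lemma L2_time_average:
  fixes u :: "real \<Rightarrow> 'a::euclidean_space \<Rightarrow> complex"
  assumes W: "W \<in> borel_measurable borel" and u: "L2_curve u"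
    and Wu: "AE t in lborel. AE z in lborel. W (t, z) = u t z" and \<theta>: "nice \<theta>"
  shows "\<exists>X. L2 X \<and> (\<forall>p. L2 p \<longrightarrow> (\<integral>z. X z * p z \<partial>lborel) = (\<integral>t. \<theta> t * (\<integral>z. u t z * p z \<partial>lborel) \<partial>lborel))"
proof -
  have Wm [measurable]: "W \<in> borel_measurable (borel \<Otimes>\<^sub>M borel)" using W by (simp add: borel_prod)
  have [measurable]: "\<theta> \<in> borel_measurable borel" using \<theta> by (simp add: nice_def)
  note uL2 = L2_curveD(1)[OF u]
  have [measurable]: "u t \<in> borel_measurable borel" for t using uL2[of t] by (simp add: L2_def)
  have Ws [measurable]: "(\<lambda>z. W (t, z)) \<in> borel_measurable borel" for t using measurable_slice(1)[OF W] .
  obtain B R where B: "\<And>t. cmod (\<theta> t) \<le> B" and R: "\<And>t. \<theta> t \<noteq> 0 \<Longrightarrow> \<bar>t\<bar> \<le> R"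
    using \<theta> by (auto simp: nice_def)
  obtain M where M: "M \<ge> 0" "\<And>t. \<bar>t\<bar> \<le> R \<Longrightarrow> sq_norm (u t) \<le> M" using L2_curve_bounded[OF u] by blast
  let ?I = "indicator {- R..R} :: real \<Rightarrow> real"
  have iI: "integrable lborel ?I" by (simp add: emeasure_lborel_Icc_eq)
  define V where "V t z = \<theta> t * W (t, z)" for t z
  have Vm [measurable]: "(\<lambda>(t, z). V t z) \<in> borel_measurable (borel \<Otimes>\<^sub>M borel)"
    unfolding V_def by measurable
  have V0: "V t z = ?I t * V t z" for t z
    using R[of t] by (auto simp: V_def indicator_def abs_le_iff)
  have inner: "AE t in lborel. integrable lborel (\<lambda>z. (cmod (V t z))\<^sup>2) \<and> (\<integral>z. (cmod (V t z))\<^sup>2 \<partial>lborel) = (cmod (\<theta> t))\<^sup>2 * sq_norm (u t)"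
    using Wu
  proof eventually_elim
    case (elim t)
    have ae: "AE z in lborel. (cmod (V t z))\<^sup>2 = (cmod (\<theta> t))\<^sup>2 * (cmod (u t z))\<^sup>2"
      using elim by eventually_elim (simp add: V_def norm_mult power_mult_distrib)
    have m: "(\<lambda>z. (cmod (V t z))\<^sup>2) \<in> borel_measurable lborel" unfolding V_def by measurable
    have "integrable lborel (\<lambda>z. (cmod (\<theta> t))\<^sup>2 * (cmod (u t z))\<^sup>2)" using L2_integrable_sq[OF uL2[of t]] by simp
    then have "integrable lborel (\<lambda>z. (cmod (V t z))\<^sup>2)"
      using integrable_cong_AE[OF m _ ae] by (auto dest: borel_measurable_integrable)
    moreover have "(\<integral>z. (cmod (V t z))\<^sup>2 \<partial>lborel) = (\<integral>z. (cmod (\<theta> t))\<^sup>2 * (cmod (u t z))\<^sup>2 \<partial>lborel)"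
      by (rule integral_cong_AE[OF m _ ae]) measurable
    ultimately show ?case by (simp add: sq_norm_def)
  qed
  have I1: "integrable (lborel \<Otimes>\<^sub>M lborel) (\<lambda>(t, z). (cmod (V t z))\<^sup>2)"
  proof (rule lborel_pair.Fubini_integrable)
    have "integrable lborel (\<lambda>t. \<integral>z. (cmod (V t z))\<^sup>2 \<partial>lborel)"
    proof (rule Bochner_Integration.integrable_bound)
      show "integrable lborel (\<lambda>t. (B\<^sup>2 * M) * ?I t)" using iI by simp
      show "AE t in lborel. norm (\<integral>z. (cmod (V t z))\<^sup>2 \<partial>lborel) \<le> norm ((B\<^sup>2 * M) * ?I t)"
        using inner
      proof eventually_elim
        case (elim t)
        have "(cmod (\<theta> t))\<^sup>2 * sq_norm (u t) \<le> (B\<^sup>2 * M) * ?I t"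
        proof (cases "\<theta> t = 0")
          case False
          then have "\<bar>t\<bar> \<le> R" by (rule R)
          then show ?thesis using M power_mono[OF B[of t], of 2]
            by (auto simp: indicator_def abs_le_iff intro!: mult_mono)
        qed (use M in simp)
        then show ?case using elim M by simp
      qed
      show "(\<lambda>t. \<integral>z. (cmod (V t z))\<^sup>2 \<partial>lborel) \<in> borel_measurable lborel"
        by (subst measurable_lborel2, rule lborel.borel_measurable_lebesgue_integral) measurable
    qed
    then show "integrable lborel (\<lambda>t. \<integral>z. norm (case (t, z) of (t, z) \<Rightarrow> (cmod (V t z))\<^sup>2) \<partial>lborel)" by simp
    show "AE t in lborel. integrable lborel (\<lambda>z. case (t, z) of (t, z) \<Rightarrow> (cmod (V t z))\<^sup>2)"
      using inner by eventually_elim simp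
  qed measurable
  define X where "X z = (\<integral>t. V t z \<partial>lborel)" for z
  have [measurable]: "X \<in> borel_measurable borel"
    unfolding X_def[abs_def] by (rule lborel.borel_measurable_lebesgue_integral) measurable
  let ?J = "\<lambda>t. complex_of_real (?I t)"
  have "(cmod (?J t))\<^sup>2 = ?I t" for t by (simp add: indicator_def)
  then have J: "L2 ?J" unfolding L2_def using iI by simp
  have Vs: "(\<lambda>t. V t z) \<in> borel_measurable borel" for z by measurable
  have Xle: "AE z in lborel. (cmod (X z))\<^sup>2 \<le> sq_norm ?J * (\<integral>t. (cmod (V t z))\<^sup>2 \<partial>lborel)"
    using lborel_pair.AE_integrable_snd[OF I1]
  proof eventually_elim
    case (elim z)
    then have "L2 (\<lambda>t. V t z)" using Vs by (simp add: L2_def)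
    moreover have "X z = (\<integral>t. ?J t * V t z \<partial>lborel)" unfolding X_def using V0 by metis
    ultimately show ?case using L2_Cauchy_Schwarz[OF J, of "\<lambda>t. V t z"] by (simp add: sq_norm_def)
  qed
  have XL2: "L2 X"
    unfolding L2_def
  proof (intro conjI)
    have "integrable lborel (\<lambda>z. sq_norm ?J * (\<integral>t. (cmod (V t z))\<^sup>2 \<partial>lborel))"
      using lborel_pair.integrable_snd[OF I1] by simp
    then show "integrable lborel (\<lambda>z. (cmod (X z))\<^sup>2)"
    proof (rule Bochner_Integration.integrable_bound)
      show "AE z in lborel. norm ((cmod (X z))\<^sup>2) \<le> norm (sq_norm ?J * (\<integral>t. (cmod (V t z))\<^sup>2 \<partial>lborel))"
        using Xle by eventually_elim (simp add: abs_mult)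
    qed measurable
  qed measurable
  have "(\<integral>z. X z * p z \<partial>lborel) = (\<integral>t. \<theta> t * (\<integral>z. u t z * p z \<partial>lborel) \<partial>lborel)" if p: "L2 p" for p
  proof -
    have [measurable]: "p \<in> borel_measurable borel" using p by (simp add: L2_def)
    have I2: "integrable (lborel \<Otimes>\<^sub>M lborel) (\<lambda>(t, z). ?I t * (cmod (p z))\<^sup>2)"
      by (rule lborel_pair.Fubini_integrable) (use iI L2_integrable_sq[OF p] in auto)
    \<comment> \<open>Pointwise, \<open>V * p\<close> is at most the sum of the two integrable squares.\<close>
    have I3: "integrable (lborel \<Otimes>\<^sub>M lborel) (\<lambda>(t, z). V t z * p z)"
    proof (rule Bochner_Integration.integrable_bound[OF Bochner_Integration.integrable_add[OF I1 I2]])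
      have "cmod (V t z * p z) \<le> (cmod (V t z))\<^sup>2 + ?I t * (cmod (p z))\<^sup>2" for t z
      proof (cases "?I t = 1")
        case True
        have "0 \<le> cmod (V t z) * cmod (p z)" "2 * (cmod (V t z) * cmod (p z)) \<le> (cmod (V t z))\<^sup>2 + (cmod (p z))\<^sup>2"
          using sum_squares_bound[of "cmod (V t z)" "cmod (p z)"] by (auto simp: mult.assoc)
        then have "cmod (V t z) * cmod (p z) \<le> (cmod (V t z))\<^sup>2 + (cmod (p z))\<^sup>2" by linarith
        then show ?thesis by (simp add: norm_mult True)
      next
        case False
        then have "V t z = 0" using V0[of t z] by (auto simp: indicator_def split: if_splits)
        then show ?thesis by simp
      qed
      then show "AE x in lborel \<Otimes>\<^sub>M lborel. norm (case x of (t, z) \<Rightarrow> V t z * p z)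
          \<le> norm ((case x of (t, z) \<Rightarrow> (cmod (V t z))\<^sup>2) + (case x of (t, z) \<Rightarrow> ?I t * (cmod (p z))\<^sup>2))"
        by (intro AE_I2) (auto simp: split_beta' intro: order_trans[OF _ abs_ge_self])
    qed measurable
    have "(\<integral>z. X z * p z \<partial>lborel) = (\<integral>z. (\<integral>t. V t z * p z \<partial>lborel) \<partial>lborel)"
      by (simp add: X_def)
    also have "\<dots> = (\<integral>t. (\<integral>z. V t z * p z \<partial>lborel) \<partial>lborel)"
      by (rule lborel_pair.Fubini_integral[OF I3])
    also have "\<dots> = (\<integral>t. \<theta> t * (\<integral>z. u t z * p z \<partial>lborel) \<partial>lborel)"
    proof (rule integral_cong_AE)
      show "(\<lambda>t. \<integral>z. V t z * p z \<partial>lborel) \<in> borel_measurable lborel"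
        by (subst measurable_lborel2, rule lborel.borel_measurable_lebesgue_integral) measurable
      show "(\<lambda>t. \<theta> t * (\<integral>z. u t z * p z \<partial>lborel)) \<in> borel_measurable lborel"
        using borel_measurable_continuous_onI[OF L2_curve_pairing_continuous[OF u p]] by simp
      show "AE t in lborel. (\<integral>z. V t z * p z \<partial>lborel) = \<theta> t * (\<integral>z. u t z * p z \<partial>lborel)"
        using Wu
      proof eventually_elim
        case (elim t)
        have "(\<integral>z. W (t, z) * p z \<partial>lborel) = (\<integral>z. u t z * p z \<partial>lborel)"
          by (rule integral_cong_AE) (use elim in auto)
        then show ?case by (simp add: V_def mult.assoc)
      qed
    qed
    finally show ?thesis .
  qed
  then show ?thesis using XL2 by blast
qed

section \<open>The equation on the Fourier side\<close>

lemma AE_zero_of_fourier_zero: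
  fixes G :: "'a::euclidean_space \<Rightarrow> complex"
  assumes "L2 G" "integrable lborel G" "\<And>k. fourier G k = 0"
  shows "AE z in lborel. G z = 0"
proof -
  have "L2_fourier G (\<lambda>k. 0)"
    unfolding L2_fourier_def
  proof (intro conjI allI impI assms(1))
    show "L2 (\<lambda>k::'a. 0 :: complex)" by (simp add: L2_def)
    fix u :: "'a \<Rightarrow> complex" assume u: "nice u"
    show "(\<integral>k. 0 * u k \<partial>lborel) = (\<integral>z. G z * fourier u z \<partial>lborel)"
      using fourier_multiplication[OF assms(2) nice_integrable[OF u]] by (simp add: assms(3))
  qed
  from Plancherel[OF this] have "sq_norm G = 0" by (simp add: sq_norm_def)
  then show ?thesis by (rule L2_AE_zero[OF assms(1)])
qed

text \<open>If \<open>X\<close> and \<open>Y\<close> are the averages of a solution against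
  \<open>\<theta>'\<close> and \<open>\<theta>\<close>, this is the equation on the Fourier
  side. Translating \<open>\<phi>\<close> by \<open>c\<close> multiplies its transform by a
  character, so the hypothesis for all translates says that an integrable function
  \<open>G\<close> has Fourier transform \<open>0\<close>. The factor \<open>fourier
  \<phi>\<close> of \<open>G\<close> can be cancelled on any given ball if the support of
  \<open>\<phi>\<close> is small enough.\<close>

lemma spectral_relation:
  fixes X Y :: "real \<times> (real^'d) \<times> (real^'n) \<Rightarrow> complex"
  assumes A: "L2_fourier A X" and B: "L2_fourier B Y"
    and eq: "\<And>\<phi>. test_function \<phi> \<Longrightarrow>
      (\<integral>z. X z * dir_deriv (1, 0, 0) \<phi> z \<partial>lborel) + (\<integral>z. Y z * spatial_op \<phi> z \<partial>lborel) = 0"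
  shows "AE k in lborel. A k = - \<i> * time_frequency k * B k"
proof -
  note AL = L2_fourierD[OF A] and BL = L2_fourierD[OF B]
  have "AE k in lborel. norm k < real (Suc n) \<longrightarrow> fst k \<noteq> 0 \<longrightarrow> A k = - \<i> * time_frequency k * B k" for n
  proof -
    \<comment> \<open>The support is so small that the transform has no zero in the ball of radius \<open>n + 1\<close>.\<close>
    define \<phi> where "\<phi> = (bump (inverse (real (Suc n))) :: real \<times> (real^'d) \<times> (real^'n) \<Rightarrow> complex)"
    have \<phi>: "test_function \<phi>" unfolding \<phi>_def by (rule test_function_bump) simp
    have nz: "fourier \<phi> k \<noteq> 0" if "norm k < real (Suc n)" for k
      unfolding \<phi>_def using that by (intro fourier_bump_neq_0) (auto simp: field_simps)
    let ?P = "fourier (dir_deriv (1, 0, 0) \<phi>)" and ?Q = "fourier (spatial_op \<phi>)"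
    have nP: "nice (dir_deriv (1, 0, 0) \<phi>)" and nQ: "nice (spatial_op \<phi>)"
      using nice_dir_deriv[OF \<phi>] nice_spatial_op[OF \<phi>] by auto
    define G where "G k = A k * ?P k + B k * ?Q k" for k
    have [measurable]: "dir_deriv (1, 0, 0) \<phi> \<in> borel_measurable borel" "spatial_op \<phi> \<in> borel_measurable borel"
        "A \<in> borel_measurable borel" "B \<in> borel_measurable borel"
      using nP nQ AL BL by (auto simp: nice_def L2_def)
    have iA: "integrable lborel (\<lambda>k. A k * ?P k)" and iB: "integrable lborel (\<lambda>k. B k * ?Q k)"
      using L2_mult_integrable AL(1) BL(1) Plancherel_nice(1) nP nQ by blast+
    have L2m: "L2 (\<lambda>k. F k * fourier q k)" if "L2 F" "nice q" for F q :: "real \<times> (real^'d) \<times> (real^'n) \<Rightarrow> complex"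
    proof (rule L2_dominated(1)[OF that(1)])
      show "(\<lambda>k. F k * fourier q k) \<in> borel_measurable borel" using that by (auto simp: L2_def nice_def)
      show "cmod (F k * fourier q k) \<le> (\<integral>z. cmod (q z) \<partial>lborel) * cmod (F k)" for k
        using fourier_bound[of q k] by (simp add: norm_mult mult.commute mult_left_mono)
    qed
    have "AE k in lborel. G k = 0"
    proof (rule AE_zero_of_fourier_zero)
      show "L2 G" unfolding G_def by (intro L2_add(1) L2m AL BL nP nQ)
      show "integrable lborel G" unfolding G_def using iA iB by simp
      fix c
      let ?\<phi>c = "\<lambda>z. \<phi> (z + (- c))"
      have \<phi>c: "test_function ?\<phi>c" by (rule test_function_translate[OF \<phi>])
      have ft: "fourier ?\<phi>c k = cis (k \<bullet> c) * fourier \<phi> k" for k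
        using fourier_translate[of \<phi> "- c" k] test_function_nice[OF \<phi>] by (simp add: nice_def)
      have 1: "fourier (dir_deriv (1, 0, 0) ?\<phi>c) k = cis (c \<bullet> k) * ?P k" for k
        unfolding fourier_dir_deriv[OF \<phi>] fourier_dir_deriv[OF \<phi>c] ft by (simp add: ac_simps inner_commute)
      have 2: "fourier (spatial_op ?\<phi>c) k = cis (c \<bullet> k) * ?Q k" for k
      proof -
        obtain \<sigma> \<xi> \<eta> where k: "k = (\<sigma>, \<xi>, \<eta>)" by (cases k) auto
        show ?thesis
          unfolding k fourier_spatial_op[OF \<phi>] fourier_spatial_op[OF \<phi>c] ft by (simp add: ac_simps inner_commute)
      qed
      have "fourier G c = (\<integral>k. A k * (cis (c \<bullet> k) * ?P k) + B k * (cis (c \<bullet> k) * ?Q k) \<partial>lborel)"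
        unfolding fourier_def[of G] G_def by (simp add: algebra_simps)
      also have "\<dots> = (\<integral>k. A k * (cis (c \<bullet> k) * ?P k) \<partial>lborel) + (\<integral>k. B k * (cis (c \<bullet> k) * ?Q k) \<partial>lborel)"
        using integrable_cis_mult[OF iA, of c] integrable_cis_mult[OF iB, of c]
        by (intro Bochner_Integration.integral_add) (simp_all add: mult.left_commute)
      also have "\<dots> = (\<integral>z. X z * dir_deriv (1, 0, 0) ?\<phi>c z \<partial>lborel) + (\<integral>z. Y z * spatial_op ?\<phi>c z \<partial>lborel)"
        unfolding AL(3)[OF nice_dir_deriv[OF \<phi>c]] BL(3)[OF nice_spatial_op[OF \<phi>c]] 1 2 ..
      also have "\<dots> = 0" by (rule eq[OF \<phi>c])
      finally show "fourier G c = 0" .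
    qed
    then show ?thesis
    proof eventually_elim
      case (elim k)
      obtain \<sigma> \<xi> \<eta> where k: "k = (\<sigma>, \<xi>, \<eta>)" by (cases k) auto
      let ?\<omega> = "complex_of_real (\<eta> \<bullet> \<eta> - \<xi> \<bullet> \<xi>)"
      show ?case
      proof (intro impI)
        assume n: "norm k < real (Suc n)" and "fst k \<noteq> 0"
        then have \<sigma>: "complex_of_real \<sigma> \<noteq> 0" by (simp add: k)
        have "(- \<i> * \<sigma> * A k + ?\<omega> * B k) * fourier \<phi> k = 0"
          using elim unfolding G_def k fourier_dir_deriv[OF \<phi>] fourier_spatial_op[OF \<phi>]
          by (simp add: inner_prod_def algebra_simps)
        then have "\<i> * \<sigma> * A k = ?\<omega> * B k" using nz[OF n] by simp
        then have "\<sigma> * A k = - \<i> * (?\<omega> * B k)"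
          by (metis (no_types, lifting) complex_i_mult_minus minus_mult_minus mult.assoc mult_minus_left minus_minus)
        then have "A k = - \<i> * (?\<omega> / \<sigma>) * B k" using \<sigma> by (simp add: field_simps)
        then show "A k = - \<i> * time_frequency k * B k" by (simp add: k time_frequency_def)
      qed
    qed
  qed
  then have "AE k in lborel. \<forall>n. norm k < real (Suc n) \<longrightarrow> fst k \<noteq> 0 \<longrightarrow> A k = - \<i> * time_frequency k * B k"
    by (subst AE_all_countable) blast
  with AE_fst_neq_0 show ?thesis
  proof eventually_elim
    case (elim k)
    obtain n where "norm k < real n" using reals_Archimedean2 by blast
    then have "norm k < real (Suc n)" by simp
    then show ?case using elim by blast
  qed
qed

lemma time_frequency_uminus: "time_frequency (- k) = - time_frequency k"
  by (cases k) (simp add: time_frequency_def)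

lemma nice_time_frequency_mult:
  assumes "nice h" "\<And>k. h k \<noteq> 0 \<Longrightarrow> \<bar>time_frequency k\<bar> \<le> C"
  shows "nice (\<lambda>k. \<i> * time_frequency k * h k)"
  using assms by (intro nice_mult_bounded[where B=C]) (auto simp: norm_mult)

text \<open>The transposed form of the spectral relation. It mentions only \<open>X\<close>,
  \<open>Y\<close> and classical transforms; the sign differs from the one in the spectral
  relation because inversion reflects the frequency and \<open>time_frequency\<close> is odd.\<close>

lemma spectral_pairing:
  fixes X Y :: "real \<times> (real^'d) \<times> (real^'n) \<Rightarrow> complex"
  assumes X: "L2 X" and Y: "L2 Y"
    and eq: "\<And>\<phi>. test_function \<phi> \<Longrightarrow>
      (\<integral>z. X z * dir_deriv (1, 0, 0) \<phi> z \<partial>lborel) + (\<integral>z. Y z * spatial_op \<phi> z \<partial>lborel) = 0"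
    and h: "nice h" "\<And>k. h k \<noteq> 0 \<Longrightarrow> \<bar>time_frequency k\<bar> \<le> C"
  shows "(\<integral>z. X z * fourier h z \<partial>lborel) = (\<integral>z. Y z * fourier (\<lambda>k. \<i> * time_frequency k * h k) z \<partial>lborel)"
proof -
  obtain A B where A: "L2_fourier A X" and B: "L2_fourier B Y"
    using L2_fourier_onto X Y by blast
  let ?h = "\<lambda>k. \<i> * time_frequency k * h k"
  let ?c = "complex_of_real ((2 * pi) ^ DIM(real \<times> (real^'d) \<times> (real^'n)))"
  have h': "nice ?h" by (rule nice_time_frequency_mult[OF h])
  have [measurable]: "A \<in> borel_measurable borel" "B \<in> borel_measurable borel" "h \<in> borel_measurable borel"
    using L2_fourierD(1)[OF A] L2_fourierD(1)[OF B] h by (auto simp: L2_def nice_def)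
  have "(\<integral>z. X z * fourier h z \<partial>lborel) = (\<integral>k. A k * (?c * h (- k)) \<partial>lborel)"
    by (rule L2_fourier_duality[OF A L2_fourier_inversion[OF L2_fourier_nice[OF h(1)]]])
  also have "\<dots> = (\<integral>k. B k * (?c * ?h (- k)) \<partial>lborel)"
  proof (rule integral_cong_AE)
    have "AE k in lborel. A k = - \<i> * time_frequency k * B k"
      by (rule spectral_relation[OF A B eq])
    then show "AE k in lborel. A k * (?c * h (- k)) = B k * (?c * ?h (- k))"
      by eventually_elim (simp add: time_frequency_uminus)
  qed measurable
  also have "\<dots> = (\<integral>z. Y z * fourier ?h z \<partial>lborel)"
    by (rule L2_fourier_duality[OF B L2_fourier_inversion[OF L2_fourier_nice[OF h']], symmetric])
  finally show ?thesis .
qed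

section \<open>Borel versions\<close>

text \<open>Completeness of Lebesgue measure.\<close>

lemma borel_measurable_lebesgue_AE:
  fixes f g :: "'a::euclidean_space \<Rightarrow> 'b::topological_space"
  assumes "f \<in> borel_measurable lebesgue" "AE x in lebesgue. f x = g x"
  shows "g \<in> borel_measurable lebesgue"
proof (rule measurableI)
  fix A :: "'b set" assume A: "A \<in> sets borel"
  show "g -` A \<inter> space lebesgue \<in> sets lebesgue"
  proof (rule completion.in_sets_AE)
    show "f -` A \<inter> space lebesgue \<in> sets lebesgue" by (rule measurable_sets[OF assms(1) A])
    show "AE x in lebesgue. (x \<in> f -` A \<inter> space lebesgue) = (x \<in> g -` A \<inter> space lebesgue)"
      using assms(2) by eventually_elim simp
  qed simp
qed simp

lemma borel_version:
  fixes f :: "'a::euclidean_space \<Rightarrow> complex"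
  assumes "f \<in> borel_measurable lebesgue"
  shows "\<exists>g \<in> borel_measurable borel. AE x in lborel. f x = g x"
proof -
  have re: "(\<lambda>x. Re (f x)) \<in> borel_measurable lebesgue" and im: "(\<lambda>x. Im (f x)) \<in> borel_measurable lebesgue"
    using assms by measurable
  obtain a where a: "a \<in> borel_measurable lborel" "AE x in lborel. Re (f x) = a x"
    using completion_ex_borel_measurable_real[OF re] by blast
  obtain b where b: "b \<in> borel_measurable lborel" "AE x in lborel. Im (f x) = b x"
    using completion_ex_borel_measurable_real[OF im] by blast
  show ?thesis
  proof (intro bexI)
    show "AE x in lborel. f x = Complex (a x) (b x)"
      using a(2) b(2) by eventually_elim (simp add: complex_eq_iff)
    show "(\<lambda>x. Complex (a x) (b x)) \<in> borel_measurable borel"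
      using a(1) b(1) by (simp add: borel_measurable_complex_iff)
  qed
qed

lemma L2_version:
  assumes "square_integrable f"
  shows "\<exists>g. L2 g \<and> (AE x in lborel. f x = g x)"
proof -
  obtain g where g: "g \<in> borel_measurable borel" "AE x in lborel. f x = g x"
    using borel_version assms unfolding square_integrable_def by blast
  have m: "(\<lambda>z. (cmod (g z))\<^sup>2) \<in> borel_measurable lborel" using g by simp
  have "integrable lebesgue (\<lambda>z. (cmod (g z))\<^sup>2)"
  proof (rule integrable_cong_AE_imp)
    show "integrable lebesgue (\<lambda>z. (cmod (f z))\<^sup>2)" using assms by (simp add: square_integrable_def)
    show "(\<lambda>z. (cmod (g z))\<^sup>2) \<in> borel_measurable lebesgue" using m by (rule measurable_completion)
    show "AE z in lebesgue. (cmod (f z))\<^sup>2 = (cmod (g z))\<^sup>2"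
      using g(2) unfolding AE_completion_iff by eventually_elim simp
  qed
  then have "integrable lborel (\<lambda>z. (cmod (g z))\<^sup>2)" using m by (simp add: integrable_completion)
  then show ?thesis using g by (auto simp: L2_def)
qed

text \<open>Changing each \<open>v t\<close> on a null set makes it Borel measurable and does not change
  the curve in \<open>L\<^sub>2\<close>.\<close>

definition version_of :: "(real \<Rightarrow> 'a::euclidean_space \<Rightarrow> complex) \<Rightarrow> (real \<Rightarrow> 'a \<Rightarrow> complex) \<Rightarrow> bool" where
  "version_of u v \<longleftrightarrow> L2_curve u \<and> (\<forall>t. AE z in lborel. v t z = u t z)"

lemma L2_curve_version:
  assumes "L2_continuous_curve v" shows "\<exists>u. version_of u v"
proof -
  have v: "square_integrable (v t)" for t using assms by (simp add: L2_continuous_curve_def)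
  obtain u where u: "\<And>t. L2 (u t)" "\<And>t. AE z in lborel. v t z = u t z"
    using L2_version[OF v] by metis
  have [measurable]: "u t \<in> borel_measurable borel" for t using u(1)[of t] by (simp add: L2_def)
  have [measurable]: "v t \<in> borel_measurable lebesgue" for t using v[of t] by (simp add: square_integrable_def)
  have eq: "(L2_norm (\<lambda>z. v t z - v t0 z))\<^sup>2 = sq_norm (\<lambda>z. u t z - u t0 z)" for t t0
  proof -
    have m: "(\<lambda>z. (cmod (u t z - u t0 z))\<^sup>2) \<in> borel_measurable lborel" by measurable
    have "(\<integral>z. (cmod (v t z - v t0 z))\<^sup>2 \<partial>lebesgue) = (\<integral>z. (cmod (u t z - u t0 z))\<^sup>2 \<partial>lebesgue)"
    proof (rule integral_cong_AE)
      show "(\<lambda>z. (cmod (v t z - v t0 z))\<^sup>2) \<in> borel_measurable lebesgue"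
        by measurable
      show "(\<lambda>z. (cmod (u t z - u t0 z))\<^sup>2) \<in> borel_measurable lebesgue" using m by (rule measurable_completion)
      show "AE z in lebesgue. (cmod (v t z - v t0 z))\<^sup>2 = (cmod (u t z - u t0 z))\<^sup>2"
        unfolding AE_completion_iff using u(2)[of t] u(2)[of t0] by eventually_elim simp
    qed
    also have "\<dots> = sq_norm (\<lambda>z. u t z - u t0 z)" unfolding sq_norm_def by (rule integral_completion[OF m])
    finally show ?thesis by (simp add: L2_norm_def)
  qed
  have "((\<lambda>t. (L2_norm (\<lambda>z. v t z - v t0 z))\<^sup>2) \<longlongrightarrow> 0\<^sup>2) (at t0)" for t0
    using assms by (intro tendsto_intros) (simp add: L2_continuous_curve_def)
  then have "L2_curve u" unfolding eq L2_curve_def using u(1) by simp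
  then show ?thesis using u(2) by (auto simp: version_of_def)
qed

section \<open>Evolution of the spectral pairings\<close>

text \<open>For every \<open>t\<close> the inner integral does not depend on the representative, and with
  the curve \<open>u\<close> in place of the joint representative it is continuous in
  \<open>t\<close>.\<close>

lemma solution_tensor_identity:
  fixes v u :: "real \<Rightarrow> real \<times> (real^'d) \<times> (real^'n) \<Rightarrow> complex"
  assumes vc: "L2_continuous_curve v" and jr: "joint_representative v w" and ds: "distributional_solution w"
    and ver: "version_of u v" and \<theta>: "test_function \<theta>" and \<phi>: "test_function \<phi>"
  shows "(\<integral>t. dir_deriv 1 \<theta> t * (\<integral>z. u t z * dir_deriv (1, 0, 0) \<phi> z \<partial>lborel)
            + \<theta> t * (\<integral>z. u t z * spatial_op \<phi> z \<partial>lborel) \<partial>lborel) = 0"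
proof -
  let ?\<psi> = "\<lambda>p. \<theta> (fst p) * \<phi> (snd p)"
  have u: "L2_curve u" "\<And>t. AE z in lborel. v t z = u t z" using ver by (auto simp: version_of_def)
  note uL2 = L2_curveD(1)[OF u(1)]
  have um [measurable]: "u t \<in> borel_measurable borel" for t using uL2[of t] by (simp add: L2_def)
  have nP: "nice (dir_deriv (1, 0, 0) \<phi>)" and nQ: "nice (spatial_op \<phi>)"
    using nice_dir_deriv[OF \<phi>] nice_spatial_op[OF \<phi>] by auto
  have [measurable]: "dir_deriv (1, 0, 0) \<phi> \<in> borel_measurable borel" "spatial_op \<phi> \<in> borel_measurable borel"
    using nP nQ by (auto simp: nice_def)
  let ?F = "\<lambda>t. dir_deriv 1 \<theta> t * (\<integral>z. u t z * dir_deriv (1, 0, 0) \<phi> z \<partial>lborel) + \<theta> t * (\<integral>z. u t z * spatial_op \<phi> z \<partial>lborel)"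
  have inner: "(\<integral>z. w (t, z) * ultrahyperbolic_op ?\<psi> (t, z) \<partial>lebesgue) = ?F t" for t
  proof -
    let ?G = "\<lambda>z. dir_deriv 1 \<theta> t * dir_deriv (1, 0, 0) \<phi> z + \<theta> t * spatial_op \<phi> z"
    have m: "(\<lambda>z. u t z * ?G z) \<in> borel_measurable lborel" by measurable
    have ae: "AE z in lebesgue. u t z * ?G z = w (t, z) * ultrahyperbolic_op ?\<psi> (t, z)"
    proof -
      have "AE z in lborel. w (t, z) = v t z"
        using jr unfolding joint_representative_def AE_completion_iff by blast
      with u(2)[of t] show ?thesis
        unfolding AE_completion_iff ultrahyperbolic_op_tensor[OF \<theta> \<phi>] by eventually_elim simp
    qed
    have m': "(\<lambda>z. u t z * ?G z) \<in> borel_measurable lebesgue" using m by (rule measurable_completion)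
    have "(\<integral>z. w (t, z) * ultrahyperbolic_op ?\<psi> (t, z) \<partial>lebesgue) = (\<integral>z. u t z * ?G z \<partial>lebesgue)"
      by (rule integral_cong_AE[symmetric, OF m' borel_measurable_lebesgue_AE[OF m' ae] ae])
    also have "\<dots> = (\<integral>z. u t z * ?G z \<partial>lborel)" by (rule integral_completion[OF m])
    also have "\<dots> = (\<integral>z. dir_deriv 1 \<theta> t * (u t z * dir_deriv (1, 0, 0) \<phi> z) + \<theta> t * (u t z * spatial_op \<phi> z) \<partial>lborel)"
      by (simp add: algebra_simps)
    also have "\<dots> = ?F t"
      using L2_mult_integrable[OF uL2 nice_L2[OF nP], of t] L2_mult_integrable[OF uL2 nice_L2[OF nQ], of t]
      by (subst Bochner_Integration.integral_add) auto
    finally show ?thesis .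
  qed
  have "?F \<in> borel_measurable lborel"
    using borel_measurable_continuous_onI[OF L2_curve_pairing_continuous[OF u(1) nice_L2[OF nP]]]
      borel_measurable_continuous_onI[OF L2_curve_pairing_continuous[OF u(1) nice_L2[OF nQ]]]
      test_function_nice[OF \<theta>] nice_dir_deriv[OF \<theta>, of 1] by (auto simp: nice_def)
  then have "(\<integral>t. ?F t \<partial>lborel) = (\<integral>t. ?F t \<partial>lebesgue)" by (rule integral_completion[symmetric])
  also have "\<dots> = 0"
    using ds test_function_tensor[OF \<theta> \<phi>] unfolding distributional_solution_def inner[symmetric] by blast
  finally show ?thesis .
qed

text \<open>A Borel function that agrees almost everywhere with the joint representative agrees with it on
  almost every slice, and this is enough for integrals over \<open>t\<close>.\<close>

lemma joint_borel_version:
  assumes jr: "joint_representative v w" and ver: "version_of u v"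
  shows "\<exists>W \<in> borel_measurable borel. AE t in lborel. AE z in lborel. W (t, z) = u t z"
proof -
  obtain W where W: "W \<in> borel_measurable borel" "AE p in lborel. w p = W p"
    using borel_version jr unfolding joint_representative_def by blast
  have "AE t in lborel. AE z in lborel. w (t, z) = W (t, z)"
    using W(2) unfolding lborel_prod[symmetric] by (rule lborel_pair.AE_pair)
  then have "AE t in lborel. AE z in lborel. W (t, z) = u t z"
  proof eventually_elim
    case (elim t)
    have "AE z in lborel. w (t, z) = v t z"
      using jr unfolding joint_representative_def AE_completion_iff by blast
    moreover have "AE z in lborel. v t z = u t z" using ver by (simp add: version_of_def)
    ultimately show ?case using elim by eventually_elim simp
  qed
  then show ?thesis using W(1) by blast
qed

text \<open>Averaged against \<open>\<theta>'\<close> and \<open>\<theta>\<close>, the two pairings agree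
  by the transposed spectral relation, so that the first is an antiderivative of minus the
  second. The bound on \<open>time_frequency\<close> over the support of \<open>h\<close> keeps
  the product in the class of nice functions, so that the formula can be iterated.\<close>

proposition spectral_evolution:
  fixes v u :: "real \<Rightarrow> real \<times> (real^'d) \<times> (real^'n) \<Rightarrow> complex"
  assumes vc: "L2_continuous_curve v" and se: "solves_equation v" and ver: "version_of u v"
    and h: "nice h" "\<And>k. h k \<noteq> 0 \<Longrightarrow> \<bar>time_frequency k\<bar> \<le> C"
  shows "((\<lambda>t. \<integral>z. u t z * fourier h z \<partial>lborel) has_vector_derivative
     - (\<integral>z. u t z * fourier (\<lambda>k. \<i> * time_frequency k * h k) z \<partial>lborel)) (at t)"
proof (rule du_Bois_Reymond)
  obtain w where jr: "joint_representative v w" and ds: "distributional_solution w"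
    using se unfolding solves_equation_def by blast
  have u: "L2_curve u" using ver by (simp add: version_of_def)
  obtain W where W: "W \<in> borel_measurable borel" "AE t in lborel. AE z in lborel. W (t, z) = u t z"
    using joint_borel_version[OF jr ver] by blast
  have h': "nice (\<lambda>k. \<i> * time_frequency k * h k)" by (rule nice_time_frequency_mult[OF h])
  note FL = Plancherel_nice(1)[OF h(1)] Plancherel_nice(1)[OF h']
  show "continuous_on UNIV (\<lambda>t. \<integral>z. u t z * fourier h z \<partial>lborel)"
    by (rule L2_curve_pairing_continuous[OF u FL(1)])
  show "continuous_on UNIV (\<lambda>t. \<integral>z. u t z * fourier (\<lambda>k. \<i> * time_frequency k * h k) z \<partial>lborel)"
    by (rule L2_curve_pairing_continuous[OF u FL(2)])
  fix \<theta> :: "real \<Rightarrow> complex" assume \<theta>: "test_function \<theta>"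
  obtain X where X: "L2 X" "\<And>p. L2 p \<Longrightarrow> (\<integral>z. X z * p z \<partial>lborel) = (\<integral>t. dir_deriv 1 \<theta> t * (\<integral>z. u t z * p z \<partial>lborel) \<partial>lborel)"
    using L2_time_average[OF W(1) u W(2) nice_dir_deriv[OF \<theta>]] by blast
  obtain Y where Y: "L2 Y" "\<And>p. L2 p \<Longrightarrow> (\<integral>z. Y z * p z \<partial>lborel) = (\<integral>t. \<theta> t * (\<integral>z. u t z * p z \<partial>lborel) \<partial>lborel)"
    using L2_time_average[OF W(1) u W(2) test_function_nice[OF \<theta>]] by blast
  have i: "integrable lborel (\<lambda>t. \<theta>' t * (\<integral>z. u t z * p z \<partial>lborel))" if "test_function \<theta>'" "L2 p" for \<theta>' p
  proof -
    note c = L2_curve_pairing_continuous[OF u that(2)]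
    have "nice (\<lambda>t. \<theta>' t * (\<integral>z. u t z * p z \<partial>lborel))"
    proof (rule nice_continuous_compact)
      show "continuous_on UNIV (\<lambda>t. \<theta>' t * (\<integral>z. u t z * p z \<partial>lborel))"
        by (intro continuous_intros c test_functionD(3)[OF that(1)])
      show "compact (closure {z. \<theta>' z \<noteq> 0})" using that by (simp add: test_function_def)
      show "\<theta>' t * (\<integral>z. u t z * p z \<partial>lborel) = 0" if "t \<notin> closure {z. \<theta>' z \<noteq> 0}" for t
        using zero_outside_support[OF that] by simp
    qed
    then show ?thesis by (rule nice_integrable)
  qed
  have eq: "(\<integral>z. X z * dir_deriv (1, 0, 0) \<phi> z \<partial>lborel) + (\<integral>z. Y z * spatial_op \<phi> z \<partial>lborel) = 0"
    if \<phi>: "test_function \<phi>" for \<phi>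
  proof -
    note P = nice_L2[OF nice_dir_deriv[OF \<phi>]] and Q = nice_L2[OF nice_spatial_op[OF \<phi>]]
    show ?thesis
      using solution_tensor_identity[OF vc jr ds ver \<theta> \<phi>]
        i[OF test_function_dir_deriv[OF \<theta>] P, of 1 "(1, 0, 0)"] i[OF \<theta> Q]
      by (simp add: X(2)[OF P] Y(2)[OF Q])
  qed
  have "(\<integral>z. X z * fourier h z \<partial>lborel) = (\<integral>z. Y z * fourier (\<lambda>k. \<i> * time_frequency k * h k) z \<partial>lborel)"
    by (rule spectral_pairing[OF X(1) Y(1) eq h])
  then show "(\<integral>s. dir_deriv 1 \<theta> s * (\<integral>z. u s z * fourier h z \<partial>lborel) \<partial>lborel)
      = (\<integral>s. \<theta> s * (\<integral>z. u s z * fourier (\<lambda>k. \<i> * time_frequency k * h k) z \<partial>lborel) \<partial>lborel)"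
    by (simp only: X(2)[OF FL(1)] Y(2)[OF FL(2)])
qed

section \<open>Uniqueness\<close>

lemma sq_norm_frequency_power:
  fixes h :: "real \<times> (real^'d) \<times> (real^'n) \<Rightarrow> complex"
  assumes "nice h" "\<And>k. h k \<noteq> 0 \<Longrightarrow> \<bar>time_frequency k\<bar> \<le> C" "0 \<le> C"
  shows "nice (\<lambda>k. (\<i> * time_frequency k) ^ m * h k)" 
    "sq_norm (\<lambda>k. (\<i> * time_frequency k) ^ m * h k) \<le> (C ^ m)\<^sup>2 * sq_norm h"
proof -
  have le: "cmod ((\<i> * time_frequency k) ^ m) \<le> C ^ m" if "h k \<noteq> 0" for k
    using power_mono[OF assms(2)[OF that], of m] by (simp add: norm_power norm_mult)
  have [measurable]: "h \<in> borel_measurable borel" using assms(1) by (simp add: nice_def)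
  show "nice (\<lambda>k. (\<i> * time_frequency k) ^ m * h k)"
    by (rule nice_mult_bounded[OF assms(1) _ le]) measurable
  show "sq_norm (\<lambda>k. (\<i> * time_frequency k) ^ m * h k) \<le> (C ^ m)\<^sup>2 * sq_norm h"
  proof (rule L2_dominated(2)[OF nice_L2[OF assms(1)]])
    show "cmod ((\<i> * time_frequency k) ^ m * h k) \<le> C ^ m * cmod (h k)" for k
      using le[of k] by (cases "h k = 0") (auto simp: norm_mult intro: mult_right_mono)
  qed measurable
qed

text \<open>The difference of the two solutions, paired with \<open>fourier (H m)\<close> for \<open>H m k
  = (\<i> * time_frequency k) ^ m * h k\<close>, gives a sequence of functions of
  \<open>t\<close> in which each is minus the derivative of the one before, all vanish at
  \<open>0\<close>, and the growth in \<open>m\<close> is at most that of \<open>C ^ m\<close>.\<close>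

lemma solutions_agree_on_bounded_frequencies:
  fixes v1 v2 u1 u2 :: "real \<Rightarrow> real \<times> (real^'d) \<times> (real^'n) \<Rightarrow> complex"
  assumes v1: "L2_continuous_curve v1" "solves_equation v1" "version_of u1 v1"
    and v2: "L2_continuous_curve v2" "solves_equation v2" "version_of u2 v2"
    and init: "AE z in lborel. u1 0 z = u2 0 z"
    and h: "nice h" "\<And>k. h k \<noteq> 0 \<Longrightarrow> \<bar>time_frequency k\<bar> \<le> C" "0 \<le> C"
  shows "(\<integral>z. (u1 t z - u2 t z) * fourier h z \<partial>lborel) = 0"
proof -
  have u: "L2_curve u1" "L2_curve u2" using v1 v2 by (auto simp: version_of_def)
  define H where "H m k = (\<i> * time_frequency k) ^ m * h k" for m k
  have Hn: "nice (H m)" and Hs: "sq_norm (H m) \<le> (C ^ m)\<^sup>2 * sq_norm h" for m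
    unfolding H_def using sq_norm_frequency_power[OF h] by auto
  have Hb: "\<bar>time_frequency k\<bar> \<le> C" if "H m k \<noteq> 0" for m k using that h(2)[of k] by (auto simp: H_def)
  have HS: "(\<lambda>k. \<i> * time_frequency k * H m k) = H (Suc m)" for m by (auto simp: H_def fun_eq_iff)
  note FL = Plancherel_nice(1)[OF Hn]
  define \<alpha> where "\<alpha> m t = (\<integral>z. u1 t z * fourier (H m) z \<partial>lborel) - (\<integral>z. u2 t z * fourier (H m) z \<partial>lborel)" for m t
  have \<alpha>: "\<alpha> m t = (\<integral>z. (u1 t z - u2 t z) * fourier (H m) z \<partial>lborel)" for m t
    unfolding \<alpha>_def left_diff_distrib
    by (intro Bochner_Integration.integral_diff[symmetric] L2_mult_integrable L2_curveD(1)[OF u(1)] L2_curveD(1)[OF u(2)] FL)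
  have d: "(\<alpha> m has_vector_derivative - \<alpha> (Suc m) s) (at s)" for m s
    using has_vector_derivative_diff[OF spectral_evolution[OF v1 Hn[of m] Hb, where t=s] spectral_evolution[OF v2 Hn[of m] Hb, where t=s]]
    unfolding HS \<alpha>_def[abs_def] by simp
  have z: "\<alpha> m 0 = 0" for m
  proof -
    have "(\<integral>z. (u1 0 z - u2 0 z) * fourier (H m) z \<partial>lborel) = (\<integral>z. 0 \<partial>(lborel :: (real \<times> (real^'d) \<times> (real^'n)) measure))"
      using L2_curveD(1)[OF u(1), of 0] L2_curveD(1)[OF u(2), of 0] FL[of m] init
      by (intro integral_cong_AE) (auto simp: L2_def)
    then show ?thesis by (simp add: \<alpha>)
  qed
  \<comment> \<open>Uniform bounds on the time interval between \<open>- \<bar>t\<bar>\<close> and \<open>\<bar>t\<bar>\<close>, independent of \<open>m\<close>.\<close>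
  obtain M1 where M1: "\<And>s. \<bar>s\<bar> \<le> \<bar>t\<bar> \<Longrightarrow> sq_norm (u1 s) \<le> M1" using L2_curve_bounded[OF u(1)] by blast
  obtain M2 where M2: "\<And>s. \<bar>s\<bar> \<le> \<bar>t\<bar> \<Longrightarrow> sq_norm (u2 s) \<le> M2" using L2_curve_bounded[OF u(2)] by blast
  let ?c = "(2 * pi) ^ DIM(real \<times> (real^'d) \<times> (real^'n))"
  let ?K = "sqrt ((2 * M1 + 2 * M2) * (?c * sq_norm h))"
  have bd: "cmod (\<alpha> m s) \<le> ?K * C ^ m" if s: "\<bar>s\<bar> \<le> \<bar>t\<bar>" for m s
  proof -
    have "sq_norm (\<lambda>z. u1 s z - u2 s z) \<le> 2 * M1 + 2 * M2"
      using L2_diff(2)[OF L2_curveD(1)[OF u(1), of s] L2_curveD(1)[OF u(2), of s]] M1[OF s] M2[OF s] by simp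
    moreover have "sq_norm (fourier (H m)) \<le> ?c * ((C ^ m)\<^sup>2 * sq_norm h)"
      using Hs[of m] by (simp add: Plancherel_nice(2)[OF Hn])
    ultimately have "sq_norm (\<lambda>z. u1 s z - u2 s z) * sq_norm (fourier (H m)) \<le> (2 * M1 + 2 * M2) * (?c * ((C ^ m)\<^sup>2 * sq_norm h))"
      by (intro mult_mono order_trans[OF sq_norm_nonneg]) auto
    then have "(cmod (\<alpha> m s))\<^sup>2 \<le> (2 * M1 + 2 * M2) * (?c * ((C ^ m)\<^sup>2 * sq_norm h))"
      using L2_Cauchy_Schwarz[OF L2_diff(1)[OF L2_curveD(1)[OF u(1), of s] L2_curveD(1)[OF u(2), of s]] FL[of m]]
      unfolding \<alpha> by linarith
    also have "\<dots> = ((2 * M1 + 2 * M2) * (?c * sq_norm h)) * (C ^ m)\<^sup>2" by (simp only: ac_simps)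
    finally have "cmod (\<alpha> m s) \<le> sqrt (((2 * M1 + 2 * M2) * (?c * sq_norm h)) * (C ^ m)\<^sup>2)"
      by (rule real_le_rsqrt)
    also have "\<dots> = ?K * C ^ m" using h(3) by (simp only: real_sqrt_mult real_sqrt_abs abs_of_nonneg zero_le_power)
    finally show ?thesis .
  qed
  have "\<alpha> 0 t = 0" by (rule iterated_derivative_zero[OF d z bd]) auto
  moreover have "H 0 = h" by (auto simp: H_def)
  ultimately show ?thesis by (simp only: \<alpha>)
qed

text \<open>The frequencies with \<open>\<bar>time_frequency k\<bar> \<le> n\<close> exhaust the whole
  space as \<open>n\<close> grows.\<close>

proposition Cauchy_problem_uniqueness:
  fixes v1 v2 :: "real \<Rightarrow> real \<times> (real^'d) \<times> (real^'n) \<Rightarrow> complex"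
    and v0 :: "real \<times> (real^'d) \<times> (real^'n) \<Rightarrow> complex"
  assumes "solves_Cauchy_problem v0 v1" "solves_Cauchy_problem v0 v2"
  shows "AE z in lebesgue. v1 t z = v2 t z"
proof -
  have v1: "L2_continuous_curve v1" "solves_equation v1" "AE z in lborel. v1 0 z = v0 z"
    and v2: "L2_continuous_curve v2" "solves_equation v2" "AE z in lborel. v2 0 z = v0 z"
    using assms by (auto simp: solves_Cauchy_problem_def AE_completion_iff)
  obtain u1 u2 where u: "version_of u1 v1" "version_of u2 v2"
    using L2_curve_version v1(1) v2(1) by metis
  have ae: "\<And>t. AE z in lborel. v1 t z = u1 t z" "\<And>t. AE z in lborel. v2 t z = u2 t z"
    and L: "L2_curve u1" "L2_curve u2"
    using u by (auto simp: version_of_def)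
  have init: "AE z in lborel. u1 0 z = u2 0 z"
    using ae(1)[of 0] ae(2)[of 0] v1(3) v2(3) by eventually_elim simp
  let ?w = "\<lambda>z. u1 t z - u2 t z"
  have wL: "L2 ?w" by (intro L2_diff(1) L2_curveD(1)[OF L(1)] L2_curveD(1)[OF L(2)])
  obtain U where U: "L2_fourier ?w U" using L2_fourier_exists[OF wL] by blast
  have [measurable]: "U \<in> borel_measurable borel" using L2_fourierD(2)[OF U] by (simp add: L2_def)
  have "AE k in lborel. indicator {k. \<bar>time_frequency k\<bar> \<le> real n} k * U k = 0" for n
  proof (rule L2_AE_zero_of_duality)
    let ?I = "indicator {k. \<bar>time_frequency k\<bar> \<le> real n} :: real \<times> (real^'d) \<times> (real^'n) \<Rightarrow> complex"
    have S: "{k :: real \<times> (real^'d) \<times> (real^'n). \<bar>time_frequency k\<bar> \<le> real n} \<in> sets borel"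
    proof -
      have "{k \<in> space borel. \<bar>time_frequency (k :: real \<times> (real^'d) \<times> (real^'n))\<bar> \<le> real n} \<in> sets borel" by measurable
      then show ?thesis by simp
    qed
    then have I: "?I \<in> borel_measurable borel" by (rule borel_measurable_indicator)
    show "L2 (\<lambda>k. ?I k * U k)"
      by (rule L2_dominated(1)[OF L2_fourierD(2)[OF U], of _ 1]) (use I in \<open>auto simp: indicator_def norm_mult\<close>)
    fix g :: "real \<times> (real^'d) \<times> (real^'n) \<Rightarrow> complex" assume g: "nice g"
    have n: "nice (\<lambda>k. ?I k * g k)"
      by (rule nice_mult_bounded[OF g I, of 1]) (simp add: indicator_def)
    have "(\<integral>k. ?I k * U k * g k \<partial>lborel) = (\<integral>k. U k * (?I k * g k) \<partial>lborel)" by (simp add: ac_simps)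
    also have "\<dots> = (\<integral>z. ?w z * fourier (\<lambda>k. ?I k * g k) z \<partial>lborel)" by (rule L2_fourierD(3)[OF U n])
    also have "\<dots> = 0"
      by (rule solutions_agree_on_bounded_frequencies[OF v1(1,2) u(1) v2(1,2) u(2) init n, where C="real n"])
         (auto simp: indicator_def split: if_splits)
    finally show "(\<integral>k. ?I k * U k * g k \<partial>lborel) = 0" .
  qed
  then have "AE k in lborel. \<forall>n. indicator {k. \<bar>time_frequency k\<bar> \<le> real n} k * U k = 0"
    by (subst AE_all_countable) blast
  then have "AE k in lborel. U k = 0"
  proof eventually_elim
    case (elim k)
    obtain n where "\<bar>time_frequency k\<bar> \<le> real n" using real_arch_simple by blast
    then show ?case using elim[rule_format, of n] by (simp add: indicator_def)
  qed
  then have "sq_norm U = 0" using sq_norm_cong_AE[of U "\<lambda>k. 0"] by (simp add: sq_norm_def)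
  then have "sq_norm ?w = 0" using Plancherel[OF U] by simp
  from L2_AE_zero[OF wL this] have "AE z in lborel. v1 t z = v2 t z"
    using ae(1)[of t] ae(2)[of t] by eventually_elim simp
  then show ?thesis by (simp add: AE_completion_iff)
qed

lemma solves_Cauchy_problem_cong:
  assumes "AE z in lebesgue. v0 z = v0' z" "solves_Cauchy_problem v0 v"
  shows "solves_Cauchy_problem v0' v"
proof -
  have "AE z in lebesgue. v 0 z = v0 z" using assms(2) by (simp add: solves_Cauchy_problem_def)
  with assms(1) have "AE z in lebesgue. v 0 z = v0' z" by eventually_elim simp
  then show ?thesis using assms(2) by (simp add: solves_Cauchy_problem_def)
qed

theorem theorem1:
  fixes v\<^sub>0 :: "real \<times> (real^'d) \<times> (real^'n) \<Rightarrow> complex"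
  assumes "square_integrable v\<^sub>0"
  shows "\<exists>v. solves_Cauchy_problem v\<^sub>0 v \<and>
           (\<forall>w. solves_Cauchy_problem v\<^sub>0 w \<longrightarrow> (\<forall>t. AE z in lebesgue. w t z = v t z))"
proof -
  obtain g where g: "L2 g" "AE z in lborel. v\<^sub>0 z = g z" using L2_version[OF assms] by blast
  obtain v where "solves_Cauchy_problem g v" using Cauchy_problem_existence[OF g(1)] by blast
  then have "solves_Cauchy_problem v\<^sub>0 v"
    by (rule solves_Cauchy_problem_cong[rotated])
       (use g(2) in \<open>auto simp: AE_completion_iff elim: eventually_mono\<close>)
  then show ?thesis using Cauchy_problem_uniqueness by blast
qed

end
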